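(* Let $(K,\eta,g)$ be a $(2n+1)$-dimensional compact Einstein $K$-contact manifold. Assume that there exists a contact metric immersion of $K$ into $\mathbb{S}^{2N+1}$, equipped with its standard Sasakian structure, for some non-negative integer $N$. Then $K$ is Sasaki equivalent to $\mathbb{S}^{2n+1}$ with its standard Sasakian structure.
   Context: A contact metric manifold $(S,\eta,g)$ is a connected contact manifold $(S,\eta)$ of dimension $2n+1$ with a Riemannian metric $g$ such that the $(1,1)$-tensor $\phi$ defined by $d\eta(X,Y)=2g(X,\phi Y)$ satisfies $\phi^2X=-X+\eta(X)\xi$ and $g(\phi X,\phi Y)=g(X,Y)-\eta(X)\eta(Y)$, where $\xi$ is the Reeb vector field ($\eta(\xi)=1$, $i_\xi d\eta=0$). It is $K$-contact if $\xi$ is a Killing vector field. It is Einstein if $g$ is Einstein. It is Sasakian if $[\phi,\phi](X,Y)=-d\eta(X,Y)\xi$ for all vector fields $X,Y$, where $[\phi,\phi]$ is the Nijenhuis torsion of $\phi$: $[\phi,\phi](X,Y)=\phi^2[X,Y]+[\phi X,\phi Y]-\phi[\phi X,Y]-\phi[X,\phi Y]$. The standard Sasakian structure $(\eta_0,g_0)$ on $\mathbb{S}^{2m+1}\subset\mathbb{R}^{2m+2}$ consists of the usual round metric $g_0$ and the contact form $\eta_0$ induced by $\sum_{j=1}^{m+1}(x_jdy_j-y_jdx_j)$. A contact metric immersion $\varphi:(S_1,\eta_1,g_1)\to(S_2,\eta_2,g_2)$ between contact metric manifolds is an immersion with $\varphi^*g_2=g_1$, $\varphi^*\eta_2=\eta_1$,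 $\varphi_*\xi_1=\xi_2$ and $\varphi_*\circ\phi_1=\phi_2\circ\varphi_*$. Sasaki equivalence of $(S_1,\eta_1,g_1)$ and $(S_2,\eta_2,g_2)$ means that there is a diffeomorphism $F:S_1\to S_2$ with $F^*\eta_2=\eta_1$ and $F^*g_2=g_1$.
   Formalization: The formal theorem assumes n ≥ 1; for n = 0 the claim fails, since the circle of length 4π is compact, Einstein and K-contact and its double covering of the unit circle is a contact metric immersion, yet it is not Sasaki equivalent to the unit circle. *)

theory Defs
  imports "HOL-Analysis.Analysis" "HOL-Combinatorics.Permutations"
begin

section \<open>Smooth maps between open subsets of Euclidean spaces\<close>

primrec Ck_on :: "nat \<Rightarrow> 'e::euclidean_space set \<Rightarrow> ('e \<Rightarrow> 'b::real_normed_vector) \<Rightarrow> bool" where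
  "Ck_on 0 S f \<longleftrightarrow> continuous_on S f"
| "Ck_on (Suc k) S f \<longleftrightarrow>
     (\<forall>x\<in>S. f differentiable (at x)) \<and> (\<forall>v. Ck_on k S (\<lambda>x. frechet_derivative f (at x) v))"

text \<open>Derivatives are taken with respect to the ambient space, so this is only meant for open sets.\<close>

definition smooth_on :: "'e::euclidean_space set \<Rightarrow> ('e \<Rightarrow> 'b::real_normed_vector) \<Rightarrow> bool" where
  "smooth_on S f \<longleftrightarrow> (\<forall>k. Ck_on k S f)"

section \<open>Smooth manifolds\<close>

text \<open>A chart \<open>(U, \<psi>)\<close> consists of its domain and its coordinate map; the values of \<open>\<psi>\<close> outside
  \<open>U\<close> are irrelevant. The dimension of the manifold is that of the type \<open>'e\<close>.\<close>

type_synonym ('a, 'e) chart = "'a set \<times> ('a \<Rightarrow> 'e)"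

definition coord_image :: "('a, 'e) chart \<Rightarrow> 'e set" where
  "coord_image c = snd c ` fst c"

definition param :: "('a, 'e) chart \<Rightarrow> 'e \<Rightarrow> 'a" where
  "param c = inv_into (fst c) (snd c)"

definition local_dom :: "('a \<Rightarrow> 'b) \<Rightarrow> ('a, 'e) chart \<Rightarrow> ('b, 'f) chart \<Rightarrow> 'e set" where
  "local_dom F c c' = snd c ` {p \<in> fst c. F p \<in> fst c'}"

definition local_rep :: "('a \<Rightarrow> 'b) \<Rightarrow> ('a, 'e) chart \<Rightarrow> ('b, 'f) chart \<Rightarrow> 'e \<Rightarrow> 'f" where
  "local_rep F c c' = (\<lambda>x. snd c' (F (param c x)))"

definition local_deriv ::
  "('a \<Rightarrow> 'b) \<Rightarrow> ('a, 'e::euclidean_space) chart \<Rightarrow> ('b, 'f::euclidean_space) chart \<Rightarrow> 'e \<Rightarrow> 'e \<Rightarrow> 'f" where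
  "local_deriv F c c' x = frechet_derivative (local_rep F c c') (at x)"

definition smooth_manifold :: "'a topology \<Rightarrow> ('a, 'e::euclidean_space) chart set \<Rightarrow> bool" where
  "smooth_manifold X A \<longleftrightarrow>
     Hausdorff_space X \<and> second_countable X \<and>
     (\<forall>c\<in>A. openin X (fst c) \<and> open (coord_image c) \<and>
        homeomorphic_map (subtopology X (fst c)) (top_of_set (coord_image c)) (snd c)) \<and>
     (\<Union>c\<in>A. fst c) = topspace X \<and>
     (\<forall>c\<in>A. \<forall>c'\<in>A. smooth_on (local_dom id c c') (local_rep id c c'))"

definition smooth_map ::
  "'a topology \<Rightarrow> ('a, 'e::euclidean_space) chart set \<Rightarrow>
   'b topology \<Rightarrow> ('b, 'f::euclidean_space) chart set \<Rightarrow> ('a \<Rightarrow> 'b) \<Rightarrow> bool" where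
  "smooth_map X A Y B F \<longleftrightarrow>
     continuous_map X Y F \<and>
     (\<forall>c\<in>A. \<forall>c'\<in>B. smooth_on (local_dom F c c') (local_rep F c c'))"

definition immersion ::
  "'a topology \<Rightarrow> ('a, 'e::euclidean_space) chart set \<Rightarrow>
   'b topology \<Rightarrow> ('b, 'f::euclidean_space) chart set \<Rightarrow> ('a \<Rightarrow> 'b) \<Rightarrow> bool" where
  "immersion X A Y B F \<longleftrightarrow>
     smooth_map X A Y B F \<and>
     (\<forall>c\<in>A. \<forall>c'\<in>B. \<forall>x\<in>local_dom F c c'. inj (local_deriv F c c' x))"

definition diffeomorphism ::
  "'a topology \<Rightarrow> ('a, 'e::euclidean_space) chart set \<Rightarrow>
   'b topology \<Rightarrow> ('b, 'f::euclidean_space) chart set \<Rightarrow> ('a \<Rightarrow> 'b) \<Rightarrow> bool" where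
  "diffeomorphism X A Y B F \<longleftrightarrow>
     bij_betw F (topspace X) (topspace Y) \<and>
     smooth_map X A Y B F \<and> smooth_map Y B X A (inv_into (topspace X) F)"

section \<open>Tensor fields\<close>

text \<open>A covariant tensor field is the family of its coordinate expressions: the first argument is a
  chart \<open>c\<close>, the second a point of \<open>coord_image c\<close>, the remaining ones are tangent vectors in the
  coordinates \<open>c\<close>. Being well defined on the manifold amounts to invariance under pullback by the
  identity, i.e. under changes of coordinates.\<close>

type_synonym ('a, 'e) covector_field = "('a, 'e) chart \<Rightarrow> 'e \<Rightarrow> 'e \<Rightarrow> real"
type_synonym ('a, 'e) bilinear_field = "('a, 'e) chart \<Rightarrow> 'e \<Rightarrow> 'e \<Rightarrow> 'e \<Rightarrow> real"

definition pulls_back_form ::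
  "('a, 'e::euclidean_space) chart set \<Rightarrow> ('b, 'f::euclidean_space) chart set \<Rightarrow> ('a \<Rightarrow> 'b) \<Rightarrow>
   ('b, 'f) covector_field \<Rightarrow> ('a, 'e) covector_field \<Rightarrow> bool" where
  "pulls_back_form A B F \<beta> \<alpha> \<longleftrightarrow>
     (\<forall>c\<in>A. \<forall>c'\<in>B. \<forall>x\<in>local_dom F c c'. \<forall>v.
        \<beta> c' (local_rep F c c' x) (local_deriv F c c' x v) = \<alpha> c x v)"

definition pulls_back_metric ::
  "('a, 'e::euclidean_space) chart set \<Rightarrow> ('b, 'f::euclidean_space) chart set \<Rightarrow> ('a \<Rightarrow> 'b) \<Rightarrow>
   ('b, 'f) bilinear_field \<Rightarrow> ('a, 'e) bilinear_field \<Rightarrow> bool" where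
  "pulls_back_metric A B F h g \<longleftrightarrow>
     (\<forall>c\<in>A. \<forall>c'\<in>B. \<forall>x\<in>local_dom F c c'. \<forall>u v.
        h c' (local_rep F c c' x) (local_deriv F c c' x u) (local_deriv F c c' x v) = g c x u v)"

definition one_form :: "('a, 'e::euclidean_space) chart set \<Rightarrow> ('a, 'e) covector_field \<Rightarrow> bool" where
  "one_form A \<eta> \<longleftrightarrow>
     (\<forall>c\<in>A. \<forall>x\<in>coord_image c. linear (\<eta> c x)) \<and>
     (\<forall>c\<in>A. \<forall>v. smooth_on (coord_image c) (\<lambda>x. \<eta> c x v)) \<and>
     pulls_back_form A A id \<eta> \<eta>"

definition riemannian_metric :: "('a, 'e::euclidean_space) chart set \<Rightarrow> ('a, 'e) bilinear_field \<Rightarrow> bool" where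
  "riemannian_metric A g \<longleftrightarrow>
     (\<forall>c\<in>A. \<forall>x\<in>coord_image c.
        bilinear (g c x) \<and> (\<forall>u v. g c x u v = g c x v u) \<and> (\<forall>v. v \<noteq> 0 \<longrightarrow> g c x v v > 0)) \<and>
     (\<forall>c\<in>A. \<forall>u v. smooth_on (coord_image c) (\<lambda>x. g c x u v)) \<and>
     pulls_back_metric A A id g g"

text \<open>Exterior derivative with the convention
  \<open>d\<eta>(X,Y) = X(\<eta>(Y)) - Y(\<eta>(X)) - \<eta>([X,Y])\<close> (no factor 1/2), written for coordinate fields
  \<open>X = u\<close>, \<open>Y = v\<close>, whose bracket vanishes.\<close>

definition ext_deriv :: "('a, 'e::euclidean_space) covector_field \<Rightarrow> ('a, 'e) bilinear_field" where
  "ext_deriv \<eta> c x u v =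
     frechet_derivative (\<lambda>y. \<eta> c y v) (at x) u - frechet_derivative (\<lambda>y. \<eta> c y u) (at x) v"

text \<open>The value of \<open>\<eta> \<and> (d\<eta>)^n\<close> on the vectors \<open>v 0, \<dots>, v (2 * n)\<close>.\<close>

definition contact_volume ::
  "nat \<Rightarrow> ('a, 'e::euclidean_space) covector_field \<Rightarrow> ('a, 'e) chart \<Rightarrow> 'e \<Rightarrow> (nat \<Rightarrow> 'e) \<Rightarrow> real" where
  "contact_volume n \<eta> c x v =
     (\<Sum>\<sigma> | \<sigma> permutes {0..2*n}. of_int (sign \<sigma>) * \<eta> c x (v (\<sigma> 0)) *
        (\<Prod>i=1..n. ext_deriv \<eta> c x (v (\<sigma> (2*i-1))) (v (\<sigma> (2*i))))) / 2^n"

section \<open>Curvature\<close>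

text \<open>\<open>levi_civita g c x u v\<close> is the covariant derivative at \<open>x\<close>, in direction \<open>u\<close>, of the
  vector field with constant coordinates \<open>v\<close>; its components are the Christoffel symbols. It is
  given by the Koszul formula.\<close>

definition levi_civita :: "('a, 'e::euclidean_space) bilinear_field \<Rightarrow> ('a, 'e) chart \<Rightarrow> 'e \<Rightarrow> 'e \<Rightarrow> 'e \<Rightarrow> 'e" where
  "levi_civita g c x u v = (THE w. \<forall>z. 2 * g c x w z =
       frechet_derivative (\<lambda>y. g c y v z) (at x) u
     + frechet_derivative (\<lambda>y. g c y u z) (at x) v
     - frechet_derivative (\<lambda>y. g c y u v) (at x) z)"

text \<open>\<open>R(u,v)w = \<nabla>\<^sub>u \<nabla>\<^sub>v w - \<nabla>\<^sub>v \<nabla>\<^sub>u w\<close> for coordinate fields \<open>u\<close>, \<open>v\<close>, \<open>w\<close>.\<close>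

definition riemann :: "('a, 'e::euclidean_space) bilinear_field \<Rightarrow> ('a, 'e) chart \<Rightarrow> 'e \<Rightarrow> 'e \<Rightarrow> 'e \<Rightarrow> 'e \<Rightarrow> 'e" where
  "riemann g c x u v w =
       (frechet_derivative (\<lambda>y. levi_civita g c y v w) (at x) u
        + levi_civita g c x u (levi_civita g c x v w))
     - (frechet_derivative (\<lambda>y. levi_civita g c y u w) (at x) v
        + levi_civita g c x v (levi_civita g c x u w))"

text \<open>\<open>Ric(v,w)\<close> is the trace of \<open>u \<mapsto> R(u,v)w\<close>.\<close>

definition ricci :: "('a, 'e::euclidean_space) bilinear_field \<Rightarrow> ('a, 'e) bilinear_field" where
  "ricci g c x v w = (\<Sum>b\<in>Basis. riemann g c x b v w \<bullet> b)"

definition einstein_metric :: "('a, 'e::euclidean_space) chart set \<Rightarrow> ('a, 'e) bilinear_field \<Rightarrow> bool" where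
  "einstein_metric A g \<longleftrightarrow>
     (\<exists>l::real. \<forall>c\<in>A. \<forall>x\<in>coord_image c. \<forall>v w. ricci g c x v w = l * g c x v w)"

section \<open>Contact metric manifolds\<close>

record ('a, 'e) contact_metric_data =
  underlying :: "'a topology"
  atlas :: "('a, 'e) chart set"
  contact_form :: "('a, 'e) covector_field"
  metric_tensor :: "('a, 'e) bilinear_field"

definition reeb :: "('a, 'e::euclidean_space) contact_metric_data \<Rightarrow> ('a, 'e) chart \<Rightarrow> 'e \<Rightarrow> 'e" where
  "reeb S c x = (THE w. contact_form S c x w = 1 \<and> (\<forall>v. ext_deriv (contact_form S) c x w v = 0))"

definition phi :: "('a, 'e::euclidean_space) contact_metric_data \<Rightarrow> ('a, 'e) chart \<Rightarrow> 'e \<Rightarrow> 'e \<Rightarrow> 'e" where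
  "phi S c x v = (THE w. \<forall>u. ext_deriv (contact_form S) c x u v = 2 * metric_tensor S c x u w)"

definition contact_manifold :: "nat \<Rightarrow> ('a, 'e::euclidean_space) contact_metric_data \<Rightarrow> bool" where
  "contact_manifold n S \<longleftrightarrow>
     smooth_manifold (underlying S) (atlas S) \<and> DIM('e) = 2 * n + 1 \<and>
     one_form (atlas S) (contact_form S) \<and>
     (\<forall>c\<in>atlas S. \<forall>x\<in>coord_image c. \<exists>v. contact_volume n (contact_form S) c x v \<noteq> 0)"

text \<open>The empty space counts as connected in the library, hence the extra condition.\<close>

definition contact_metric_manifold :: "nat \<Rightarrow> ('a, 'e::euclidean_space) contact_metric_data \<Rightarrow> bool" where
  "contact_metric_manifold n S \<longleftrightarrow>
     contact_manifold n S \<and>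
     connected_space (underlying S) \<and> topspace (underlying S) \<noteq> {} \<and>
     riemannian_metric (atlas S) (metric_tensor S) \<and>
     (\<forall>c\<in>atlas S. \<forall>x\<in>coord_image c.
        (\<forall>u. phi S c x (phi S c x u) = - u + contact_form S c x u *\<^sub>R reeb S c x) \<and>
        (\<forall>u v. metric_tensor S c x (phi S c x u) (phi S c x v) =
           metric_tensor S c x u v - contact_form S c x u * contact_form S c x v))"

text \<open>\<open>reeb_killing\<close> is the vanishing of the Lie derivative of the metric along the Reeb field,
  \<open>\<xi>(g(u,v)) - g([\<xi>,u],v) - g(u,[\<xi>,v]) = 0\<close>; for a coordinate field \<open>u\<close> the bracket \<open>[\<xi>,u]\<close> is
  minus the derivative of \<open>\<xi>\<close> in direction \<open>u\<close>.\<close>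

definition reeb_killing :: "('a, 'e::euclidean_space) contact_metric_data \<Rightarrow> bool" where
  "reeb_killing S \<longleftrightarrow>
     (\<forall>c\<in>atlas S. \<forall>x\<in>coord_image c. \<forall>u v.
        frechet_derivative (\<lambda>y. metric_tensor S c y u v) (at x) (reeb S c x)
        + metric_tensor S c x (frechet_derivative (reeb S c) (at x) u) v
        + metric_tensor S c x u (frechet_derivative (reeb S c) (at x) v) = 0)"

definition K_contact_manifold :: "nat \<Rightarrow> ('a, 'e::euclidean_space) contact_metric_data \<Rightarrow> bool" where
  "K_contact_manifold n S \<longleftrightarrow> contact_metric_manifold n S \<and> reeb_killing S"

definition contact_metric_immersion ::
  "('a, 'e::euclidean_space) contact_metric_data \<Rightarrow> ('b, 'f::euclidean_space) contact_metric_data \<Rightarrow>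
   ('a \<Rightarrow> 'b) \<Rightarrow> bool" where
  "contact_metric_immersion S T F \<longleftrightarrow>
     immersion (underlying S) (atlas S) (underlying T) (atlas T) F \<and>
     pulls_back_metric (atlas S) (atlas T) F (metric_tensor T) (metric_tensor S) \<and>
     pulls_back_form (atlas S) (atlas T) F (contact_form T) (contact_form S) \<and>
     (\<forall>c\<in>atlas S. \<forall>c'\<in>atlas T. \<forall>x\<in>local_dom F c c'.
        local_deriv F c c' x (reeb S c x) = reeb T c' (local_rep F c c' x) \<and>
        (\<forall>v. local_deriv F c c' x (phi S c x v) =
             phi T c' (local_rep F c c' x) (local_deriv F c c' x v)))"

definition sasaki_equivalent ::
  "('a, 'e::euclidean_space) contact_metric_data \<Rightarrow> ('b, 'f::euclidean_space) contact_metric_data \<Rightarrow> bool" where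
  "sasaki_equivalent S T \<longleftrightarrow>
     (\<exists>F. diffeomorphism (underlying S) (atlas S) (underlying T) (atlas T) F \<and>
        pulls_back_form (atlas S) (atlas T) F (contact_form T) (contact_form S) \<and>
        pulls_back_metric (atlas S) (atlas T) F (metric_tensor T) (metric_tensor S))"

section \<open>The standard Sasakian structure on odd-dimensional spheres\<close>

text \<open>With \<open>CARD('k) = m + 1\<close>, a point of \<open>real^'k \<times> real^'k\<close> is written \<open>(x, y)\<close> in the coordinates
  \<open>x\<^sub>j, y\<^sub>j\<close> of \<open>(2m+2)\<close>-space, so that its unit sphere has dimension \<open>2m+1\<close>; charts take values in
  any Euclidean space \<open>'f\<close> of that dimension. The atlas is the maximal one: it consists of the
  inverses of all smooth local parametrizations of the sphere.\<close>

definition sphere_atlas :: "((real^'k) \<times> (real^'k), 'f::euclidean_space) chart set" where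
  "sphere_atlas = {c. openin (top_of_set (sphere 0 1)) (fst c) \<and> open (coord_image c) \<and>
     homeomorphism (fst c) (coord_image c) (snd c) (param c) \<and>
     smooth_on (coord_image c) (param c) \<and>
     (\<forall>x\<in>coord_image c. inj (frechet_derivative (param c) (at x)))}"

definition ambient_form :: "(real^'k) \<times> (real^'k) \<Rightarrow> (real^'k) \<times> (real^'k) \<Rightarrow> real" where
  "ambient_form p w = (\<Sum>j\<in>UNIV. fst p $ j * snd w $ j - snd p $ j * fst w $ j)"

definition std_sphere :: "((real^'k) \<times> (real^'k), 'f::euclidean_space) contact_metric_data" where
  "std_sphere = \<lparr>
     underlying = top_of_set (sphere 0 1),
     atlas = sphere_atlas,
     contact_form = (\<lambda>c x v. ambient_form (param c x) (frechet_derivative (param c) (at x) v)),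
     metric_tensor = (\<lambda>c x u v.
       frechet_derivative (param c) (at x) u \<bullet> frechet_derivative (param c) (at x) v) \<rparr>"

end

theory Submission
  imports Defs
begin

text \<open>In a chart, write \<open>h\<close> for the immersion viewed as a map into \<open>\<real>\<^sup>2\<^sup>N\<^sup>+\<^sup>2\<close>, \<open>J (x, y) = (- y, x)\<close>, and \<open>C\<close> for
  the span of \<open>h\<close> and the image of \<open>Dh\<close>, the tangent space of the cone over the image. The contact metric
  conditions say exactly that \<open>C\<close> is \<open>J\<close>-invariant. Let \<open>P\<close> be the orthogonal projection onto \<open>C\<close> and
  \<open>Q u = D\<^sub>u P\<close>, so that \<open>Q u (Dh v)\<close> is the second fundamental form. As \<open>Q\<close> commutes with \<open>J\<close>, its trace
  vanishes and the Gauss equation becomes \<open>Ric v v = 2n \<bar>v\<bar>\<^sup>2 - (\<Sum>e. \<bar>Q e (Dh v)\<bar>\<^sup>2)\<close>; moreover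
  \<open>Q u (J h) = 0\<close>, so the Reeb direction shows that the Einstein constant is \<open>2n\<close>, and hence \<open>Q = 0\<close>. Thus
  \<open>C\<close> is one fixed complex subspace, isometric to \<open>\<complex>\<^sup>n\<^sup>+\<^sup>1\<close>, and the manifold is mapped by a local isometry
  to its unit sphere; by compactness this is a covering, hence a diffeomorphism as the sphere is simply
  connected.\<close>

section \<open>Smooth maps on open subsets of Euclidean space\<close>

text \<open>The second fundamental form takes values in a normal bundle, which has no fixed fibre
  and no preferred frame. The projection \<open>P\<close> avoids both: it takes values in the
  operators of one fixed space, its derivative needs no connection, and \<open>Q = 0\<close> says
  directly that the cone is locally constant. Passing from the sphere to the cone adds the radial
  direction, so that the odd-dimensional tangent space becomes a space of even real dimension on
  which \<open>J\<close> can act. The price is regularity: \<open>P\<close> comes from linear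
  systems that depend on the point, and charts of the sphere are known only through their inverse
  parametrizations, so smoothness has to be recovered from equations that a map satisfies. The
  hypothesis \<open>n \<ge> 1\<close> enters through the simple connectivity of the sphere. It
  cannot be dropped: for \<open>n = 0\<close>, a circle of length 2 pi k that winds k times around
  an orbit of the circle action generated by \<open>J\<close> satisfies everything else, and for k >
  1 it is not isometric to the unit circle.\<close>

abbreviation FD :: "('e::euclidean_space \<Rightarrow> 'b::real_normed_vector) \<Rightarrow> 'e \<Rightarrow> 'e \<Rightarrow> 'b"
  where "FD f x \<equiv> frechet_derivative f (at x)"

lemma has_derivative_FD: "f differentiable (at x) \<Longrightarrow> (f has_derivative FD f x) (at x)"
  by (simp add: frechet_derivative_works)

lemma FD_eq: "(f has_derivative f') (at x) \<Longrightarrow> FD f x = f'"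
  by (metis frechet_derivative_at)

lemma linear_FD: "f differentiable (at x) \<Longrightarrow> linear (FD f x)"
  by (rule linear_frechet_derivative)

lemma FD_cong:
  assumes "open S" "x \<in> S" "\<And>y. y \<in> S \<Longrightarrow> f y = g y" "f differentiable (at x)"
  shows "g differentiable (at x)" "FD g x = FD f x"
proof -
  have "(g has_derivative FD f x) (at x)"
    using has_derivative_transform_within_open[OF has_derivative_FD[OF assms(4)] assms(1,2)] assms(3)
    by blast
  then show "g differentiable (at x)" "FD g x = FD f x"
    using FD_eq differentiableI by blast+
qed

text \<open>Derivatives are ambient, so agreement on \<open>S\<close> passes to derivatives only
  because \<open>S\<close> is open; the induction then replaces both maps by their directional
  derivatives.\<close>

lemma Ck_on_cong:
  assumes "open S" "\<And>x. x \<in> S \<Longrightarrow> f x = g x" "Ck_on k S f"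
  shows "Ck_on k S g"
  using assms(2,3)
proof (induction k arbitrary: f g)
  case 0
  then show ?case using continuous_on_cong by (metis Ck_on.simps(1))
next
  case (Suc k)
  have d: "f differentiable (at x)" if "x \<in> S" for x using Suc.prems that by simp
  have "Ck_on k S (\<lambda>x. FD g x v)" for v
  proof (rule Suc.IH)
    show "Ck_on k S (\<lambda>x. FD f x v)" using Suc.prems by simp
    show "FD f x v = FD g x v" if "x \<in> S" for x
      using FD_cong(2)[OF assms(1) that Suc.prems(1) d[OF that]] by simp
  qed
  moreover have "g differentiable (at x)" if "x \<in> S" for x
    using FD_cong(1)[OF assms(1) that Suc.prems(1) d[OF that]] by blast
  ultimately show ?case by simp
qed

lemma Ck_on_subset: "Ck_on k S f \<Longrightarrow> T \<subseteq> S \<Longrightarrow> Ck_on k T f"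
  by (induction k arbitrary: f) (auto intro: continuous_on_subset)

lemma Ck_on_continuous: "Ck_on k S f \<Longrightarrow> continuous_on S f"
  by (cases k) (auto intro!: continuous_at_imp_continuous_on differentiable_imp_continuous_within)

lemma Ck_on_SucD: "Ck_on (Suc k) S f \<Longrightarrow> Ck_on k S f"
proof (induction k arbitrary: f)
  case 0
  then show ?case using Ck_on_continuous by (metis Ck_on.simps(1))
next
  case (Suc k)
  then show ?case by (metis Ck_on.simps(2))
qed

lemma Ck_on_local:
  assumes "\<And>x. x \<in> S \<Longrightarrow> \<exists>T. open T \<and> x \<in> T \<and> Ck_on k T f"
  shows "Ck_on k S f"
  using assms
proof (induction k arbitrary: f)
  case 0
  show ?case
  proof (simp, rule continuous_at_imp_continuous_on, rule)
    fix x assume "x \<in> S"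
    then show "isCont f x" using 0[of x] by (auto simp: continuous_on_eq_continuous_at)
  qed
next
  case (Suc k)
  have "Ck_on k S (\<lambda>x. FD f x v)" for v
  proof (rule Suc.IH)
    fix x assume "x \<in> S"
    then show "\<exists>T. open T \<and> x \<in> T \<and> Ck_on k T (\<lambda>x. FD f x v)" using Suc.prems[of x] by auto
  qed
  then show ?case using Suc.prems by fastforce
qed

lemma Ck_on_const: "Ck_on k S (\<lambda>x. c)"
  by (induction k arbitrary: c) (auto simp: frechet_derivative_const)

lemma Ck_on_linear:
  assumes "open S" "bounded_linear L" "Ck_on k S f"
  shows "Ck_on k S (\<lambda>x. L (f x))"
  using assms(3)
proof (induction k arbitrary: f)
  case 0
  then show ?case using assms(2) by (simp add: bounded_linear.continuous_on)
next
  case (Suc k)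
  have *: "((\<lambda>x. L (f x)) has_derivative (\<lambda>v. L (FD f x v))) (at x)" if "x \<in> S" for x
    using Suc.prems that bounded_linear.has_derivative[OF assms(2)] has_derivative_FD by fastforce
  have "Ck_on k S (\<lambda>x. FD (\<lambda>x. L (f x)) x v)" for v
    by (rule Ck_on_cong[OF assms(1) _ Suc.IH[of "\<lambda>x. FD f x v"]])
       (use Suc.prems FD_eq[OF *] in auto)
  then show ?case using * differentiableI by fastforce
qed

lemma Ck_on_id: "Ck_on k S (\<lambda>x. x)"
proof (cases k)
  case (Suc j)
  have "FD (\<lambda>x. x) x = (\<lambda>v. v)" for x :: 'a by (rule FD_eq) (rule has_derivative_ident)
  then show ?thesis using Suc Ck_on_const by auto
qed simp

lemma Ck_on_add:
  assumes "open S" "Ck_on k S f" "Ck_on k S g"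
  shows "Ck_on k S (\<lambda>x. f x + g x)"
  using assms(2,3)
proof (induction k arbitrary: f g)
  case 0
  then show ?case by (simp add: continuous_on_add)
next
  case (Suc k)
  have *: "((\<lambda>x. f x + g x) has_derivative (\<lambda>v. FD f x v + FD g x v)) (at x)" if "x \<in> S" for x
    using Suc.prems that by (intro has_derivative_add has_derivative_FD) auto
  have "Ck_on k S (\<lambda>x. FD (\<lambda>x. f x + g x) x v)" for v
    by (rule Ck_on_cong[OF assms(1) _ Suc.IH[of "\<lambda>x. FD f x v" "\<lambda>x. FD g x v"]])
       (use Suc.prems FD_eq[OF *] in auto)
  then show ?case using * differentiableI by fastforce
qed

lemma Ck_on_sum:
  assumes "open S" "\<And>i. i \<in> I \<Longrightarrow> Ck_on k S (f i)"
  shows "Ck_on k S (\<lambda>x. \<Sum>i\<in>I. f i x)"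
  using assms(2)
  by (induction I rule: infinite_finite_induct) (auto intro: Ck_on_const Ck_on_add[OF assms(1)])

text \<open>The two terms of the product rule are again values of \<open>B\<close>, each with one
  factor differentiated, so the induction must leave both \<open>f\<close> and \<open>g\<close>
  free.\<close>

lemma Ck_on_bilinear:
  assumes "open S" "bounded_bilinear B" "Ck_on k S f" "Ck_on k S g"
  shows "Ck_on k S (\<lambda>x. B (f x) (g x))"
  using assms(3,4)
proof (induction k arbitrary: f g)
  case 0
  then show ?case using assms(2) by (simp add: bounded_bilinear.continuous_on)
next
  case (Suc k)
  have *: "((\<lambda>x. B (f x) (g x)) has_derivative (\<lambda>v. B (f x) (FD g x v) + B (FD f x v) (g x))) (at x)"
    if "x \<in> S" for x
    using Suc.prems that by (intro bounded_bilinear.FDERIV[OF assms(2)] has_derivative_FD) auto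
  have fg: "Ck_on k S f" "Ck_on k S g"
    using Suc.prems Ck_on_SucD by (auto simp del: Ck_on.simps)
  have "Ck_on k S (\<lambda>x. B (f x) (FD g x v) + B (FD f x v) (g x))" for v
    using Suc.prems by (intro Ck_on_add assms(1) Suc.IH fg) auto
  then have "Ck_on k S (\<lambda>x. FD (\<lambda>x. B (f x) (g x)) x v)" for v
    by (rule Ck_on_cong[OF assms(1), rotated]) (simp only: FD_eq[OF *])
  then show ?case using * differentiableI by fastforce
qed

lemmas Ck_on_inner = Ck_on_bilinear[OF _ bounded_bilinear_inner]
  and Ck_on_scaleR = Ck_on_bilinear[OF _ bounded_bilinear_scaleR]

text \<open>The chain rule differentiates \<open>g\<close> in the direction \<open>FD f x v\<close>,
  which moves with \<open>x\<close>, whereas \<open>Ck_on\<close> controls fixed directions only.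
  Expanding that direction in \<open>Basis\<close> leaves finitely many maps \<open>FD g _ b\<close>
  composed with \<open>f\<close>, to which the induction hypothesis applies.\<close>

lemma Ck_on_compose:
  fixes f :: "'e::euclidean_space \<Rightarrow> 'f::euclidean_space" and g :: "'f \<Rightarrow> 'b::real_normed_vector"
  assumes "open S" "open T" "f \<in> S \<rightarrow> T" "Ck_on k S f" "Ck_on k T g"
  shows "Ck_on k S (\<lambda>x. g (f x))"
  using assms(4,5)
proof (induction k arbitrary: g)
  case 0
  then show ?case using assms(3) by (auto intro: continuous_on_compose2)
next
  case (Suc k)
  have *: "((\<lambda>x. g (f x)) has_derivative (\<lambda>v. FD g (f x) (FD f x v))) (at x)" if "x \<in> S" for x
  proof -
    have "(f has_derivative FD f x) (at x)" "(g has_derivative FD g (f x)) (at (f x))"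
      using Suc.prems that assms(3) by (auto intro!: has_derivative_FD)
    then show ?thesis by (rule has_derivative_compose)
  qed
  have eq: "(\<Sum>b\<in>Basis. (FD f x v \<bullet> b) *\<^sub>R FD g (f x) b) = FD (\<lambda>x. g (f x)) x v"
    if "x \<in> S" for x v
  proof -
    have "linear (FD g (f x))" using Suc.prems that assms(3) by (intro linear_FD) auto
    then have "FD g (f x) (\<Sum>b\<in>Basis. (FD f x v \<bullet> b) *\<^sub>R b)
        = (\<Sum>b\<in>Basis. (FD f x v \<bullet> b) *\<^sub>R FD g (f x) b)"
      by (simp add: linear_sum linear_scale)
    then show ?thesis using FD_eq[OF *[OF that]] by (simp add: euclidean_representation)
  qed
  have f: "Ck_on k S f" using Suc.prems Ck_on_SucD by blast
  have "Ck_on k S (\<lambda>x. FD (\<lambda>x. g (f x)) x v)" for v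
  proof (rule Ck_on_cong[OF assms(1) eq])
    show "Ck_on k S (\<lambda>x. \<Sum>b\<in>Basis. (FD f x v \<bullet> b) *\<^sub>R FD g (f x) b)"
      using Suc.prems f by (intro Ck_on_sum Ck_on_scaleR Ck_on_inner Ck_on_const assms(1) Suc.IH) auto
  qed
  then show ?case using * differentiableI by fastforce
qed

lemma Ck_on_inverse:
  fixes f :: "'e::euclidean_space \<Rightarrow> real"
  assumes "open S" "\<And>x. x \<in> S \<Longrightarrow> f x \<noteq> 0" "Ck_on k S f"
  shows "Ck_on k S (\<lambda>x. inverse (f x))"
  using assms(3)
proof (induction k)
  case 0
  then show ?case using assms(2) by (auto intro: continuous_on_inverse)
next
  case (Suc k)
  \<comment> \<open>The derivative is written as nested scalings, so that
    \<open>Ck_on_scaleR\<close> and the induction hypothesis settle its regularity.\<close>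
  have *: "((\<lambda>x. inverse (f x)) has_derivative
      (\<lambda>v. (- 1) *\<^sub>R (inverse (f x) *\<^sub>R (FD f x v *\<^sub>R inverse (f x))))) (at x)" if "x \<in> S" for x
  proof -
    have "(f has_derivative FD f x) (at x)" using Suc.prems that has_derivative_FD by auto
    from Deriv.has_derivative_inverse[OF assms(2)[OF that] this] show ?thesis by (simp add: mult.assoc)
  qed
  have i: "Ck_on k S (\<lambda>x. inverse (f x))" by (rule Suc.IH[OF Ck_on_SucD[OF Suc.prems]])
  have "Ck_on k S (\<lambda>x. (- 1) *\<^sub>R (inverse (f x) *\<^sub>R (FD f x v *\<^sub>R inverse (f x))))" for v
    using Suc.prems i by (intro Ck_on_scaleR Ck_on_const assms(1)) auto
  then have "Ck_on k S (\<lambda>x. FD (\<lambda>x. inverse (f x)) x v)" for v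
    by (rule Ck_on_cong[OF assms(1), rotated]) (simp only: FD_eq[OF *])
  then show ?case using * differentiableI by fastforce
qed

lemma smooth_onI: "(\<And>k. Ck_on k S f) \<Longrightarrow> smooth_on S f"
  by (simp add: smooth_on_def)

lemma smooth_onD: "smooth_on S f \<Longrightarrow> Ck_on k S f"
  by (simp add: smooth_on_def)

lemma smooth_on_cong:
  assumes "open S" "\<And>x. x \<in> S \<Longrightarrow> f x = g x" "smooth_on S f"
  shows "smooth_on S g"
  by (rule smooth_onI) (rule Ck_on_cong[OF assms(1,2) smooth_onD[OF assms(3)]])

lemma smooth_on_subset: "smooth_on S f \<Longrightarrow> T \<subseteq> S \<Longrightarrow> smooth_on T f"
  unfolding smooth_on_def by (auto intro: Ck_on_subset)

lemma smooth_on_local: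
  assumes "\<And>x. x \<in> S \<Longrightarrow> \<exists>T. open T \<and> x \<in> T \<and> smooth_on T f"
  shows "smooth_on S f"
proof (intro smooth_onI Ck_on_local)
  fix k x assume "x \<in> S"
  then show "\<exists>T. open T \<and> x \<in> T \<and> Ck_on k T f" using assms[of x] smooth_onD by metis
qed

lemma smooth_on_compose:
  fixes f :: "'e::euclidean_space \<Rightarrow> 'f::euclidean_space" and g :: "'f \<Rightarrow> 'b::real_normed_vector"
  assumes "open S" "open T" "f \<in> S \<rightarrow> T" "smooth_on S f" "smooth_on T g"
  shows "smooth_on S (\<lambda>x. g (f x))"
  by (rule smooth_onI) (rule Ck_on_compose[OF assms(1-3) smooth_onD[OF assms(4)] smooth_onD[OF assms(5)]])

lemma smooth_on_linear:
  assumes "open S" "bounded_linear L" "smooth_on S f"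
  shows "smooth_on S (\<lambda>x. L (f x))"
  by (rule smooth_onI) (rule Ck_on_linear[OF assms(1,2) smooth_onD[OF assms(3)]])

lemma smooth_on_differentiable: "smooth_on S f \<Longrightarrow> x \<in> S \<Longrightarrow> f differentiable (at x)"
  using smooth_onD[of S f "Suc 0"] by simp

lemma smooth_on_FD: "smooth_on S f \<Longrightarrow> smooth_on S (\<lambda>x. FD f x v)"
proof (rule smooth_onI)
  fix k assume "smooth_on S f"
  then show "Ck_on k S (\<lambda>x. FD f x v)" using smooth_onD[of S f "Suc k"] by simp
qed

lemma smooth_on_continuous: "smooth_on S f \<Longrightarrow> continuous_on S f"
  using smooth_onD[of S f 0] by simp

section \<open>Smooth dependence of solutions and symmetry of second derivatives\<close>

text \<open>Trades an argument that may vary with the point for the fixed vectors of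
  \<open>Basis\<close>; the device behind the product rules for families of linear maps.\<close>

lemma sum_family_linear:
  "linear F \<Longrightarrow> (\<Sum>b\<in>Basis. (w \<bullet> b) *\<^sub>R F b) = F w" for w :: "'e::euclidean_space"
  using linear_sum[of F "\<lambda>b. (w \<bullet> b) *\<^sub>R b" Basis]
  by (simp add: euclidean_representation linear_scale)

text \<open>With a left inverse \<open>B\<close> of \<open>A\<close>, the map
  \<open>B \<circ> s\<close> has identity derivative at \<open>y x0\<close>, so near
  \<open>x0\<close> the increment of \<open>y\<close> equals that of
  \<open>g = B \<circ> s \<circ> y\<close> up to an error small against the increment of
  \<open>y\<close> itself. Absorbing this error first bounds \<open>y\<close> and then gives the
  derivative \<open>B \<circ> G\<close>. The target of \<open>s\<close> may have larger dimension
  than its source.\<close>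

lemma differentiable_factor:
  fixes s :: "'e::euclidean_space \<Rightarrow> 'b::euclidean_space" and y :: "'x::real_normed_vector \<Rightarrow> 'e"
  assumes s: "(s has_derivative A) (at (y x0))" and "inj A"
    and y: "isCont y x0" and sy: "((\<lambda>x. s (y x)) has_derivative G) (at x0)"
  shows "y differentiable (at x0)"
proof -
  have "linear A" using s has_derivative_linear by blast
  then obtain B where B: "linear B" "B \<circ> A = id"
    using linear_injective_left_inverse \<open>inj A\<close> by blast
  then have bB: "bounded_linear B" by (simp add: linear_conv_bounded_linear)
  define g where "g = (\<lambda>x. B (s (y x)))"
  define G' where "G' = (\<lambda>v. B (G v))"
  have gd: "(g has_derivative G') (at x0)"
    unfolding g_def G'_def by (rule bounded_linear.has_derivative[OF bB sy])
  have sd: "((\<lambda>z. B (s z)) has_derivative (\<lambda>v. v)) (at (y x0))"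
    using bounded_linear.has_derivative[OF bB s] B(2) by (simp add: o_def id_def fun_eq_iff)
  obtain K where K: "K > 0" "\<And>v. norm (G' v) \<le> norm v * K"
    using has_derivative_bounded_linear[OF gd] bounded_linear.pos_bounded by blast
  have g_ev: "\<forall>\<^sub>F x in nhds x0. norm (g x - g x0 - G' (x - x0)) \<le> e * norm (x - x0)" if "e > 0" for e
    using gd that unfolding has_derivative_at_alt eventually_nhds_metric dist_norm by blast
  have s_ev: "\<forall>\<^sub>F x in nhds x0. norm (g x - g x0 - (y x - y x0)) \<le> e * norm (y x - y x0)" if "e > 0" for e
  proof -
    have "\<forall>\<^sub>F z in nhds (y x0). norm (B (s z) - B (s (y x0)) - (z - y x0)) \<le> e * norm (z - y x0)"
      using sd that unfolding has_derivative_at_alt eventually_nhds_metric dist_norm by blast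
    moreover have "filterlim y (nhds (y x0)) (nhds x0)"
      using y continuous_at_imp_continuous_on isCont_def tendsto_at_iff_tendsto_nhds by blast
    ultimately show ?thesis
      unfolding g_def using eventually_compose_filterlim by blast
  qed
  \<comment> \<open>Tolerance 1 for \<open>g\<close> bounds its increment by K + 1 times that of the
    argument; tolerance 1/2 lets the other error be absorbed on the left, at the cost of the factor
    2.\<close>
  have lip: "\<forall>\<^sub>F x in nhds x0. norm (y x - y x0) \<le> 2 * (K + 1) * norm (x - x0)"
    using g_ev[of 1, simplified] s_ev[of "1/2", simplified]
  proof eventually_elim
    case (elim x)
    have "norm (y x - y x0) \<le> norm (g x - g x0 - G' (x - x0)) + norm (G' (x - x0))
        + norm (g x - g x0 - (y x - y x0))"
      using norm_triangle_ineq[of "g x - g x0 - G' (x - x0)" "G' (x - x0)"]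
        norm_triangle_ineq4[of "g x - g x0" "g x - g x0 - (y x - y x0)"] by simp
    then show ?case using elim K(2)[of "x - x0"] by (simp add: algebra_simps)
  qed
  have "(y has_derivative G') (at x0)"
    unfolding has_derivative_at_alt
  proof (intro conjI allI impI)
    show "bounded_linear G'" using gd has_derivative_bounded_linear by blast
    fix e :: real assume "e > 0"
    \<comment> \<open>Against the Lipschitz constant 2 (K + 1) this leaves exactly e / 2, the other
      half being spent on \<open>g\<close>.\<close>
    define e' where "e' = e / (4 * (K + 1))"
    have e': "e' > 0" using \<open>e > 0\<close> K(1) by (simp add: e'_def)
    have "\<forall>\<^sub>F x in nhds x0. norm (y x - y x0 - G' (x - x0)) \<le> e * norm (x - x0)"
      using lip g_ev[OF half_gt_zero[OF \<open>e > 0\<close>]] s_ev[OF e']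
    proof eventually_elim
      case (elim x)
      have "e' * norm (y x - y x0) \<le> e' * (2 * (K + 1) * norm (x - x0))"
        using elim(1) e' by (intro mult_left_mono) auto
      also have "\<dots> = e / 2 * norm (x - x0)" using K(1) by (simp add: e'_def divide_simps)
      finally have "e' * norm (y x - y x0) \<le> e / 2 * norm (x - x0)" .
      moreover have "norm (y x - y x0 - G' (x - x0)) \<le> norm (g x - g x0 - G' (x - x0))
          + norm (g x - g x0 - (y x - y x0))"
        using norm_triangle_ineq4[of "g x - g x0 - G' (x - x0)" "g x - g x0 - (y x - y x0)"]
        by (simp add: algebra_simps)
      ultimately show ?case using elim(2,3) by (simp add: algebra_simps)
    qed
    then show "\<exists>d>0. \<forall>x. norm (x - x0) < d \<longrightarrow> norm (y x - y x0 - G' (x - x0)) \<le> e * norm (x - x0)"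
      unfolding eventually_nhds_metric dist_norm by blast
  qed
  then show ?thesis by (rule differentiableI)
qed

text \<open>\<open>L x0\<close> is injective, hence bounded below by some c. While the perturbation
  of \<open>L\<close> has size below c / 2, \<open>L x\<close> is bounded below by c / 2, and the
  distance from \<open>z x\<close> to \<open>z x0\<close> is at most 2 / c times the residual of
  \<open>z x0\<close> in the equation at \<open>x\<close>.\<close>

lemma isCont_linear_solve:
  fixes L :: "'x::t2_space \<Rightarrow> 'e::euclidean_space \<Rightarrow> 'b::euclidean_space"
  assumes ev: "\<forall>\<^sub>F x in nhds x0. linear (L x) \<and> L x (z x) = a x" and inj: "inj (L x0)"
    and L: "\<And>v. isCont (\<lambda>x. L x v) x0" and a: "isCont a x0"
  shows "isCont z x0"
proof -
  have 0: "linear (L x0)" "L x0 (z x0) = a x0" using eventually_nhds_x_imp_x[OF ev] by auto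
  obtain c where c: "c > 0" "\<And>v. c * norm v \<le> norm (L x0 v)"
    using linear_inj_bounded_below_pos[OF 0(1) inj] by blast
  define s where "s = (\<lambda>x. \<Sum>b\<in>Basis. norm (L x b - L x0 b))"
  have "(s \<longlongrightarrow> (\<Sum>b\<in>(Basis::'e set). norm (L x0 b - L x0 b))) (at x0)"
    unfolding s_def using L by (intro tendsto_intros) (simp add: isCont_def)
  then have "(s \<longlongrightarrow> 0) (at x0)" by simp
  then have s_ev: "\<forall>\<^sub>F x in at x0. s x < c / 2" using c(1) by (intro order_tendstoD) auto
  have s: "norm (L x v - L x0 v) \<le> s x * norm v" if "linear (L x)" for x v
  proof -
    have "L x v - L x0 v = (\<Sum>b\<in>Basis. (v \<bullet> b) *\<^sub>R (L x b - L x0 b))"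
      by (simp add: scaleR_diff_right sum_subtractf sum_family_linear that 0(1))
    also have "norm \<dots> \<le> (\<Sum>b\<in>Basis. norm v * norm (L x b - L x0 b))"
      by (rule sum_norm_le) (simp add: Basis_le_norm mult_right_mono)
    finally show ?thesis by (simp add: s_def sum_distrib_left mult.commute)
  qed
  have r: "((\<lambda>x. 2 / c * norm (a x - L x (z x0))) \<longlongrightarrow> 2 / c * norm (a x0 - L x0 (z x0))) (at x0)"
    using L a by (intro tendsto_intros) (simp_all add: isCont_def)
  have "\<forall>\<^sub>F x in at x0. norm (z x - z x0) \<le> 2 / c * norm (a x - L x (z x0))"
  proof -
    have "\<forall>\<^sub>F x in at x0. linear (L x) \<and> L x (z x) = a x"
      using ev by (simp add: eventually_at_filter eventually_mono)
    with s_ev show ?thesis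
    proof eventually_elim
      case (elim x)
      define w where "w = z x - z x0"
      have "L x w = a x - L x (z x0)" using elim by (simp add: w_def linear_diff)
      moreover have "c * norm w \<le> norm (L x w) + s x * norm w"
        using c(2)[of w] s[of x w] elim norm_triangle_ineq4[of "L x w" "L x w - L x0 w"] by simp
      moreover have "s x * norm w \<le> c / 2 * norm w" using elim by (intro mult_right_mono) auto
      ultimately have "c * norm w \<le> 2 * norm (a x - L x (z x0))" by simp
      then show ?case using c(1) by (simp add: w_def field_simps)
    qed
  qed
  then have "((\<lambda>x. z x - z x0) \<longlongrightarrow> 0) (at x0)"
    by (rule Lim_null_comparison) (use r 0(2) in simp)
  then show ?thesis by (simp add: isCont_def LIM_zero_cancel)
qed

text \<open>Only the maps \<open>F y v\<close> with fixed \<open>v\<close> are known to be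
  differentiable. The basis expansion yields a product rule in coordinates; for constant
  \<open>w\<close> the same rule identifies the coordinate sum with the derivative of
  \<open>F y (w x)\<close>.\<close>

lemma has_derivative_family:
  fixes F :: "'x::euclidean_space \<Rightarrow> 'e::euclidean_space \<Rightarrow> 'b::real_normed_vector"
  assumes "open S" "x \<in> S" "\<And>y. y \<in> S \<Longrightarrow> linear (F y)"
    and F: "\<And>v. (\<lambda>y. F y v) differentiable (at x)" and w: "(w has_derivative w') (at x)"
  shows "((\<lambda>y. F y (w y)) has_derivative (\<lambda>u. FD (\<lambda>y. F y (w x)) x u + F x (w' u))) (at x)"
proof -
  have D: "((\<lambda>y. \<Sum>b\<in>Basis. (p y \<bullet> b) *\<^sub>R F y b) has_derivative
      (\<lambda>u. \<Sum>b\<in>Basis. (p x \<bullet> b) *\<^sub>R FD (\<lambda>y. F y b) x u + (p' u \<bullet> b) *\<^sub>R F x b)) (at x)"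
    if "(p has_derivative p') (at x)" for p p'
    using that by (intro has_derivative_sum has_derivative_scaleR has_derivative_FD[OF F]
        has_derivative_inner_left)
  have eq: "(\<Sum>b\<in>Basis. (p y \<bullet> b) *\<^sub>R F y b) = F y (p y)" if "y \<in> S" for y p
    using sum_family_linear assms(3) that by blast
  have lin: "linear (F x)" using assms(2,3) by blast
  have D': "((\<lambda>y. F y (p y)) has_derivative
      (\<lambda>u. (\<Sum>b\<in>Basis. (p x \<bullet> b) *\<^sub>R FD (\<lambda>y. F y b) x u) + F x (p' u))) (at x)"
    if "(p has_derivative p') (at x)" for p p'
    using has_derivative_transform_within_open[OF D[OF that] assms(1,2), of "\<lambda>y. F y (p y)"] eq
    by (simp add: sum.distrib sum_family_linear[OF lin])
  have F': "FD (\<lambda>y. F y v) x u = (\<Sum>b\<in>Basis. (v \<bullet> b) *\<^sub>R FD (\<lambda>y. F y b) x u)" for u v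
    using FD_eq[OF D'[OF has_derivative_const[of v]]] by (simp add: linear_0[OF lin])
  then show ?thesis using D'[OF w] by (simp only: F'[symmetric])
qed

text \<open>The graph of \<open>z\<close> is fed to \<open>differentiable_factor\<close>: the map
  from (x, v) to (x, L x v) has an injective derivative at (x, z x) because \<open>L x\<close> is
  injective, and along the graph it equals (x, a x), which is differentiable.\<close>

lemma differentiable_linear_solve:
  fixes L :: "'x::euclidean_space \<Rightarrow> 'e::euclidean_space \<Rightarrow> 'b::euclidean_space"
  assumes "open S" "x \<in> S" "\<And>x. x \<in> S \<Longrightarrow> linear (L x)" "inj (L x)"
    and eq: "\<And>x. x \<in> S \<Longrightarrow> L x (z x) = a x"
    and L: "\<And>v. (\<lambda>x. L x v) differentiable (at x)" and a: "a differentiable (at x)"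
  shows "z differentiable (at x)"
proof -
  have lin: "linear (L x)" using assms by blast
  have "isCont z x"
  proof (rule isCont_linear_solve[where L = L and a = a])
    show "\<forall>\<^sub>F x in nhds x. linear (L x) \<and> L x (z x) = a x"
      by (rule eventually_mono[OF eventually_nhds_in_open[OF assms(1,2)]]) (use assms(3) eq in auto)
    show "isCont (\<lambda>x. L x v) x" for v by (rule differentiable_imp_continuous_within[OF L])
    show "isCont a x" by (rule differentiable_imp_continuous_within[OF a])
  qed (rule assms(4))
  define s where "s = (\<lambda>p. (fst p, L (fst p) (snd p)))"
  have fam: "((\<lambda>p. L (fst p) (snd p)) has_derivative
      (\<lambda>p. FD (\<lambda>q. L (fst q) (z x)) (x, z x) p + L x (snd p))) (at (x, z x))"
  proof -
    have "((\<lambda>q. L (fst q) (snd q)) has_derivative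
      (\<lambda>u. FD (\<lambda>y. L (fst y) (snd (x, z x))) (x, z x) u + L (fst (x, z x)) (snd u))) (at (x, z x))"
    proof (rule has_derivative_family[of "S \<times> UNIV"])
      show "(\<lambda>y. L (fst y) v) differentiable (at (x, z x))" for v
        using differentiable_compose[of "\<lambda>x. L x v" fst "(x, z x)"] L
        by (simp add: bounded_linear_fst bounded_linear_imp_differentiable)
    qed (use assms in \<open>auto intro!: derivative_eq_intros open_Times\<close>)
    then show ?thesis by simp
  qed
  have fst': "FD (\<lambda>q. L (fst q) (z x)) (x, z x) p = FD (\<lambda>y. L y (z x)) x (fst p)" for p
  proof -
    have "((\<lambda>q. L (fst q) (z x)) has_derivative (\<lambda>p. FD (\<lambda>y. L y (z x)) x (fst p))) (at (x, z x))"
      by (rule has_derivative_compose[OF has_derivative_fst[OF has_derivative_ident]])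
        (use has_derivative_FD[OF L] in simp)
    from FD_eq[OF this] show ?thesis by simp
  qed
  have sd: "(s has_derivative (\<lambda>p. (fst p, FD (\<lambda>y. L y (z x)) x (fst p) + L x (snd p)))) (at (x, z x))"
    unfolding s_def using fam by (auto simp: fst' intro!: derivative_eq_intros)
  have "inj (\<lambda>p. (fst p, FD (\<lambda>y. L y (z x)) x (fst p) + L x (snd p)))"
    using assms(4) by (auto simp: inj_def)
  moreover have "((\<lambda>x. s (x, z x)) has_derivative (\<lambda>v. (v, FD a x v))) (at x)"
  proof (rule has_derivative_transform_within_open[OF _ assms(1,2)])
    show "((\<lambda>x. (x, a x)) has_derivative (\<lambda>v. (v, FD a x v))) (at x)"
      using has_derivative_FD[OF a] by (auto intro!: derivative_eq_intros)
  qed (simp add: s_def eq)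
  ultimately have "(\<lambda>x. (x, z x)) differentiable (at x)"
    using \<open>isCont z x\<close> sd by (intro differentiable_factor[of s]) auto
  then have "(\<lambda>x. snd (x, z x)) differentiable (at x)"
    unfolding differentiable_def using has_derivative_snd by (elim exE) blast
  then show ?thesis by simp
qed

text \<open>Differentiating the equation shows that each directional derivative of \<open>z\<close>
  solves the system with the same \<open>L\<close> and a right-hand side made of \<open>z\<close>
  and first derivatives of \<open>a\<close> and \<open>L\<close>; here \<open>z\<close> has class k
  by the induction hypothesis for the undifferentiated equation.\<close>

lemma Ck_on_solve:
  fixes L :: "'x::euclidean_space \<Rightarrow> 'e::euclidean_space \<Rightarrow> 'b::euclidean_space"
  assumes "open S" "\<And>x. x \<in> S \<Longrightarrow> linear (L x)" "\<And>x. x \<in> S \<Longrightarrow> inj (L x)"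
    and "\<And>x. x \<in> S \<Longrightarrow> L x (z x) = a x"
    and "\<And>v. Ck_on k S (\<lambda>x. L x v)" "Ck_on k S a"
  shows "Ck_on k S z"
  using assms(4-6)
proof (induction k arbitrary: z a)
  case 0
  have "isCont z x" if "x \<in> S" for x
  proof (rule isCont_linear_solve[where L = L and a = a])
    show "\<forall>\<^sub>F x in nhds x. linear (L x) \<and> L x (z x) = a x"
      by (rule eventually_mono[OF eventually_nhds_in_open[OF assms(1) that]]) (use assms(2) 0(1) in auto)
    show "isCont (\<lambda>x. L x v) x" for v
      using 0(2)[of v] assms(1) that by (simp add: continuous_on_eq_continuous_at)
    show "isCont a x" using 0(3) assms(1) that by (simp add: continuous_on_eq_continuous_at)
  qed (use assms(3) that in auto)
  then show ?case by (simp add: continuous_at_imp_continuous_on)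
next
  case (Suc k)
  have L: "(\<lambda>x. L x v) differentiable (at x)" if "x \<in> S" for v x
    using Suc.prems(2)[of v] that by simp
  have a: "a differentiable (at x)" if "x \<in> S" for x
    using Suc.prems(3) that by simp
  have z: "z differentiable (at x)" if "x \<in> S" for x
    by (rule differentiable_linear_solve[OF assms(1) that assms(2) assms(3)[OF that] Suc.prems(1) L[OF that] a[OF that]])
  have zk: "Ck_on k S z"
    using Suc.IH[OF Suc.prems(1)] Suc.prems(2,3) Ck_on_SucD by blast
  have "Ck_on k S (\<lambda>x. FD z x v)" for v
  proof (rule Suc.IH)
    fix x assume x: "x \<in> S"
    have "((\<lambda>y. L y (z y)) has_derivative (\<lambda>u. FD (\<lambda>y. L y (z x)) x u + L x (FD z x u))) (at x)"
      by (rule has_derivative_family[OF assms(1) x assms(2) L[OF x] has_derivative_FD[OF z[OF x]]])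
    from FD_eq[OF this] FD_cong(2)[OF assms(1) x Suc.prems(1)[symmetric] a[OF x]]
    have 1: "FD a x v = FD (\<lambda>y. L y (z x)) x v + L x (FD z x v)" by simp
    have "((\<lambda>y. L y (z x)) has_derivative (\<lambda>u. \<Sum>b\<in>Basis. (z x \<bullet> b) *\<^sub>R FD (\<lambda>y. L y b) x u)) (at x)"
      by (rule has_derivative_transform_within_open[OF _ assms(1) x, of "\<lambda>y. \<Sum>b\<in>Basis. (z x \<bullet> b) *\<^sub>R L y b"])
        (auto intro!: has_derivative_sum has_derivative_scaleR_right has_derivative_FD L[OF x]
          simp: sum_family_linear[OF assms(2)])
    from FD_eq[OF this] 1
    show "L x (FD z x v) = FD a x v + (- 1) *\<^sub>R (\<Sum>b\<in>Basis. (z x \<bullet> b) *\<^sub>R FD (\<lambda>y. L y b) x v)"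
      by simp
  next
    show "Ck_on k S (\<lambda>x. L x v)" for v using Suc.prems(2) Ck_on_SucD by blast
    show "Ck_on k S (\<lambda>x. FD a x v + (- 1) *\<^sub>R (\<Sum>b\<in>Basis. (z x \<bullet> b) *\<^sub>R FD (\<lambda>y. L y b) x v))"
      using Suc.prems(2,3) by (intro Ck_on_add Ck_on_scaleR Ck_on_sum Ck_on_inner Ck_on_const zk assms(1)) auto
  qed
  then show ?case using z by simp
qed

text \<open>In coordinates this is the Gram operator, the adjoint of \<open>A\<close> composed with
  \<open>A\<close>. It replaces an injective map by an invertible one between equal
  dimensions.\<close>

lemma gram_linear_inj:
  fixes A :: "'e::euclidean_space \<Rightarrow> 'b::euclidean_space"
  assumes "linear A" "inj A"
  shows "linear (\<lambda>u. \<Sum>b\<in>Basis. (A u \<bullet> A b) *\<^sub>R b)" "inj (\<lambda>u. \<Sum>b\<in>Basis. (A u \<bullet> A b) *\<^sub>R b)"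
proof -
  let ?G = "\<lambda>u. \<Sum>b\<in>Basis. (A u \<bullet> A b) *\<^sub>R b"
  show lin: "linear ?G"
    by (rule linearI) (simp_all add: linear_add[OF assms(1)] linear_scale[OF assms(1)] inner_add_left
        scaleR_add_left sum.distrib scaleR_sum_right)
  have "u = 0" if "?G u = 0" for u
  proof -
    have "A u \<bullet> A b = 0" if "b \<in> Basis" for b
      using arg_cong[OF \<open>?G u = 0\<close>, of "\<lambda>w. w \<bullet> b"] that by simp
    then have "(\<Sum>b\<in>Basis. (u \<bullet> b) *\<^sub>R (A u \<bullet> A b)) = 0" by simp
    moreover have "linear (\<lambda>w. A u \<bullet> A w)"
      by (rule linearI) (simp_all add: linear_add[OF assms(1)] linear_scale[OF assms(1)] inner_add_right)
    ultimately have "A u \<bullet> A u = 0" using sum_family_linear[of "\<lambda>w. A u \<bullet> A w" u] by simp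
    then show ?thesis using assms linear_injective_0 by auto
  qed
  then show "inj ?G" using lin linear_injective_0 by blast
qed

text \<open>Bootstrapping: if \<open>y\<close> has class k, so do the coefficients
  \<open>FD s (y x)\<close> of the linear system that the chain rule gives for
  \<open>FD y x v\<close>, hence so does its solution, and \<open>y\<close> has class k + 1. With
  \<open>s\<close> an inverse chart, this turns smooth ambient maps into smooth coordinate
  expressions.\<close>

lemma smooth_on_factor:
  fixes s :: "'e::euclidean_space \<Rightarrow> 'b::euclidean_space" and y :: "'x::euclidean_space \<Rightarrow> 'e"
  assumes "open U" "open V" "smooth_on V s" "\<And>z. z \<in> V \<Longrightarrow> inj (FD s z)"
    and "continuous_on U y" "y \<in> U \<rightarrow> V" "smooth_on U (\<lambda>x. s (y x))"
  shows "smooth_on U y"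
proof -
  let ?g = "\<lambda>x. s (y x)"
  have sd: "(s has_derivative FD s (y x)) (at (y x))" if "x \<in> U" for x
    using assms(3,6) that by (auto intro!: has_derivative_FD smooth_on_differentiable)
  have gd: "(?g has_derivative FD ?g x) (at x)" if "x \<in> U" for x
    using assms(7) that by (auto intro!: has_derivative_FD smooth_on_differentiable)
  have lin: "linear (FD s (y x))" if "x \<in> U" for x using sd[OF that] has_derivative_linear by blast
  have inj: "inj (FD s (y x))" if "x \<in> U" for x using assms(4,6) that by blast
  have y: "y differentiable (at x)" if "x \<in> U" for x
  proof (rule differentiable_factor[OF sd[OF that] inj[OF that] _ gd[OF that]])
    show "isCont y x" using assms(1,5) that by (simp add: continuous_on_eq_continuous_at)
  qed
  have chain: "FD ?g x v = FD s (y x) (FD y x v)" if "x \<in> U" for x v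
    using FD_eq[OF has_derivative_compose[OF has_derivative_FD[OF y[OF that]] sd[OF that]]] by simp
  have "Ck_on k U y" for k
  proof (induction k)
    case 0
    then show ?case using assms(5) by simp
  next
    case (Suc k)
    have s: "Ck_on k U (\<lambda>x. FD s (y x) v)" for v
      using Ck_on_compose[OF assms(1,2,6) Suc smooth_onD[OF smooth_on_FD[OF assms(3)]]] .
    have g: "Ck_on k U (\<lambda>x. FD ?g x v)" for v by (rule smooth_onD[OF smooth_on_FD[OF assms(7)]])
    have "Ck_on k U (\<lambda>x. FD y x v)" for v
    proof (rule Ck_on_solve[OF assms(1) gram_linear_inj[OF lin inj]])
      show "(\<Sum>b\<in>Basis. (FD s (y x) (FD y x v) \<bullet> FD s (y x) b) *\<^sub>R b) =
          (\<Sum>b\<in>Basis. (FD ?g x v \<bullet> FD s (y x) b) *\<^sub>R b)" if "x \<in> U" for x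
        using chain[OF that] by simp
      show "Ck_on k U (\<lambda>x. \<Sum>b\<in>Basis. (FD s (y x) v \<bullet> FD s (y x) b) *\<^sub>R b)" for v
        by (intro Ck_on_sum Ck_on_scaleR Ck_on_inner Ck_on_const s assms(1))
      show "Ck_on k U (\<lambda>x. \<Sum>b\<in>Basis. (FD ?g x v \<bullet> FD s (y x) b) *\<^sub>R b)"
        by (intro Ck_on_sum Ck_on_scaleR Ck_on_inner Ck_on_const s g assms(1))
    qed
    then show ?case using y by simp
  qed
  then show ?thesis by (rule smooth_onI)
qed

section \<open>Symmetry of second derivatives\<close>

lemma second_difference:
  fixes f :: "'e::euclidean_space \<Rightarrow> real"
  assumes d: "\<And>y. y \<in> ball x (s * (norm u + norm v) + e) \<Longrightarrow> f differentiable (at y)"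
    "\<And>y. y \<in> ball x (s * (norm u + norm v) + e) \<Longrightarrow> (\<lambda>y. FD f y u) differentiable (at y)"
    and "s > 0" "e > 0"
  shows "\<exists>y \<in> ball x (s * (norm u + norm v) + e).
    f (x + s *\<^sub>R u + s *\<^sub>R v) - f (x + s *\<^sub>R u) - f (x + s *\<^sub>R v) + f x = s\<^sup>2 * FD (\<lambda>y. FD f y u) y v"
proof -
  let ?B = "ball x (s * (norm u + norm v) + e)"
  have B: "x + t *\<^sub>R u + r *\<^sub>R v \<in> ?B" if "0 \<le> t" "t \<le> s" "0 \<le> r" "r \<le> s" for t r
  proof -
    have "norm (t *\<^sub>R u + r *\<^sub>R v) \<le> t * norm u + r * norm v"
      using norm_triangle_ineq[of "t *\<^sub>R u" "r *\<^sub>R v"] that by simp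
    also have "\<dots> \<le> s * norm u + s * norm v" using that by (intro add_mono mult_right_mono) auto
    finally have "norm (t *\<^sub>R u + r *\<^sub>R v) < s * (norm u + norm v) + e"
      using \<open>e > 0\<close> by (simp add: algebra_simps)
    then show ?thesis by (simp add: dist_norm norm_minus_commute algebra_simps)
  qed
  have line: "((\<lambda>t. g (p + t *\<^sub>R w)) has_real_derivative FD g (p + t *\<^sub>R w) w) (at t)"
    if "g differentiable (at (p + t *\<^sub>R w))" for g :: "'e \<Rightarrow> real" and p w t
  proof -
    have "((\<lambda>t. p + t *\<^sub>R w) has_derivative (\<lambda>h. h *\<^sub>R w)) (at t)"
      by (auto intro!: derivative_eq_intros)
    from has_derivative_compose[OF this has_derivative_FD[OF that]]
    have "((\<lambda>t. g (p + t *\<^sub>R w)) has_derivative (\<lambda>h. FD g (p + t *\<^sub>R w) (h *\<^sub>R w))) (at t)" .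
    moreover have "(\<lambda>h. FD g (p + t *\<^sub>R w) (h *\<^sub>R w)) = (*) (FD g (p + t *\<^sub>R w) w)"
      using linear_scale[OF linear_FD[OF that]] by (auto simp: fun_eq_iff)
    ultimately show ?thesis by (simp add: has_field_derivative_def)
  qed
  \<comment> \<open>Mean value theorem along \<open>u\<close> for the difference of \<open>f\<close>
    on two parallel segments; the second application runs along \<open>v\<close>.\<close>
  have "\<exists>t. 0 < t \<and> t < s \<and>
     (f ((x + s *\<^sub>R v) + s *\<^sub>R u) - f (x + s *\<^sub>R u)) - (f ((x + s *\<^sub>R v) + 0 *\<^sub>R u) - f (x + 0 *\<^sub>R u)) =
     (s - 0) * (FD f ((x + s *\<^sub>R v) + t *\<^sub>R u) u - FD f (x + t *\<^sub>R u) u)"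
  proof (rule MVT2)
    fix t assume t: "0 \<le> t" "t \<le> s"
    have 1: "f differentiable (at ((x + s *\<^sub>R v) + t *\<^sub>R u))"
      using d(1) B[OF t, of s] \<open>s > 0\<close> by (simp add: algebra_simps)
    have 2: "f differentiable (at (x + t *\<^sub>R u))"
      using d(1) B[OF t, of 0] \<open>s > 0\<close> by simp
    show "((\<lambda>t. f ((x + s *\<^sub>R v) + t *\<^sub>R u) - f (x + t *\<^sub>R u)) has_real_derivative
       FD f ((x + s *\<^sub>R v) + t *\<^sub>R u) u - FD f (x + t *\<^sub>R u) u) (at t)"
      by (rule DERIV_diff[OF line[OF 1] line[OF 2]])
  qed (use \<open>s > 0\<close> in auto)
  then obtain t where t: "0 < t" "t < s" and
    1: "f ((x + s *\<^sub>R v) + s *\<^sub>R u) - f (x + s *\<^sub>R u) - (f (x + s *\<^sub>R v) - f x) =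
     s * (FD f ((x + s *\<^sub>R v) + t *\<^sub>R u) u - FD f (x + t *\<^sub>R u) u)" by auto
  have "\<exists>r. 0 < r \<and> r < s \<and> FD f ((x + t *\<^sub>R u) + s *\<^sub>R v) u - FD f ((x + t *\<^sub>R u) + 0 *\<^sub>R v) u =
     (s - 0) * FD (\<lambda>y. FD f y u) ((x + t *\<^sub>R u) + r *\<^sub>R v) v"
    by (rule MVT2) (use \<open>s > 0\<close> t B[of t] in \<open>auto intro!: line d(2)\<close>)
  then obtain r where r: "0 < r" "r < s" and
    2: "FD f ((x + t *\<^sub>R u) + s *\<^sub>R v) u - FD f (x + t *\<^sub>R u) u =
     s * FD (\<lambda>y. FD f y u) ((x + t *\<^sub>R u) + r *\<^sub>R v) v" by auto
  have "f (x + s *\<^sub>R u + s *\<^sub>R v) - f (x + s *\<^sub>R u) - f (x + s *\<^sub>R v) + f x =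
      s * (s * FD (\<lambda>y. FD f y u) ((x + t *\<^sub>R u) + r *\<^sub>R v) v)"
    using 1 unfolding 2[symmetric] by (simp add: algebra_simps)
  then show ?thesis using B[of t r] t r by (auto simp: power2_eq_square intro!: bexI)
qed

text \<open>The second difference over a parallelogram is symmetric in its two sides and equals the
  squared scale times a value of either iterated derivative near \<open>x\<close>; both being
  continuous, the parallelogram may shrink.\<close>

lemma FD_commute_real:
  fixes f :: "'e::euclidean_space \<Rightarrow> real"
  assumes "open S" "x \<in> S" "smooth_on S f"
  shows "FD (\<lambda>y. FD f y v) x u = FD (\<lambda>y. FD f y u) x v"
proof -
  let ?P = "\<lambda>u v y. FD (\<lambda>y. FD f y u) y v"
  have c: "isCont (?P u v) x" for u v
    by (rule continuous_on_interior[OF smooth_on_continuous[OF smooth_on_FD[OF smooth_on_FD[OF assms(3)]]]])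
      (use assms(1,2) in \<open>simp add: interior_open\<close>)
  have "\<bar>?P u v x - ?P v u x\<bar> \<le> 2 * \<epsilon>" if eps: "\<epsilon> > 0" for \<epsilon>
  proof -
    obtain r where r: "r > 0" "ball x r \<subseteq> S" using openE[OF assms(1,2)] by metis
    obtain d1 where d1: "d1 > 0" "\<And>y. dist y x < d1 \<Longrightarrow> dist (?P u v y) (?P u v x) < \<epsilon>"
      using c[of u v, unfolded continuous_at_eps_delta, rule_format, OF eps] by auto
    obtain d2 where d2: "d2 > 0" "\<And>y. dist y x < d2 \<Longrightarrow> dist (?P v u y) (?P v u x) < \<epsilon>"
      using c[of v u, unfolded continuous_at_eps_delta, rule_format, OF eps] by auto
    define d where "d = min r (min d1 d2)"
    have d: "d > 0" using r d1 d2 by (simp add: d_def)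
    \<comment> \<open>The parallelogram then stays within d / 2 of \<open>x\<close>, which leaves d
      / 2 as slack; the 1 in the denominator covers \<open>u = v = 0\<close>.\<close>
    define s where "s = d / (2 * (norm u + norm v + 1))"
    have "norm u + norm v + 1 > 0" by (simp add: add_nonneg_pos)
    then have s: "s > 0" "s * (norm u + norm v) + d/2 \<le> d"
      using d by (auto simp: s_def field_simps)
    then have B: "ball x (s * (norm u + norm v) + d/2) \<subseteq> ball x d"
      "ball x (s * (norm v + norm u) + d/2) \<subseteq> ball x d" by (auto simp: add.commute)
    have dS: "ball x d \<subseteq> S" using r(2) by (auto simp: d_def)
    have "\<exists>y \<in> ball x (s * (norm u + norm v) + d/2).
      f (x + s *\<^sub>R u + s *\<^sub>R v) - f (x + s *\<^sub>R u) - f (x + s *\<^sub>R v) + f x = s\<^sup>2 * ?P u v y"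
      by (rule second_difference)
         (use B dS d s in \<open>auto intro!: smooth_on_differentiable[of S] smooth_on_FD assms(3)\<close>)
    then obtain y where y: "y \<in> ball x d" and
      1: "f (x + s *\<^sub>R u + s *\<^sub>R v) - f (x + s *\<^sub>R u) - f (x + s *\<^sub>R v) + f x = s\<^sup>2 * ?P u v y"
      using B(1) by blast
    have "\<exists>y \<in> ball x (s * (norm v + norm u) + d/2).
      f (x + s *\<^sub>R v + s *\<^sub>R u) - f (x + s *\<^sub>R v) - f (x + s *\<^sub>R u) + f x = s\<^sup>2 * ?P v u y"
      by (rule second_difference)
         (use B dS d s in \<open>auto intro!: smooth_on_differentiable[of S] smooth_on_FD assms(3)\<close>)
    then obtain y' where y': "y' \<in> ball x d" and
      2: "f (x + s *\<^sub>R v + s *\<^sub>R u) - f (x + s *\<^sub>R v) - f (x + s *\<^sub>R u) + f x = s\<^sup>2 * ?P v u y'"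
      using B(2) by blast
    have "s\<^sup>2 * ?P u v y = s\<^sup>2 * ?P v u y'"
      using 1 2 by (simp add: algebra_simps)
    then have "?P u v y = ?P v u y'" using s(1) by simp
    moreover have "\<bar>?P u v y - ?P u v x\<bar> < \<epsilon>" "\<bar>?P v u y' - ?P v u x\<bar> < \<epsilon>"
      using d1(2)[of y] d2(2)[of y'] y y' by (auto simp: d_def dist_commute dist_real_def)
    ultimately show ?thesis by linarith
  qed
  then have "\<bar>?P u v x - ?P v u x\<bar> \<le> 0 + e" if "e > 0" for e
    using half_gt_zero[OF that] by fastforce
  then have "\<bar>?P u v x - ?P v u x\<bar> \<le> 0" by (rule field_le_epsilon)
  then show ?thesis by simp
qed

lemma FD_commute:
  fixes f :: "'e::euclidean_space \<Rightarrow> 'b::euclidean_space"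
  assumes "open S" "x \<in> S" "smooth_on S f"
  shows "FD (\<lambda>y. FD f y v) x u = FD (\<lambda>y. FD f y u) x v"
proof (rule euclidean_eqI)
  fix b :: 'b
  have in1: "FD (\<lambda>y. g y \<bullet> b) y w = FD g y w \<bullet> b" if "y \<in> S" "smooth_on S g" for g :: "'e \<Rightarrow> 'b" and y w
    using FD_eq[OF has_derivative_inner_left[OF has_derivative_FD[OF smooth_on_differentiable[OF that(2,1)]]]]
    by simp
  have sm: "smooth_on S (\<lambda>y. f y \<bullet> b)"
    by (rule smooth_on_linear[OF assms(1) bounded_linear_inner_left assms(3)])
  have in2: "FD (\<lambda>y. FD f y v) x u \<bullet> b = FD (\<lambda>y. FD (\<lambda>y. f y \<bullet> b) y v) x u" for u v
  proof -
    have "FD (\<lambda>y. FD f y v) x u \<bullet> b = FD (\<lambda>y. FD f y v \<bullet> b) x u"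
      using in1[OF assms(2) smooth_on_FD[OF assms(3)]] by simp
    also have "\<dots> = FD (\<lambda>y. FD (\<lambda>y. f y \<bullet> b) y v) x u"
      by (rule fun_cong[OF FD_cong(2)[OF assms(1,2)]])
        (use in1 assms smooth_on_differentiable[OF smooth_on_FD[OF sm]] in auto)
    finally show ?thesis .
  qed
  show "FD (\<lambda>y. FD f y v) x u \<bullet> b = FD (\<lambda>y. FD f y u) x v \<bullet> b"
    unfolding in2 by (rule FD_commute_real[OF assms(1,2) sm])
qed

section \<open>Immersed patches of a sphere\<close>

lemma smooth_on_add: "open S \<Longrightarrow> smooth_on S f \<Longrightarrow> smooth_on S g \<Longrightarrow> smooth_on S (\<lambda>x. f x + g x)"
  by (simp add: smooth_on_def Ck_on_add)

lemma smooth_on_sum: "open S \<Longrightarrow> (\<And>i. i \<in> I \<Longrightarrow> smooth_on S (f i)) \<Longrightarrow> smooth_on S (\<lambda>x. \<Sum>i\<in>I. f i x)"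
  by (simp add: smooth_on_def Ck_on_sum)

lemma smooth_on_const: "smooth_on S (\<lambda>x. c)"
  by (simp add: smooth_on_def Ck_on_const)

lemma smooth_on_inner: "open S \<Longrightarrow> smooth_on S f \<Longrightarrow> smooth_on S g \<Longrightarrow> smooth_on S (\<lambda>x. f x \<bullet> g x)"
  by (simp add: smooth_on_def Ck_on_inner)

lemma smooth_on_scaleR: "open S \<Longrightarrow> smooth_on S f \<Longrightarrow> smooth_on S g \<Longrightarrow> smooth_on S (\<lambda>x. f x *\<^sub>R g x)"
  by (simp add: smooth_on_def Ck_on_scaleR)

lemma smooth_on_family:
  fixes F :: "'x::euclidean_space \<Rightarrow> 'e::euclidean_space \<Rightarrow> 'b::real_normed_vector"
  assumes "open S" "\<And>y. y \<in> S \<Longrightarrow> linear (F y)" "\<And>v. smooth_on S (\<lambda>y. F y v)" "smooth_on S w"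
  shows "smooth_on S (\<lambda>y. F y (w y))"
  by (rule smooth_on_cong[OF assms(1), of "\<lambda>y. \<Sum>b\<in>Basis. (w y \<bullet> b) *\<^sub>R F y b"])
     (auto intro!: smooth_on_sum smooth_on_scaleR smooth_on_inner smooth_on_const assms
        simp: sum_family_linear[OF assms(2)])

lemma FD_family:
  fixes F :: "'x::euclidean_space \<Rightarrow> 'e::euclidean_space \<Rightarrow> 'b::real_normed_vector"
  assumes "open S" "x \<in> S" "\<And>y. y \<in> S \<Longrightarrow> linear (F y)"
    and "\<And>v. smooth_on S (\<lambda>y. F y v)" "smooth_on S w"
  shows "FD (\<lambda>y. F y (w y)) x u = FD (\<lambda>y. F y (w x)) x u + F x (FD w x u)"
  by (subst FD_eq[OF has_derivative_family[OF assms(1-3)]])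
     (auto intro!: has_derivative_FD smooth_on_differentiable[OF _ assms(2)] assms(4,5))

lemma FD_inner:
  assumes "f differentiable (at x)" "g differentiable (at x)"
  shows "FD (\<lambda>y. f y \<bullet> g y) x u = f x \<bullet> FD g x u + FD f x u \<bullet> g x"
  by (subst FD_eq[OF has_derivative_inner[OF has_derivative_FD[OF assms(1)] has_derivative_FD[OF assms(2)]]]) simp

lemma FD_cong_smooth:
  assumes "open S" "x \<in> S" "\<And>y. y \<in> S \<Longrightarrow> f y = g y" "smooth_on S f"
  shows "FD f x u = FD g x u"
  using FD_cong(2)[OF assms(1-3)] smooth_on_differentiable[OF assms(4,2)] by simp

lemma FD_linear:
  assumes "bounded_linear L" "f differentiable (at x)"
  shows "FD (\<lambda>y. L (f y)) x u = L (FD f x u)"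
  by (subst FD_eq[OF bounded_linear.has_derivative[OF assms(1) has_derivative_FD[OF assms(2)]]]) simp

text \<open>The least-squares solution of \<open>A z = w\<close>, i.e. the Moore--Penrose inverse of an injective \<open>A\<close>.\<close>

definition pinv :: "('e::euclidean_space \<Rightarrow> 'b::euclidean_space) \<Rightarrow> 'b \<Rightarrow> 'e" where
  "pinv A w = (THE z. \<forall>u. A z \<bullet> A u = w \<bullet> A u)"

lemma inner_range_cancel:
  assumes "linear A" "inj A" "\<And>u. A z \<bullet> A u = A z' \<bullet> A u"
  shows "z = z'"
proof -
  have "A (z - z') \<bullet> A (z - z') = 0"
    using assms(3)[of "z - z'"] by (simp add: linear_diff[OF assms(1)] inner_diff_left)
  then have "A (z - z') = 0" by simp
  then have "A z = A z'" by (simp add: linear_diff[OF assms(1)])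
  then show ?thesis using assms(2) by (simp add: inj_eq)
qed

lemma pinv:
  assumes "linear A" "inj A"
  shows "A (pinv A w) \<bullet> A u = w \<bullet> A u"
proof -
  let ?G = "\<lambda>u. \<Sum>b\<in>Basis. (A u \<bullet> A b) *\<^sub>R b"
  have "surj ?G" by (rule linear_inj_imp_surj[OF gram_linear_inj[OF assms]])
  then obtain z where z: "?G z = (\<Sum>b\<in>Basis. (w \<bullet> A b) *\<^sub>R b)" using surjD[of ?G "\<Sum>b\<in>Basis. (w \<bullet> A b) *\<^sub>R b"] by metis
  have zb: "A z \<bullet> A b = w \<bullet> A b" if "b \<in> Basis" for b
    using arg_cong[OF z, of "\<lambda>y. y \<bullet> b"] that by simp
  have lin: "linear (\<lambda>u. p \<bullet> A u)" for p
    by (rule linearI) (simp_all add: linear_add[OF assms(1)] linear_scale[OF assms(1)] inner_add_right)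
  have "A z \<bullet> A u = w \<bullet> A u" for u
    using sum_family_linear[OF lin[of "A z"], of u] sum_family_linear[OF lin[of w], of u] zb by simp
  then have "\<exists>!z. \<forall>u. A z \<bullet> A u = w \<bullet> A u"
    using inner_range_cancel[OF assms] by metis
  from theI'[OF this] show ?thesis unfolding pinv_def by blast
qed

lemma pinv_unique:
  assumes "linear A" "inj A" "\<And>u. A z \<bullet> A u = w \<bullet> A u"
  shows "pinv A w = z"
  using inner_range_cancel[OF assms(1,2)] pinv[OF assms(1,2)] assms(3) by metis

lemma linear_pinv:
  assumes "linear A" "inj A"
  shows "linear (pinv A)"
  by (rule linearI; rule pinv_unique[OF assms])
     (simp_all add: linear_add[OF assms(1)] linear_scale[OF assms(1)] inner_add_left pinv[OF assms])

lemma smooth_on_pinv: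
  fixes A :: "'x::euclidean_space \<Rightarrow> 'e::euclidean_space \<Rightarrow> 'b::euclidean_space"
  assumes "open S" "\<And>x. x \<in> S \<Longrightarrow> linear (A x)" "\<And>x. x \<in> S \<Longrightarrow> inj (A x)"
    and "\<And>v. smooth_on S (\<lambda>x. A x v)" "smooth_on S w"
  shows "smooth_on S (\<lambda>x. pinv (A x) (w x))"
proof (rule smooth_onI)
  fix k
  show "Ck_on k S (\<lambda>x. pinv (A x) (w x))"
  proof (rule Ck_on_solve[OF assms(1) gram_linear_inj[OF assms(2,3)]])
    show "(\<Sum>b\<in>Basis. (A x (pinv (A x) (w x)) \<bullet> A x b) *\<^sub>R b) = (\<Sum>b\<in>Basis. (w x \<bullet> A x b) *\<^sub>R b)"
      if "x \<in> S" for x using pinv[OF assms(2,3)[OF that]] by simp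
    show "Ck_on k S (\<lambda>x. \<Sum>b\<in>Basis. (A x v \<bullet> A x b) *\<^sub>R b)" for v
      by (intro Ck_on_sum Ck_on_scaleR Ck_on_inner Ck_on_const smooth_onD[OF assms(4)] assms(1))
    show "Ck_on k S (\<lambda>x. \<Sum>b\<in>Basis. (w x \<bullet> A x b) *\<^sub>R b)"
      by (intro Ck_on_sum Ck_on_scaleR Ck_on_inner Ck_on_const smooth_onD[OF assms(4)]
          smooth_onD[OF assms(5)] assms(1))
  qed
qed

section \<open>The projection onto the tangent cone and its derivative\<close>

locale sphere_patch =
  fixes U :: "'e::euclidean_space set" and h :: "'e \<Rightarrow> 'b::euclidean_space" and J :: "'b \<Rightarrow> 'b"
  assumes open_U: "open U" and smooth_h: "smooth_on U h"
    and norm_h: "\<And>x. x \<in> U \<Longrightarrow> norm (h x) = 1"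
    and immersed: "\<And>x. x \<in> U \<Longrightarrow> inj (FD h x)"
    and linear_J: "linear J" and J_J: "\<And>v. J (J v) = - v"
    and J_skew: "\<And>v w. J v \<bullet> w = - (v \<bullet> J w)"
begin

text \<open>Chart coordinates of the tangential part: \<open>FD h x (tau x w)\<close> is the
  orthogonal projection of \<open>w\<close> onto the image of \<open>FD h x\<close>.\<close>

definition tau :: "'e \<Rightarrow> 'b \<Rightarrow> 'e" where "tau x = pinv (FD h x)"

text \<open>The radial and the tangential projection may be added because \<open>h x\<close> is a
  unit vector orthogonal to the image of \<open>FD h x\<close>.\<close>

definition P :: "'e \<Rightarrow> 'b \<Rightarrow> 'b" where "P x w = (h x \<bullet> w) *\<^sub>R h x + FD h x (tau x w)"

abbreviation Q :: "'e \<Rightarrow> 'e \<Rightarrow> 'b \<Rightarrow> 'b" where "Q x u w \<equiv> FD (\<lambda>y. P y w) x u"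

abbreviation D2 :: "'e \<Rightarrow> 'e \<Rightarrow> 'e \<Rightarrow> 'b" where "D2 x u v \<equiv> FD (\<lambda>y. FD h y v) x u"

lemma smooth_Dh: "smooth_on U (\<lambda>x. FD h x v)"
  using smooth_on_FD[OF smooth_h] .

lemma linear_Dh: "x \<in> U \<Longrightarrow> linear (FD h x)"
  by (rule linear_FD[OF smooth_on_differentiable[OF smooth_h]])

lemma bounded_J: "bounded_linear J"
  using linear_J linear_conv_bounded_linear by blast

lemma inner_h_h: "x \<in> U \<Longrightarrow> h x \<bullet> h x = 1"
  using norm_h by (simp add: norm_eq_1)

lemma h_Dh: "x \<in> U \<Longrightarrow> h x \<bullet> FD h x u = 0"
proof -
  assume x: "x \<in> U"
  have d: "h differentiable (at x)" using smooth_on_differentiable[OF smooth_h x] .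
  have "FD (\<lambda>y. 1::real) x u = FD (\<lambda>y. h y \<bullet> h y) x u"
    by (rule FD_cong_smooth[OF open_U x _ smooth_on_const]) (simp add: inner_h_h)
  then show ?thesis using FD_inner[OF d d, of u] by (simp add: inner_commute)
qed

lemma D2_commute: "x \<in> U \<Longrightarrow> D2 x u v = D2 x v u"
  by (rule FD_commute[OF open_U _ smooth_h])

text \<open>Derivative of the relation \<open>h_Dh\<close>. The curvature of the unit sphere enters
  \<open>gauss\<close> through this radial part of the second derivative.\<close>

lemma h_D2: "x \<in> U \<Longrightarrow> h x \<bullet> D2 x u v = - (FD h x u \<bullet> FD h x v)"
proof -
  assume x: "x \<in> U"
  have "FD (\<lambda>y. 0::real) x u = FD (\<lambda>y. h y \<bullet> FD h y v) x u"
    by (rule FD_cong_smooth[OF open_U x _ smooth_on_const]) (simp add: h_Dh)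
  then show ?thesis
    using FD_inner[OF smooth_on_differentiable[OF smooth_h x] smooth_on_differentiable[OF smooth_Dh x], of v u]
    by simp
qed

lemma tau_inner: "x \<in> U \<Longrightarrow> FD h x (tau x w) \<bullet> FD h x u = w \<bullet> FD h x u"
  unfolding tau_def by (rule pinv[OF linear_Dh immersed])

lemma tau_unique: "x \<in> U \<Longrightarrow> (\<And>u. FD h x z \<bullet> FD h x u = w \<bullet> FD h x u) \<Longrightarrow> tau x w = z"
  unfolding tau_def by (rule pinv_unique[OF linear_Dh immersed])

lemma tau_Dh: "x \<in> U \<Longrightarrow> tau x (FD h x u) = u"
  by (rule tau_unique) auto

lemma linear_tau: "x \<in> U \<Longrightarrow> linear (tau x)"
  unfolding tau_def by (rule linear_pinv[OF linear_Dh immersed])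

lemma smooth_tau: "smooth_on U w \<Longrightarrow> smooth_on U (\<lambda>x. tau x (w x))"
  unfolding tau_def by (rule smooth_on_pinv[OF open_U linear_Dh immersed smooth_Dh])

lemma smooth_P: "smooth_on U (\<lambda>x. P x w)"
  unfolding P_def
  by (intro smooth_on_add smooth_on_scaleR smooth_on_inner smooth_h smooth_on_const open_U
      smooth_on_family[OF open_U linear_Dh smooth_Dh] smooth_tau)

lemma linear_P: "x \<in> U \<Longrightarrow> linear (P x)"
  by (rule linearI)
     (simp_all add: P_def linear_add[OF linear_tau] linear_scale[OF linear_tau] linear_add[OF linear_Dh]
       linear_scale[OF linear_Dh] inner_add_right algebra_simps)

lemma P_Dh_inner: "x \<in> U \<Longrightarrow> P x w \<bullet> FD h x u = w \<bullet> FD h x u"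
  by (simp add: P_def inner_add_left tau_inner h_Dh)

lemma P_h_inner: "x \<in> U \<Longrightarrow> P x w \<bullet> h x = w \<bullet> h x"
  unfolding inner_commute[of "P x w"] inner_commute[of w] by (simp add: P_def inner_add_right inner_h_h h_Dh)

lemma P_sym: "x \<in> U \<Longrightarrow> P x w \<bullet> z = w \<bullet> P x z"
proof -
  assume x: "x \<in> U"
  have *: "P x w \<bullet> P x z = w \<bullet> P x z" for w z
    unfolding P_def[of x z] inner_add_right inner_scaleR_right
    using x by (simp add: P_h_inner P_Dh_inner)
  show ?thesis using *[of w z] *[of z w] by (simp add: inner_commute)
qed

lemma P_h: "x \<in> U \<Longrightarrow> P x (h x) = h x"
proof -
  assume x: "x \<in> U"
  have "tau x (h x) = 0" by (rule tau_unique[OF x]) (simp add: h_Dh x linear_0[OF linear_Dh])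
  then show ?thesis by (simp add: P_def x inner_h_h linear_0[OF linear_Dh])
qed

lemma P_Dh: "x \<in> U \<Longrightarrow> P x (FD h x u) = FD h x u"
  by (simp add: P_def h_Dh tau_Dh)

lemma P_P: "x \<in> U \<Longrightarrow> P x (P x w) = P x w"
proof -
  assume x: "x \<in> U"
  have "P x ((h x \<bullet> w) *\<^sub>R h x + FD h x (tau x w)) = (h x \<bullet> w) *\<^sub>R h x + FD h x (tau x w)"
    by (simp add: linear_add[OF linear_P] linear_scale[OF linear_P] P_h P_Dh x)
  then show ?thesis by (simp only: P_def[of x w])
qed

lemma linear_Q_dir: "x \<in> U \<Longrightarrow> linear (\<lambda>u. Q x u w)"
  using linear_FD[OF smooth_on_differentiable[OF smooth_P]] .

lemma FD_P:
  assumes "x \<in> U" "smooth_on U w"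
  shows "FD (\<lambda>y. P y (w y)) x u = Q x u (w x) + P x (FD w x u)"
  by (rule FD_family[OF open_U assms(1) linear_P smooth_P assms(2)])

lemma linear_Q: "x \<in> U \<Longrightarrow> linear (Q x u)"
proof -
  assume x: "x \<in> U"
  have d: "(\<lambda>y. P y w) differentiable (at x)" for w by (rule smooth_on_differentiable[OF smooth_P x])
  have "FD (\<lambda>y. P y (w + z)) x u = FD (\<lambda>y. P y w + P y z) x u" for w z
    by (rule FD_cong_smooth[OF open_U x _ smooth_P]) (simp add: linear_add[OF linear_P])
  moreover have "FD (\<lambda>y. P y w + P y z) x = (\<lambda>u. Q x u w + Q x u z)" for w z
    by (rule FD_eq[OF has_derivative_add[OF has_derivative_FD[OF d] has_derivative_FD[OF d]]])
  moreover have "FD (\<lambda>y. P y (r *\<^sub>R w)) x u = FD (\<lambda>y. r *\<^sub>R P y w) x u" for r w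
    by (rule FD_cong_smooth[OF open_U x _ smooth_P]) (simp add: linear_scale[OF linear_P])
  moreover have "FD (\<lambda>y. r *\<^sub>R P y w) x = (\<lambda>u. r *\<^sub>R Q x u w)" for r w
    by (rule FD_eq[OF has_derivative_scaleR_right[OF has_derivative_FD[OF d]]])
  ultimately show ?thesis by (intro linearI) simp_all
qed

lemma Q_h: "x \<in> U \<Longrightarrow> Q x u (h x) = 0"
proof -
  assume x: "x \<in> U"
  have "FD h x u = FD (\<lambda>y. P y (h y)) x u"
    by (rule FD_cong_smooth[OF open_U x _ smooth_h]) (simp add: P_h)
  then show ?thesis using FD_P[OF x smooth_h, of u] P_Dh[OF x] by simp
qed

text \<open>Derivative of the relation \<open>P_Dh\<close>: on tangent vectors \<open>Q\<close>
  returns the part of the second derivative normal to the cone.\<close>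

lemma Q_Dh: "x \<in> U \<Longrightarrow> Q x u (FD h x v) = D2 x u v - P x (D2 x u v)"
proof -
  assume x: "x \<in> U"
  have "FD (\<lambda>y. FD h y v) x u = FD (\<lambda>y. P y (FD h y v)) x u"
    by (rule FD_cong_smooth[OF open_U x _ smooth_Dh]) (simp add: P_Dh)
  then show ?thesis using FD_P[OF x smooth_Dh, of v u] by (simp add: eq_diff_eq)
qed

lemma Q_Dh_commute: "x \<in> U \<Longrightarrow> Q x u (FD h x v) = Q x v (FD h x u)"
  by (simp add: Q_Dh D2_commute[of x u v])

lemma Q_Dh_inner: "x \<in> U \<Longrightarrow> Q x u (FD h x v) \<bullet> Q x u' (FD h x v') = Q x u (FD h x v) \<bullet> D2 x u' v'"
  by (simp add: Q_Dh inner_diff_left inner_diff_right P_sym P_P)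

lemma Q_sym: "x \<in> U \<Longrightarrow> Q x u w \<bullet> z = w \<bullet> Q x u z"
proof -
  assume x: "x \<in> U"
  have d: "(\<lambda>y. P y w) differentiable (at x)" for w by (rule smooth_on_differentiable[OF smooth_P x])
  have "FD (\<lambda>y. P y w \<bullet> z) x u = FD (\<lambda>y. w \<bullet> P y z) x u"
    by (rule FD_cong_smooth[OF open_U x _ smooth_on_inner[OF open_U smooth_P smooth_on_const]])
       (simp add: P_sym)
  then show ?thesis
    using FD_inner[OF d[of w] differentiable_const[of z], of u] FD_inner[OF differentiable_const[of w] d[of z], of u]
    by (simp add: frechet_derivative_const)
qed

text \<open>Derivative of the idempotence of \<open>P\<close>. It says that \<open>Q\<close> maps
  the cone into its orthogonal complement and the complement into the cone.\<close>

lemma Q_P: "x \<in> U \<Longrightarrow> Q x u w = Q x u (P x w) + P x (Q x u w)"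
proof -
  assume x: "x \<in> U"
  have "FD (\<lambda>y. P y w) x u = FD (\<lambda>y. P y (P y w)) x u"
    by (rule FD_cong_smooth[OF open_U x _ smooth_P]) (simp add: P_P)
  then show ?thesis using FD_P[OF x smooth_P, of w u] by simp
qed

text \<open>\<open>Q\<close> vanishes on the cone, by symmetry its values are then orthogonal to the
  cone, and \<open>Q_P\<close> leaves nothing else.\<close>

lemma Q_eq_0:
  assumes "x \<in> U" "\<And>v. Q x u (FD h x v) = 0"
  shows "Q x u w = 0"
proof -
  have QP: "Q x u (P x w) = 0" for w
    by (simp add: P_def[of x w] linear_add[OF linear_Q] linear_scale[OF linear_Q] Q_h assms)
  have "P x (Q x u w) \<bullet> z = 0" for w z
    using QP[of z] Q_sym[OF assms(1), of w u "P x z"] P_sym[OF assms(1)] by simp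
  then have "P x (Q x u w) = 0" using inner_eq_zero_iff by blast
  then show ?thesis using Q_P[OF assms(1), of w u] QP by simp
qed

end

text \<open>Invariance of the cone under \<open>J\<close>, tested on its two kinds of
  generators.\<close>

locale complex_sphere_patch = sphere_patch +
  assumes P_J_Dh: "\<And>x u. x \<in> U \<Longrightarrow> P x (J (FD h x u)) = J (FD h x u)"
    and P_J_h: "\<And>x. x \<in> U \<Longrightarrow> P x (J (h x)) = J (h x)"
begin

text \<open>Invariance of the cone alone gives \<open>P J P = J P\<close>. Skewness of
  \<open>J\<close> makes the orthogonal complement invariant as well, and then \<open>P\<close>
  commutes with \<open>J\<close>.\<close>

lemma P_J: "x \<in> U \<Longrightarrow> P x (J w) = J (P x w)"
proof -
  assume x: "x \<in> U"
  have *: "P x (J (P x w)) = J (P x w)" for w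
    by (simp add: P_def[of x w] linear_add[OF linear_J] linear_scale[OF linear_J]
        linear_add[OF linear_P] linear_scale[OF linear_P] P_J_Dh P_J_h x)
  have "P x (J w) \<bullet> z = J (P x w) \<bullet> z" for z
  proof -
    have "P x (J w) \<bullet> z = - (w \<bullet> P x (J (P x z)))" using x by (simp add: P_sym J_skew *)
    also have "\<dots> = - (P x w \<bullet> J (P x z))" using x by (simp add: P_sym)
    also have "\<dots> = P x (J (P x w)) \<bullet> z" using x by (simp add: P_sym J_skew)
    finally show ?thesis by (simp add: *)
  qed
  then show ?thesis using vector_eq_rdot by blast
qed

lemma Q_J: "x \<in> U \<Longrightarrow> Q x u (J w) = J (Q x u w)"
proof -
  assume x: "x \<in> U"
  have "FD (\<lambda>y. P y (J w)) x u = FD (\<lambda>y. J (P y w)) x u"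
    by (rule FD_cong_smooth[OF open_U x _ smooth_P]) (simp add: P_J)
  then show ?thesis
    using FD_linear[OF bounded_J smooth_on_differentiable[OF smooth_P x], of w u] by simp
qed

end

section \<open>The Gauss equation\<close>

context sphere_patch
begin

abbreviation Gam :: "'e \<Rightarrow> 'e \<Rightarrow> 'e \<Rightarrow> 'e" where "Gam x u v \<equiv> tau x (D2 x u v)"

lemma smooth_D2: "smooth_on U (\<lambda>x. D2 x u v)"
  by (rule smooth_on_FD[OF smooth_Dh])

lemma smooth_Gam: "smooth_on U (\<lambda>x. Gam x u v)"
  by (rule smooth_tau[OF smooth_D2])

text \<open>Obtained by differentiating the relation that defines \<open>Gam\<close>, tested against
  \<open>FD h y z\<close>. The third-derivative term is symmetric in \<open>u\<close> and
  \<open>v\<close>; the non-tangential part of \<open>D2 x v w\<close> splits into a part normal to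
  the cone, which gives the \<open>Q\<close> term, and a radial part, which gives the product of
  metrics.\<close>

lemma gauss_half:
  assumes x: "x \<in> U"
  shows "FD h x (FD (\<lambda>y. Gam y v w) x u + Gam x u (Gam x v w)) \<bullet> FD h x z =
    FD (\<lambda>y. D2 y v w) x u \<bullet> FD h x z
    + Q x v (FD h x w) \<bullet> Q x u (FD h x z) + (FD h x v \<bullet> FD h x w) * (FD h x u \<bullet> FD h x z)"
proof -
  let ?A = "FD h x"
  have sm: "smooth_on U (\<lambda>y. FD h y (Gam y v w))"
    by (rule smooth_on_family[OF open_U linear_Dh smooth_Dh smooth_Gam])
  note d = smooth_on_differentiable[OF _ x]
  have "FD (\<lambda>y. FD h y (Gam y v w) \<bullet> FD h y z) x u = FD (\<lambda>y. D2 y v w \<bullet> FD h y z) x u"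
    by (rule FD_cong_smooth[OF open_U x _ smooth_on_inner[OF open_U sm smooth_Dh]]) (simp add: tau_inner)
  then have 1: "?A (Gam x v w) \<bullet> D2 x u z + FD (\<lambda>y. FD h y (Gam y v w)) x u \<bullet> ?A z
      = D2 x v w \<bullet> D2 x u z + FD (\<lambda>y. D2 y v w) x u \<bullet> ?A z"
    using FD_inner[OF d[OF sm] d[OF smooth_Dh], of z u] FD_inner[OF d[OF smooth_D2] d[OF smooth_Dh], of w v z u]
    by simp
  have 2: "FD (\<lambda>y. FD h y (Gam y v w)) x u = D2 x u (Gam x v w) + ?A (FD (\<lambda>y. Gam y v w) x u)"
    by (rule FD_family[OF open_U x linear_Dh smooth_Dh smooth_Gam])
  have "D2 x v w - ?A (Gam x v w) = Q x v (?A w) + (h x \<bullet> D2 x v w) *\<^sub>R h x"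
    using Q_Dh[OF x, of w v] by (simp add: P_def)
  then have "(D2 x v w - ?A (Gam x v w)) \<bullet> D2 x u z
      = Q x v (?A w) \<bullet> Q x u (?A z) + (?A v \<bullet> ?A w) * (?A u \<bullet> ?A z)"
    by (simp add: inner_add_left inner_diff_left h_D2[OF x] Q_Dh_inner[OF x])
  then show ?thesis
    using 1 unfolding 2
    by (simp add: linear_add[OF linear_Dh[OF x]] inner_add_left inner_diff_left tau_inner[OF x])
qed

text \<open>In the Koszul formula for an induced metric all second derivatives cancel in pairs
  except twice \<open>D2 x u v\<close> paired with \<open>FD h x z\<close>, so the Christoffel
  symbols are the tangential part of the second derivative.\<close>

lemma levi_civita_eq:
  assumes g: "\<And>y u v. y \<in> U \<Longrightarrow> g c y u v = FD h y u \<bullet> FD h y v" and x: "x \<in> U"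
  shows "levi_civita g c x u v = Gam x u v"
proof -
  note d = smooth_on_differentiable[OF smooth_Dh x]
  have Dg: "FD (\<lambda>y. g c y v w) x u = FD h x v \<bullet> D2 x u w + D2 x u v \<bullet> FD h x w" for u v w
  proof -
    have "FD (\<lambda>y. FD h y v \<bullet> FD h y w) x u = FD (\<lambda>y. g c y v w) x u"
      by (rule FD_cong_smooth[OF open_U x _ smooth_on_inner[OF open_U smooth_Dh smooth_Dh]]) (simp add: g)
    then show ?thesis using FD_inner[OF d d] by simp
  qed
  have K: "FD (\<lambda>y. g c y v z) x u + FD (\<lambda>y. g c y u z) x v - FD (\<lambda>y. g c y u v) x z
      = 2 * (D2 x u v \<bullet> FD h x z)" for z
    unfolding Dg using D2_commute[OF x, of u v] D2_commute[OF x, of u z] D2_commute[OF x, of v z]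
    by (simp add: inner_commute)
  have iff: "(\<forall>z. 2 * g c x w z = FD (\<lambda>y. g c y v z) x u + FD (\<lambda>y. g c y u z) x v - FD (\<lambda>y. g c y u v) x z)
      \<longleftrightarrow> w = Gam x u v" for w
    unfolding K g[OF x] using tau_inner[OF x, of "D2 x u v"] tau_unique[OF x, of w "D2 x u v"] by auto
  show ?thesis unfolding levi_civita_def iff by simp
qed

text \<open>Antisymmetrizing \<open>gauss_half\<close> in \<open>u\<close> and \<open>v\<close>
  cancels the third derivatives. The metric terms come from the curvature 1 of the sphere, the
  \<open>Q\<close> terms from the second fundamental form.\<close>

lemma gauss:
  assumes g: "\<And>y u v. y \<in> U \<Longrightarrow> g c y u v = FD h y u \<bullet> FD h y v" and x: "x \<in> U"
  shows "FD h x (riemann g c x u v w) \<bullet> FD h x z =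
    (FD h x v \<bullet> FD h x w) * (FD h x u \<bullet> FD h x z) - (FD h x u \<bullet> FD h x w) * (FD h x v \<bullet> FD h x z)
    + Q x v (FD h x w) \<bullet> Q x u (FD h x z) - Q x u (FD h x w) \<bullet> Q x v (FD h x z)"
proof -
  have L: "levi_civita g c y u v = Gam y u v" if "y \<in> U" for y u v
    by (rule levi_civita_eq) (simp_all add: g that)
  have DL: "FD (\<lambda>y. levi_civita g c y v w) x u = FD (\<lambda>y. Gam y v w) x u" for u v w
    by (rule FD_cong_smooth[OF open_U x _ smooth_Gam, symmetric]) (simp add: L)
  have R: "riemann g c x u v w = (FD (\<lambda>y. Gam y v w) x u + Gam x u (Gam x v w))
      - (FD (\<lambda>y. Gam y u w) x v + Gam x v (Gam x u w))"
    unfolding riemann_def DL L[OF x] by simp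
  have "FD (\<lambda>y. D2 y v w) x u = FD (\<lambda>y. D2 y u w) x v"
    by (rule FD_commute[OF open_U x smooth_Dh])
  then show ?thesis
    unfolding R linear_diff[OF linear_Dh[OF x]] inner_diff_left gauss_half[OF x] by simp
qed

text \<open>\<open>Basis\<close> is not orthonormal for the induced metric, so the trace is moved to
  a frame \<open>W\<close> of the cone. \<open>W\<close> need not be adapted to the radial
  direction, since \<open>tau x\<close> annihilates \<open>h x\<close>. Taking the whole cone rather
  than the tangent space is what makes \<open>J\<close> available in \<open>minimal\<close>.\<close>

lemma trace_eq:
  assumes x: "x \<in> U" and R: "linear R"
    and W: "finite W" "W \<subseteq> range (P x)" "\<And>w. w \<in> range (P x) \<Longrightarrow> (\<Sum>e\<in>W. (w \<bullet> e) *\<^sub>R e) = w"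
  shows "(\<Sum>b\<in>Basis. R b \<bullet> b) = (\<Sum>e\<in>W. FD h x (R (tau x e)) \<bullet> FD h x (tau x e))"
proof -
  have exp: "w = (\<Sum>e\<in>W. (FD h x w \<bullet> e) *\<^sub>R tau x e)" for w
  proof -
    have "FD h x w \<in> range (P x)" using P_Dh[OF x] by (metis rangeI)
    from arg_cong[OF W(3)[OF this], of "tau x"] show ?thesis
      by (simp add: linear_sum[OF linear_tau[OF x]] linear_scale[OF linear_tau[OF x]] tau_Dh[OF x])
  qed
  have lin: "linear (\<lambda>b. FD h x (R b) \<bullet> e)" for e
    by (rule linearI) (simp_all add: linear_add[OF R] linear_scale[OF R] linear_add[OF linear_Dh[OF x]]
        linear_scale[OF linear_Dh[OF x]] inner_add_left)
  have "(\<Sum>b\<in>Basis. R b \<bullet> b) = (\<Sum>b\<in>Basis. \<Sum>e\<in>W. (FD h x (R b) \<bullet> e) * (tau x e \<bullet> b))"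
  proof (rule sum.cong[OF refl])
    fix b show "R b \<bullet> b = (\<Sum>e\<in>W. (FD h x (R b) \<bullet> e) * (tau x e \<bullet> b))"
      using arg_cong[OF exp[of "R b"], of "\<lambda>w. w \<bullet> b"] by (simp add: inner_sum_left)
  qed
  also have "\<dots> = (\<Sum>e\<in>W. \<Sum>b\<in>Basis. (tau x e \<bullet> b) *\<^sub>R (FD h x (R b) \<bullet> e))"
    by (subst sum.swap) (simp add: mult.commute)
  also have "\<dots> = (\<Sum>e\<in>W. FD h x (R (tau x e)) \<bullet> e)"
    by (simp only: sum_family_linear[OF lin])
  also have "\<dots> = (\<Sum>e\<in>W. FD h x (R (tau x e)) \<bullet> FD h x (tau x e))"
    by (rule sum.cong[OF refl]) (metis tau_inner[OF x] inner_commute)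
  finally show ?thesis .
qed

end

section \<open>Minimality, Ricci curvature and the Einstein condition on a complex cone\<close>

context complex_sphere_patch
begin

text \<open>Complex submanifolds are minimal: \<open>S (J a) (J b) = - S a b\<close>, while the trace does not change
  under the isometry \<open>J\<close>.\<close>

lemma minimal:
  assumes x: "x \<in> U"
    and W: "finite W" "W \<subseteq> range (P x)" "\<And>w. w \<in> range (P x) \<Longrightarrow> (\<Sum>e\<in>W. (w \<bullet> e) *\<^sub>R e) = w"
  shows "(\<Sum>e\<in>W. Q x (tau x e) (FD h x (tau x e))) = 0"
proof -
  define S where "S a b = Q x (tau x a) b" for a b
  have S1: "S (\<Sum>e\<in>W. r e *\<^sub>R f e) b = (\<Sum>e\<in>W. r e *\<^sub>R S (f e) b)" for r f b
    by (simp add: S_def linear_sum[OF linear_tau[OF x]] linear_scale[OF linear_tau[OF x]]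
        linear_sum[OF linear_Q_dir[OF x]] linear_scale[OF linear_Q_dir[OF x]])
  have S2: "S a (\<Sum>e\<in>W. r e *\<^sub>R f e) = (\<Sum>e\<in>W. r e *\<^sub>R S a (f e))" for r f a
    by (simp add: S_def linear_sum[OF linear_Q[OF x]] linear_scale[OF linear_Q[OF x]])
  have S_tan: "S a (P x b) = Q x (tau x a) (FD h x (tau x b))" for a b
    by (simp add: S_def P_def[of x b] linear_add[OF linear_Q[OF x]] linear_scale[OF linear_Q[OF x]] Q_h[OF x])
  have tauP: "tau x (P x a) = tau x a" for a
    by (rule tau_unique[OF x]) (simp add: tau_inner[OF x] P_Dh_inner[OF x])
  \<comment> \<open>Outside the cone \<open>S a b\<close> need not be symmetric: \<open>a\<close>
    enters only through its tangential part, \<open>b\<close> entirely.\<close>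
  have S_sym: "S a b = S b a" if "a \<in> range (P x)" "b \<in> range (P x)" for a b
  proof -
    have "a = P x a" "b = P x b" using that P_P[OF x] by auto
    then show ?thesis using S_tan Q_Dh_commute[OF x] by metis
  qed
  have S_J: "S a (J b) = J (S a b)" for a b by (simp add: S_def Q_J[OF x])
  have JC: "J a \<in> range (P x)" if "a \<in> range (P x)" for a
    using that P_J[OF x] by (metis (no_types, lifting) imageE rangeI)
  have S_JJ: "S (J a) (J b) = - S a b" if "a \<in> range (P x)" "b \<in> range (P x)" for a b
    using S_sym[OF JC[OF that(1)] that(2)] S_sym[OF that] by (simp add: S_J J_J)
  \<comment> \<open>No rotated frame is introduced. Instead \<open>J e\<close> is expanded in
    \<open>W\<close>, the sums are exchanged, and skewness of \<open>J\<close> lets the expansion of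
    \<open>J p\<close> reassemble.\<close>
  have "(\<Sum>e\<in>W. S (J e) (J e)) = (\<Sum>e\<in>W. \<Sum>p\<in>W. (J e \<bullet> p) *\<^sub>R S p (J e))"
  proof (rule sum.cong[OF refl])
    fix e assume "e \<in> W"
    then have "(\<Sum>p\<in>W. (J e \<bullet> p) *\<^sub>R p) = J e" using W(2) W(3)[OF JC] by auto
    from arg_cong[OF this, of "\<lambda>a. S a (J e)"]
    show "S (J e) (J e) = (\<Sum>p\<in>W. (J e \<bullet> p) *\<^sub>R S p (J e))" unfolding S1 by simp
  qed
  also have "\<dots> = (\<Sum>p\<in>W. S p (\<Sum>e\<in>W. (J e \<bullet> p) *\<^sub>R J e))"
    by (subst sum.swap) (simp add: S2)
  also have "\<dots> = (\<Sum>p\<in>W. S p p)"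
  proof (rule sum.cong[OF refl])
    fix p assume "p \<in> W"
    then have "(\<Sum>e\<in>W. (J p \<bullet> e) *\<^sub>R e) = J p" using W(2) W(3)[OF JC] by auto
    from arg_cong[OF this, of J] have "(\<Sum>e\<in>W. (J p \<bullet> e) *\<^sub>R J e) = - p"
      by (simp add: linear_sum[OF linear_J] linear_scale[OF linear_J] J_J)
    moreover have "(\<Sum>e\<in>W. (J e \<bullet> p) *\<^sub>R J e) = - (\<Sum>e\<in>W. (J p \<bullet> e) *\<^sub>R J e)"
    proof -
      have "J e \<bullet> p = - (J p \<bullet> e)" for e using J_skew[of e p] by (simp add: inner_commute)
      then show ?thesis by (simp add: sum_negf)
    qed
    ultimately show "S p (\<Sum>e\<in>W. (J e \<bullet> p) *\<^sub>R J e) = S p p" by simp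
  qed
  finally have "(\<Sum>e\<in>W. S e e) = (\<Sum>e\<in>W. - S e e)" using S_JJ W(2) by (simp add: subset_iff)
  then have "2 *\<^sub>R (\<Sum>e\<in>W. S e e) = 0" by (simp add: sum_negf scaleR_2 eq_neg_iff_add_eq_0)
  then have "(\<Sum>e\<in>W. S e e) = 0" by simp
  moreover have "S e e = Q x (tau x e) (FD h x (tau x e))" if "e \<in> W" for e
  proof -
    have "e = P x e" using that W(2) P_P[OF x] by auto
    then show ?thesis using S_tan by metis
  qed
  ultimately show ?thesis by simp
qed

text \<open>Traced over \<open>W\<close>, the metric terms of \<open>gauss\<close> give
  \<open>DIM('a)\<close> copies of the squared length of the image of \<open>v\<close>, minus one;
  the mean curvature term drops by \<open>minimal\<close>, and the last term becomes a sum of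
  squares by \<open>Q_Dh_commute\<close>.\<close>

lemma ricci_eq:
  assumes g: "\<And>y u v. y \<in> U \<Longrightarrow> g c y u v = FD h y u \<bullet> FD h y v" and x: "x \<in> U"
    and W: "finite W" "W \<subseteq> range (P x)" "\<And>w. w \<in> range (P x) \<Longrightarrow> (\<Sum>e\<in>W. (w \<bullet> e) *\<^sub>R e) = w"
  shows "ricci g c x v v = (DIM('a) - 1) * (FD h x v \<bullet> FD h x v)
    - (\<Sum>e\<in>W. Q x (tau x e) (FD h x v) \<bullet> Q x (tau x e) (FD h x v))"
proof -
  let ?A = "FD h x"
  let ?R = "\<lambda>u. riemann g c x u v v"
  have G: "?A (riemann g c x u v w) \<bullet> ?A z =
    (?A v \<bullet> ?A w) * (?A u \<bullet> ?A z) - (?A u \<bullet> ?A w) * (?A v \<bullet> ?A z)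
    + Q x v (?A w) \<bullet> Q x u (?A z) - Q x u (?A w) \<bullet> Q x v (?A z)" for u v w z
    by (rule gauss) (simp_all add: g x)
  \<comment> \<open>\<open>riemann\<close> is built from derivatives and definite descriptions, so
    its linearity in the first argument is read off from \<open>G\<close>, whose right-hand side is
    visibly linear in \<open>u\<close>.\<close>
  have lin: "linear ?R"
    by (rule linearI; rule inner_range_cancel[OF linear_Dh[OF x] immersed[OF x]])
       (simp_all add: G linear_add[OF linear_Dh[OF x]] linear_scale[OF linear_Dh[OF x]]
          linear_add[OF linear_Q_dir[OF x]] linear_scale[OF linear_Q_dir[OF x]]
          inner_add_left inner_add_right algebra_simps)
  have min: "(\<Sum>e\<in>W. Q x (tau x e) (?A (tau x e))) = 0"
    by (rule minimal[OF x W(1,2)]) (rule W(3))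
  have d: "real (DIM('a)) = (\<Sum>e\<in>W. ?A (tau x e) \<bullet> ?A (tau x e))"
    using trace_eq[OF x linear_ident W] by simp
  have exp: "?A v \<bullet> ?A v = (\<Sum>e\<in>W. (?A (tau x e) \<bullet> ?A v) * (?A v \<bullet> ?A (tau x e)))"
  proof -
    have "?A v \<in> range (P x)" using P_Dh[OF x] by (metis rangeI)
    from arg_cong[OF W(3)[OF this], of "\<lambda>w. w \<bullet> ?A v"]
    have "?A v \<bullet> ?A v = (\<Sum>e\<in>W. (?A v \<bullet> e) * (e \<bullet> ?A v))" by (simp add: inner_sum_left)
    also have "\<dots> = (\<Sum>e\<in>W. (?A (tau x e) \<bullet> ?A v) * (?A v \<bullet> ?A (tau x e)))"
      by (rule sum.cong[OF refl]) (metis tau_inner[OF x] inner_commute)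
    finally show ?thesis .
  qed
  have "ricci g c x v v = (\<Sum>e\<in>W. ?A (?R (tau x e)) \<bullet> ?A (tau x e))"
    unfolding ricci_def by (rule trace_eq[OF x lin W])
  also have "\<dots> = (?A v \<bullet> ?A v) * (\<Sum>e\<in>W. ?A (tau x e) \<bullet> ?A (tau x e))
      - (\<Sum>e\<in>W. (?A (tau x e) \<bullet> ?A v) * (?A v \<bullet> ?A (tau x e)))
      + Q x v (?A v) \<bullet> (\<Sum>e\<in>W. Q x (tau x e) (?A (tau x e)))
      - (\<Sum>e\<in>W. Q x (tau x e) (?A v) \<bullet> Q x v (?A (tau x e)))"
    unfolding G by (simp add: sum.distrib sum_subtractf sum_distrib_left inner_sum_right)
  also have "\<dots> = (?A v \<bullet> ?A v) * DIM('a) - ?A v \<bullet> ?A v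
      - (\<Sum>e\<in>W. Q x (tau x e) (?A v) \<bullet> Q x (tau x e) (?A v))"
    unfolding min d[symmetric] exp[symmetric]
    by (simp add: Q_Dh_commute[OF x, of v "tau x _"])
  finally show ?thesis by (simp add: algebra_simps)
qed

lemma einstein_Q_eq_0:
  assumes g: "\<And>y u v. y \<in> U \<Longrightarrow> g c y u v = FD h y u \<bullet> FD h y v" and x: "x \<in> U"
    and l: "\<And>v. ricci g c x v v = l * g c x v v"
  shows "Q x u w = 0"
proof -
  have "subspace (range (P x))" by (rule linear_subspace_image[OF linear_P[OF x] subspace_UNIV])
  then obtain W where W: "W \<subseteq> range (P x)" "pairwise orthogonal W" "\<And>e. e \<in> W \<Longrightarrow> norm e = 1"
      "independent W" "span W = range (P x)"
    by (rule orthonormal_basis_subspace) (erule that, assumption+)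
  have fin: "finite W" using W(4) independent_bound by blast
  have exp: "(\<Sum>e\<in>W. (w \<bullet> e) *\<^sub>R e) = w" if "w \<in> range (P x)" for w
    using orthonormal_basis_expand[OF W(2,3)] that W(5) fin by blast
  have ric: "ricci g c x v v = (DIM('a) - 1) * (FD h x v \<bullet> FD h x v)
    - (\<Sum>e\<in>W. Q x (tau x e) (FD h x v) \<bullet> Q x (tau x e) (FD h x v))" for v
    by (rule ricci_eq) (simp_all add: g x fin W(1) exp)
  \<comment> \<open>The coordinates of the Reeb direction \<open>J (h x)\<close>, which is tangent
    because \<open>J\<close> is skew and the cone is invariant.\<close>
  define v0 where "v0 = tau x (J (h x))"
  have "h x \<bullet> J (h x) = 0" using J_skew[of "h x" "h x"] by (simp add: inner_commute)
  then have v0: "FD h x v0 = J (h x)"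
    using P_J_h[OF x] by (simp add: P_def v0_def)
  have "J (h x) \<bullet> J (h x) = 1" using inner_h_h[OF x] by (simp add: J_skew J_J)
  moreover have "Q x u (J (h x)) = 0" for u using Q_J[OF x] Q_h[OF x] linear_0[OF linear_J] by simp
  ultimately have "l = DIM('a) - 1" using ric[of v0] l[of v0] by (simp add: g x v0)
  then have sum0: "(\<Sum>e\<in>W. Q x (tau x e) (FD h x v) \<bullet> Q x (tau x e) (FD h x v)) = 0" for v
    using ric[of v] l[of v] by (simp add: g x)
  have Q0: "Q x (tau x e) (FD h x v) = 0" if "e \<in> W" for e v
    using sum0[of v] that sum_nonneg_eq_0_iff[OF fin, of "\<lambda>e. Q x (tau x e) (FD h x v) \<bullet> Q x (tau x e) (FD h x v)"]
    by simp
  \<comment> \<open>\<open>Q\<close> vanishes in the directions \<open>tau x e\<close>, and these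
    span all directions because \<open>W\<close> spans the cone.\<close>
  have "Q x u (FD h x v) = 0" for v
  proof -
    have "FD h x u \<in> range (P x)" using P_Dh[OF x] by (metis rangeI)
    from arg_cong[OF exp[OF this], of "tau x"]
    have u: "u = (\<Sum>e\<in>W. (FD h x u \<bullet> e) *\<^sub>R tau x e)"
      by (simp add: linear_sum[OF linear_tau[OF x]] linear_scale[OF linear_tau[OF x]] tau_Dh[OF x])
    have "Q x (\<Sum>e\<in>W. (FD h x u \<bullet> e) *\<^sub>R tau x e) (FD h x v) = 0"
      by (simp add: linear_sum[OF linear_Q_dir[OF x]] linear_scale[OF linear_Q_dir[OF x]] Q0)
    then show ?thesis using u by simp
  qed
  then show ?thesis by (rule Q_eq_0[OF x])
qed

end

section \<open>Local homeomorphisms onto simply connected spaces\<close>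

text \<open>A fibre is compact and, by local injectivity, discrete, hence finite. Its points get
  disjoint neighbourhoods on which \<open>p\<close> is injective; the compact rest of
  \<open>C\<close> has closed image missing \<open>y\<close>, so a small enough neighbourhood of
  \<open>y\<close> has its whole preimage inside these neighbourhoods.\<close>

lemma compact_local_homeomorphism_imp_covering_space:
  fixes C :: "'a::metric_space set" and p :: "'a \<Rightarrow> 'b::t2_space"
  assumes "compact C" "continuous_on C p" "p ` C = S"
    and op: "\<And>U. openin (top_of_set C) U \<Longrightarrow> openin (top_of_set S) (p ` U)"
    and inj: "\<And>x. x \<in> C \<Longrightarrow> \<exists>U. openin (top_of_set C) U \<and> x \<in> U \<and> inj_on p U"
  shows "covering_space C p S"
proof (rule covering_spaceI[OF assms(2,3)])
  fix y assume y: "y \<in> S"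
  define F where "F = C \<inter> p -` {y}"
  have "closedin (top_of_set C) F"
    unfolding F_def by (rule continuous_closedin_preimage[OF assms(2)]) simp
  then have "compact F" using assms(1) closedin_compact by blast
  have "\<forall>x\<in>F. \<exists>W. open W \<and> x \<in> W \<and> inj_on p (C \<inter> W)"
  proof
    fix x assume "x \<in> F"
    then obtain U where U: "openin (top_of_set C) U" "x \<in> U" "inj_on p U"
      using inj[of x] unfolding F_def by blast
    then obtain W where "open W" "U = C \<inter> W" using openin_open by blast
    with U show "\<exists>W. open W \<and> x \<in> W \<and> inj_on p (C \<inter> W)" by blast
  qed
  then obtain W where W: "\<And>x. x \<in> F \<Longrightarrow> open (W x)" "\<And>x. x \<in> F \<Longrightarrow> x \<in> W x"
      "\<And>x. x \<in> F \<Longrightarrow> inj_on p (C \<inter> W x)" by metis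
  have cov: "F \<subseteq> (\<Union>x\<in>F. W x)" by (auto intro: W(2))
  have "\<exists>F'\<subseteq>F. finite F' \<and> F \<subseteq> (\<Union>x\<in>F'. W x)"
    by (rule compactE_image[OF \<open>compact F\<close> W(1) cov]) blast+
  then obtain F' where F': "F' \<subseteq> F" "finite F'" "F \<subseteq> (\<Union>x\<in>F'. W x)" by blast
  \<comment> \<open>\<open>p\<close> is injective on \<open>C \<inter> W z\<close>, so
    \<open>W z\<close> holds a single fibre point, namely \<open>z\<close>.\<close>
  have "F \<subseteq> F'"
  proof
    fix x assume x: "x \<in> F"
    then obtain z where z: "z \<in> F'" "x \<in> W z" using F' by blast
    then have "x = z" using W(2,3)[of z] F'(1) x unfolding F_def inj_on_def by auto
    then show "x \<in> F'" using z by simp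
  qed
  then have fin: "finite F" using F'(2) finite_subset by blast
  have "\<forall>x. \<exists>\<delta>>0. \<forall>z\<in>F. z \<noteq> x \<longrightarrow> \<delta> \<le> dist x z" using finite_set_avoid[OF fin] by blast
  then obtain \<delta> where \<delta>: "\<And>x. \<delta> x > 0" "\<And>x z. z \<in> F \<Longrightarrow> z \<noteq> x \<Longrightarrow> \<delta> x \<le> dist x z" by metis
  define V where "V x = C \<inter> (W x \<inter> ball x (\<delta> x / 2))" for x
  have V_open: "openin (top_of_set C) (V x)" if "x \<in> F" for x
    unfolding V_def using W(1)[OF that] by (intro openin_open_Int open_Int) auto
  have V_inj: "inj_on p (V x)" if "x \<in> F" for x
    using W(3)[OF that] by (rule inj_on_subset) (auto simp: V_def)
  have V_mem: "x \<in> V x" if "x \<in> F" for x using that W(2)[OF that] \<delta>(1)[of x] by (auto simp: V_def F_def)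
  have V_disj: "V x \<inter> V z = {}" if "x \<in> F" "z \<in> F" "x \<noteq> z" for x z
  proof (rule ccontr)
    assume "V x \<inter> V z \<noteq> {}"
    then obtain w where "dist x w < \<delta> x / 2" "dist z w < \<delta> z / 2" by (auto simp: V_def)
    moreover have "dist x z \<le> dist x w + dist z w" by (metis dist_triangle2 add.commute dist_commute)
    ultimately show False using \<delta>(2)[of z x] \<delta>(2)[of x z] that by (simp add: dist_commute)
  qed
  define K where "K = C - (\<Union>x\<in>F. V x)"
  have "closedin (top_of_set C) K" unfolding K_def using V_open by (intro closedin_diff openin_Union) auto
  then have "compact K" using assms(1) closedin_compact by blast
  then have "closed (p ` K)"
    using assms(2) continuous_on_subset[of C p K] by (intro compact_imp_closed compact_continuous_image) (auto simp: K_def)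
  \<comment> \<open>Removing the image of \<open>K\<close> keeps all other points out of the
    preimage; intersecting with the images of the \<open>V x\<close> makes every sheet surject onto
    \<open>T\<close>.\<close>
  define T where "T = (S - p ` K) \<inter> (\<Inter>x\<in>F. p ` V x)"
  have "F \<noteq> {}" using y assms(3) by (auto simp: F_def)
  then have "openin (top_of_set S) (\<Inter>x\<in>F. p ` V x)"
    using fin op[OF V_open] by (intro openin_Inter) auto
  moreover have "openin (top_of_set S) (S - p ` K)"
    using \<open>closed (p ` K)\<close> by (simp add: open_openin_trans openin_open_Int Diff_eq open_Compl)
  ultimately have T: "openin (top_of_set S) T" unfolding T_def by (intro openin_Int)
  have py: "p x = y" if "x \<in> F" for x using that by (simp add: F_def)
  have yT: "y \<in> T"
  proof -
    have "y \<notin> p ` K" using V_mem unfolding K_def F_def by auto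
    moreover have "y \<in> p ` V x" if "x \<in> F" for x using V_mem[OF that] py[OF that] by blast
    ultimately show ?thesis using y by (auto simp: T_def)
  qed
  define v where "v = (\<lambda>x. V x \<inter> p -` T) ` F"
  have "\<Union>v = C \<inter> p -` T"
  proof
    show "\<Union>v \<subseteq> C \<inter> p -` T" by (auto simp: v_def V_def)
    show "C \<inter> p -` T \<subseteq> \<Union>v" by (auto simp: v_def T_def K_def)
  qed
  moreover have u_open: "openin (top_of_set C) u" if "u \<in> v" for u
  proof -
    obtain x where x: "x \<in> F" "u = V x \<inter> (C \<inter> p -` T)" using \<open>u \<in> v\<close> by (auto simp: v_def V_def)
    have "openin (top_of_set C) (C \<inter> p -` T)"
      using continuous_openin_preimage[OF assms(2) _ T] assms(3) by auto
    then show ?thesis using x V_open by (simp add: openin_Int)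
  qed
  moreover have "pairwise disjnt v"
    unfolding v_def pairwise_def disjnt_def using V_disj by blast
  moreover have "\<exists>q. homeomorphism u T p q" if u: "u \<in> v" for u
  proof -
    obtain x where x: "x \<in> F" "u = V x \<inter> p -` T" using u by (auto simp: v_def)
    have uC: "u \<subseteq> C" using x by (auto simp: V_def)
    have inj: "inj_on p u" by (rule inj_on_subset[OF V_inj[OF x(1)]]) (simp add: x(2))
    have "T \<subseteq> p ` V x" using x(1) by (auto simp: T_def)
    then have img: "p ` u = T" using x(2) by blast
    have "openin (top_of_set T) (p ` A)" if "openin (top_of_set u) A" for A
    proof -
      have "openin (top_of_set S) (p ` A)" using op openin_trans[OF that u_open[OF u]] by blast
      moreover have "p ` A \<subseteq> T" using img openin_imp_subset[OF that] by auto
      moreover have "T \<subseteq> S" by (auto simp: T_def)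
      ultimately show ?thesis using openin_subset_trans by blast
    qed
    then obtain q where "homeomorphism u T p q"
      by (rule homeomorphism_injective_open_map[OF continuous_on_subset[OF assms(2) uC] img inj])
    then show ?thesis by blast
  qed
  ultimately show "\<exists>T. y \<in> T \<and> openin (top_of_set S) T \<and>
      (\<exists>v. \<Union>v = C \<inter> p -` T \<and> (\<forall>u\<in>v. openin (top_of_set C) u) \<and> pairwise disjnt v \<and>
        (\<forall>u\<in>v. \<exists>q. homeomorphism u T p q))"
    using yT T by (intro exI[of _ T] exI[of _ v] conjI ballI) simp_all
qed

text \<open>The library only lifts maps through coverings between subsets of normed spaces; finitely many
  Urysohn functions separating the points of each fibre realize \<open>X\<close> inside such a space, with \<open>F\<close>
  turned into the first projection.\<close>

lemma compact_locally_injective_embedding: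
  fixes F :: "'a \<Rightarrow> 'b::real_normed_vector"
  assumes X: "compact_space X" "Hausdorff_space X" and F: "continuous_map X euclidean F"
    and inj: "\<And>x. x \<in> topspace X \<Longrightarrow> \<exists>U. openin X U \<and> x \<in> U \<and> inj_on F U"
  obtains C :: "('b \<times> (nat \<Rightarrow>\<^sub>C real)) set" and e
  where "homeomorphic_map X (top_of_set C) e" "\<And>x. x \<in> topspace X \<Longrightarrow> fst (e x) = F x"
proof -
  let ?P = "prod_topology X X"
  \<comment> \<open>The pairs that \<open>F\<close> fails to separate. Local injectivity keeps them
    away from the diagonal, so \<open>D\<close> is closed, hence compact, and finitely many
    functions separate all of them.\<close>
  define D where "D = {z \<in> topspace ?P. F (fst z) = F (snd z) \<and> fst z \<noteq> snd z}"
  have openin_neq: "openin ?P {z \<in> topspace ?P. u (fst z) \<noteq> u (snd z)}"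
    if "continuous_map X euclidean u" for u :: "'a \<Rightarrow> 'c::real_normed_vector"
  proof -
    have "continuous_map ?P euclidean (\<lambda>z. u (fst z) - u (snd z))"
      using continuous_map_compose[OF continuous_map_fst that] continuous_map_compose[OF continuous_map_snd that]
      by (auto simp: o_def intro!: continuous_map_diff)
    from openin_continuous_map_preimage[OF this, of "- {0}"] show ?thesis by (simp add: open_Compl)
  qed
  define W where "W = {z \<in> topspace ?P. F (fst z) \<noteq> F (snd z)} \<union> \<Union>{V \<times> V |V. openin X V \<and> inj_on F V}"
  have oW: "openin ?P W"
    unfolding W_def by (intro openin_Un openin_neq[OF F] openin_Union) (auto simp: openin_prod_Times_iff)
  have "D = topspace ?P - W"
  proof
    show "D \<subseteq> topspace ?P - W"
    proof
      fix z assume z: "z \<in> D"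
      have "z \<notin> V \<times> V" if "inj_on F V" for V
        using z inj_onD[OF that, of "fst z" "snd z"] by (auto simp: D_def mem_Times_iff)
      then have "z \<notin> \<Union>{V \<times> V |V. openin X V \<and> inj_on F V}" by blast
      then show "z \<in> topspace ?P - W" using z by (simp add: W_def D_def)
    qed
    show "topspace ?P - W \<subseteq> D"
    proof
      fix z assume z: "z \<in> topspace ?P - W"
      obtain x y where [simp]: "z = (x, y)" by (cases z)
      have "x \<noteq> y"
      proof
        assume "x = y"
        moreover obtain V where "openin X V" "x \<in> V" "inj_on F V" using inj[of x] z by auto
        ultimately have "z \<in> W" by (auto simp: W_def)
        then show False using z by simp
      qed
      then show "z \<in> D" using z by (auto simp: D_def W_def)
    qed
  qed
  then have "closedin ?P D" using closedin_diff[OF closedin_topspace oW] by simp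
  then have D: "compactin ?P D"
    using X by (intro closedin_compact_space) (auto simp: compact_space_prod_topology)
  define G where "G = (\<lambda>u::'a \<Rightarrow> real. {z \<in> topspace ?P. u (fst z) \<noteq> u (snd z)})"
  have "D \<subseteq> \<Union>(G ` {u. continuous_map X euclidean u})"
  proof
    fix z assume z: "z \<in> D"
    obtain x y where [simp]: "z = (x, y)" by (cases z)
    have xy: "x \<in> topspace X" "y \<in> topspace X" "x \<noteq> y" using z by (auto simp: D_def)
    have "completely_regular_space X"
      using X compact_Hausdorff_or_regular_imp_normal_space Hausdorff_imp_t1_space
        normal_imp_completely_regular_space_A by blast
    moreover have "closedin X {y}" using X(2) xy by (simp add: closedin_Hausdorff_sing_eq)
    ultimately obtain u where u: "continuous_map X (top_of_set {0..1::real}) u" "u x = 0" "u ` {y} \<subseteq> {1}"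
      using xy unfolding completely_regular_space_def by (metis DiffI singletonD)
    then have "continuous_map X euclidean u" by (simp add: continuous_map_in_subtopology)
    moreover have "z \<in> G u" using u xy by (auto simp: G_def)
    ultimately show "z \<in> \<Union>(G ` {u. continuous_map X euclidean u})" by blast
  qed
  then obtain \<F> where \<F>: "finite \<F>" "\<F> \<subseteq> G ` {u. continuous_map X euclidean u}" "D \<subseteq> \<Union>\<F>"
    using compactinD[OF D, of "G ` {u. continuous_map X euclidean u}"] openin_neq unfolding G_def by blast
  then obtain I where I: "I \<subseteq> {u. continuous_map X euclidean u}" "finite I" "\<F> = G ` I"
    using finite_subset_image[OF \<F>(1,2)] by blast
  \<comment> \<open>The number of separating functions is not known in advance, so their values are
    stored in a bounded sequence with finite support; \<open>\<iota>\<close> assigns each function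
    its own slot.\<close>
  obtain \<iota> :: "('a \<Rightarrow> real) \<Rightarrow> nat" where \<iota>: "inj_on \<iota> I" using finite_imp_inj_to_nat_seg[OF I(2)] by metis
  define \<delta> where "\<delta> i = Bcontfun (\<lambda>j. if j = i then 1 else 0 :: real)" for i :: nat
  have \<delta>: "apply_bcontfun (\<delta> i) j = (if j = i then 1 else 0)" for i j
  proof -
    have "(\<lambda>j. if j = i then 1 else 0 :: real) \<in> bcontfun"
      by (auto simp: bcontfun_def bounded_iff intro!: exI[of _ 1])
    then show ?thesis by (simp add: \<delta>_def Bcontfun_inverse)
  qed
  have ev: "apply_bcontfun (\<Sum>u\<in>A. r u *\<^sub>R \<delta> (\<iota> u)) j = (\<Sum>u\<in>A. if j = \<iota> u then r u else 0)" for A r j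
    by (induction A rule: infinite_finite_induct) (simp_all add: \<delta>)
  have coef: "apply_bcontfun (\<Sum>u\<in>I. r u *\<^sub>R \<delta> (\<iota> u)) (\<iota> v) = r v" if "v \<in> I" for r v
  proof -
    have "(\<Sum>u\<in>I. if \<iota> v = \<iota> u then r u else 0) = (\<Sum>u\<in>I. if v = u then r u else 0)"
      using \<iota> that by (intro sum.cong) (auto simp: inj_on_eq_iff)
    then show ?thesis using I(2) that by (simp add: ev)
  qed
  define e where "e x = (F x, \<Sum>u\<in>I. u x *\<^sub>R \<delta> (\<iota> u))" for x
  have "continuous_map X euclidean (\<lambda>x. \<Sum>u\<in>I. u x *\<^sub>R \<delta> (\<iota> u))"
  proof (rule continuous_map_sum[OF I(2)])
    fix u assume "u \<in> I"
    then have 1: "continuous_map X euclidean u" using I by blast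
    have 2: "continuous_map euclidean euclidean (\<lambda>r. r *\<^sub>R \<delta> (\<iota> u))"
      by (simp add: continuous_map_iff_continuous2 continuous_intros)
    from continuous_map_compose[OF 1 2]
    show "continuous_map X euclidean (\<lambda>x. u x *\<^sub>R \<delta> (\<iota> u))" by (simp add: o_def)
  qed
  then have "continuous_map X (prod_topology euclidean euclidean) e"
    unfolding e_def by (intro continuous_map_pairedI F)
  then have e: "continuous_map X (top_of_set (e ` topspace X)) e"
    by (simp add: continuous_map_in_subtopology)
  have "inj_on e (topspace X)"
  proof (rule inj_onI, rule ccontr)
    fix x y assume xy: "x \<in> topspace X" "y \<in> topspace X" "e x = e y" "x \<noteq> y"
    then have "(x, y) \<in> D" by (auto simp: D_def e_def)
    then obtain u where u: "u \<in> I" "u x \<noteq> u y" using \<F>(3) I(3) by (auto simp: G_def)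
    have "(\<Sum>u\<in>I. u x *\<^sub>R \<delta> (\<iota> u)) = (\<Sum>u\<in>I. u y *\<^sub>R \<delta> (\<iota> u))" using xy by (simp add: e_def)
    then show False using coef[OF u(1), of "\<lambda>u. u x"] coef[OF u(1), of "\<lambda>u. u y"] u(2) by simp
  qed
  then have "homeomorphic_map X (top_of_set (e ` topspace X)) e"
    using e X(1) by (intro continuous_imp_homeomorphic_map) (auto simp: Hausdorff_space_subtopology)
  then show thesis using that[of "e ` topspace X" e] by (simp add: e_def)
qed

text \<open>The identity of \<open>S\<close> lifts to a section \<open>g\<close> of the covering.
  Then \<open>g \<circ> fst\<close> and the identity of \<open>C\<close> are two lifts of
  \<open>fst\<close> that agree at \<open>a\<close>, so they agree on the connected
  \<open>C\<close>, and \<open>fst\<close> is injective.\<close>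

lemma local_homeomorphism_onto_simply_connected:
  fixes F :: "'a \<Rightarrow> 'b::real_normed_vector"
  assumes X: "compact_space X" "Hausdorff_space X" "connected_space X" "topspace X \<noteq> {}"
    and F: "continuous_map X (top_of_set S) F" "open_map X (top_of_set S) F"
    and inj: "\<And>x. x \<in> topspace X \<Longrightarrow> \<exists>U. openin X U \<and> x \<in> U \<and> inj_on F U"
    and S: "simply_connected S" "locally path_connected S"
  shows "bij_betw F (topspace X) S"
proof -
  have Fe: "continuous_map X euclidean F" using F(1) by (simp add: continuous_map_in_subtopology)
  obtain C :: "('b \<times> (nat \<Rightarrow>\<^sub>C real)) set" and e
    where e: "homeomorphic_map X (top_of_set C) e" and fe: "\<And>x. x \<in> topspace X \<Longrightarrow> fst (e x) = F x"
    using compact_locally_injective_embedding[OF X(1,2) Fe inj] by metis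
  have eC: "e ` topspace X = C" using homeomorphic_imp_surjective_map[OF e] by simp
  have ei: "inj_on e (topspace X)" by (rule homeomorphic_imp_injective_map[OF e])
  have ec: "continuous_map X (top_of_set C) e" by (rule homeomorphic_imp_continuous_map[OF e])
  have C: "compact C" using image_compactin[OF _ ec, of "topspace X"] X(1) eC
    by (simp add: compact_space_def compactin_subtopology)
  have conC: "connected C"
    using connectedin_continuous_map_image[OF ec, of "topspace X"] X(3) eC
    by (simp add: connectedin_subtopology connectedin_topspace)
  have fst_img: "fst ` e ` A = F ` A" if "A \<subseteq> topspace X" for A using fe that by (force simp: image_image)
  have lift_open: "\<exists>A. openin X A \<and> U = e ` A" if "openin (top_of_set C) U" for U
    using that homeomorphic_map_openness_eq[OF e] eC
    by (intro exI[of _ "{x \<in> topspace X. e x \<in> U}"] conjI openin_continuous_map_preimage[OF ec that])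
       (use openin_imp_subset[OF that] in auto)
  have op: "openin (top_of_set S) (fst ` U)" if U: "openin (top_of_set C) U" for U
  proof -
    obtain A where A: "openin X A" "U = e ` A" using lift_open[OF U] by blast
    then have "openin (top_of_set S) (F ` A)" using F(2) unfolding open_map_def by blast
    then show ?thesis using A fst_img[OF openin_subset[OF A(1)]] by simp
  qed
  have locinj: "\<exists>U. openin (top_of_set C) U \<and> x \<in> U \<and> inj_on fst U" if x: "x \<in> C" for x
  proof -
    obtain a where a: "a \<in> topspace X" "x = e a" using x eC by auto
    then obtain A where A: "openin X A" "a \<in> A" "inj_on F A" using inj by blast
    have "inj_on fst (e ` A)"
      using A(3) fe openin_subset[OF A(1)] by (auto simp: inj_on_def subset_iff)
    moreover have "openin (top_of_set C) (e ` A)"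
      using homeomorphic_map_openness_eq[OF e] A(1) by blast
    ultimately show ?thesis using A(2) a(2) by blast
  qed
  have CS: "fst ` C \<subseteq> S"
    using F(1) fst_img[of "topspace X"] eC by (auto simp: continuous_map_in_subtopology)
  \<comment> \<open>The image is open, compact and nonempty in a connected Hausdorff space.\<close>
  have "fst ` C = S"
  proof -
    have "connected S" using S(1) simply_connected_imp_connected by blast
    moreover have "openin (top_of_set S) (fst ` C)" using op[of C] by simp
    moreover have "closedin (top_of_set S) (fst ` C)"
      using C CS compact_continuous_image[OF continuous_on_fst[OF continuous_on_id] C]
      by (intro closed_subset compact_imp_closed) auto
    moreover have "fst ` C \<noteq> {}" using X(4) eC by auto
    ultimately show ?thesis unfolding connected_clopen by blast
  qed
  then have cov: "covering_space C fst S"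
    by (intro compact_local_homeomorphism_imp_covering_space C op locinj continuous_on_fst continuous_on_id)
  have "C \<noteq> {}" using X(4) eC by blast
  then obtain a where a: "a \<in> C" by blast
  have aS: "fst a \<in> S" and idS: "(\<lambda>x. x) \<in> S \<rightarrow> S" using CS a by auto
  obtain g where g: "continuous_on S g" "g \<in> S \<rightarrow> C" "g (fst a) = a" "\<And>y. y \<in> S \<Longrightarrow> fst (g y) = y"
    by (rule covering_space_lift_strong[OF cov a aS S continuous_on_id idS refl]) blast
  have "g (fst x) = x" if "x \<in> C" for x
  proof (rule covering_space_lift_unique[OF cov, where ?g1.0 = "\<lambda>x. g (fst x)" and ?g2.0 = "\<lambda>x. x"
        and a = a and T = C and f = fst])
    show "continuous_on C (\<lambda>x. g (fst x))"
      by (rule continuous_on_compose2[OF g(1) _ CS]) (intro continuous_intros)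
    show "continuous_on C (fst :: 'b \<times> (nat \<Rightarrow>\<^sub>C real) \<Rightarrow> 'b)"
      "continuous_on C (\<lambda>x. x)" by (intro continuous_intros)+
  qed (use g(2-4) CS a that conC in auto)
  then have "inj_on fst C" by (rule inj_on_inverseI)
  have "inj_on F (topspace X)"
  proof (rule inj_onI)
    fix x y assume xy: "x \<in> topspace X" "y \<in> topspace X" "F x = F y"
    then have "e x = e y" using inj_onD[OF \<open>inj_on fst C\<close>, of "e x" "e y"] eC fe by auto
    then show "x = y" using inj_onD[OF ei] xy by blast
  qed
  moreover have "F ` topspace X = S" using \<open>fst ` C = S\<close> fst_img[of "topspace X"] eC by simp
  ultimately show ?thesis by (simp add: bij_betw_def)
qed

section \<open>Charts of spheres\<close>

text \<open>Local injectivity requires continuity of the derivative in operator norm; this follows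
  from continuity of \<open>FD f x b\<close> for the finitely many basis vectors
  \<open>b\<close>.\<close>

lemma immersion_locally_injective:
  fixes f :: "'e::euclidean_space \<Rightarrow> 'b::euclidean_space"
  assumes "open U" "a \<in> U" "smooth_on U f" "inj (FD f a)"
  obtains r where "r > 0" "ball a r \<subseteq> U" "inj_on f (ball a r)"
proof -
  have fd: "(f has_derivative FD f x) (at x)" if "x \<in> U" for x
    by (rule has_derivative_FD[OF smooth_on_differentiable[OF assms(3) that]])
  have lin: "linear (FD f x)" if "x \<in> U" for x using fd[OF that] has_derivative_linear by blast
  obtain g where g: "linear g" "g \<circ> FD f a = id"
    using linear_injective_left_inverse[OF lin[OF assms(2)] assms(4)] by blast
  have cont: "isCont (\<lambda>x. \<Sum>b\<in>Basis. norm (FD f x b - FD f a b)) a"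
  proof -
    have "isCont (\<lambda>x. FD f x b) a" for b
      by (rule continuous_on_interior[OF smooth_on_continuous[OF smooth_on_FD[OF assms(3)]]])
        (use assms(1,2) in \<open>simp add: interior_open\<close>)
    then show ?thesis by (intro continuous_intros)
  qed
  have small: "\<exists>d>0. \<forall>x. dist a x < d \<longrightarrow> onorm (\<lambda>v. FD f x v - FD f a v) < e" if e: "e > 0" for e
  proof -
    obtain d1 where d1: "d1 > 0" "\<And>x. dist x a < d1 \<Longrightarrow> (\<Sum>b\<in>Basis. norm (FD f x b - FD f a b)) < e"
      using cont[unfolded continuous_at_eps_delta, rule_format, OF e] by (auto simp: dist_real_def abs_less_iff)
    obtain d2 where d2: "d2 > 0" "ball a d2 \<subseteq> U" using openE[OF assms(1,2)] by metis
    have "onorm (\<lambda>v. FD f x v - FD f a v) < e" if x: "dist a x < min d1 d2" for x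
    proof -
      have xU: "x \<in> U" using x d2 by auto
      have lin2: "linear (\<lambda>v. FD f x v - FD f a v)" using lin[OF xU] lin[OF assms(2)] by (rule linear_compose_sub)
      have "norm (FD f x v - FD f a v) \<le> (\<Sum>b\<in>Basis. norm (FD f x b - FD f a b)) * norm v" for v
      proof -
        have "norm (FD f x v - FD f a v) = norm (\<Sum>b\<in>Basis. (v \<bullet> b) *\<^sub>R (FD f x b - FD f a b))"
          using sum_family_linear[OF lin2, of v] by simp
        also have "\<dots> \<le> (\<Sum>b\<in>Basis. norm (FD f x b - FD f a b) * norm v)"
          by (rule sum_norm_le) (simp add: Basis_le_norm mult.commute mult_right_mono)
        finally show ?thesis by (simp add: sum_distrib_right)
      qed
      then have "onorm (\<lambda>v. FD f x v - FD f a v) \<le> (\<Sum>b\<in>Basis. norm (FD f x b - FD f a b))"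
        by (rule onorm_le)
      then show ?thesis using d1(2)[of x] x by (simp add: dist_commute)
    qed
    then show ?thesis using d1(1) d2(1) by (intro exI[of _ "min d1 d2"]) auto
  qed
  have "bounded_linear g" using g(1) linear_conv_bounded_linear by blast
  from has_derivative_locally_injective[OF assms(2,1) this g(2) fd small] that
  show thesis by blast
qed

text \<open>The cone over an immersed hypersurface patch of the sphere is open, by the inverse function
  theorem applied to \<open>(x, t) \<mapsto> t H x\<close>.\<close>

lemma immersion_open_in_sphere:
  fixes H :: "'e::euclidean_space \<Rightarrow> 'b::euclidean_space"
  assumes "open U" "smooth_on U H" "\<And>x. x \<in> U \<Longrightarrow> norm (H x) = 1"
    and imm: "\<And>x. x \<in> U \<Longrightarrow> inj (FD H x)" and dim: "DIM('e) + 1 = DIM('b)"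
  shows "openin (top_of_set (sphere 0 1)) (H ` U)"
proof (subst openin_euclidean_subtopology_iff, intro conjI ballI)
  show "H ` U \<subseteq> sphere 0 1" using assms(3) by auto
  fix q assume "q \<in> H ` U"
  then obtain x where x: "x \<in> U" "q = H x" by blast
  define \<Phi> where "\<Phi> = (\<lambda>z. snd z *\<^sub>R H (fst z))"
  define V where "V = U \<times> {0::real<..}"
  have Hd: "(H has_derivative FD H y) (at y)" if "y \<in> U" for y
    by (rule has_derivative_FD[OF smooth_on_differentiable[OF assms(2) that]])
  define \<Phi>' where "\<Phi>' = (\<lambda>w. FD H x (fst w) + snd w *\<^sub>R H x)"
  have "((\<lambda>z. H (fst z)) has_derivative (\<lambda>w. FD H x (fst w))) (at (x, 1))"
    by (rule has_derivative_compose[OF has_derivative_fst[OF has_derivative_ident]]) (use Hd[OF x(1)] in simp)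
  from has_derivative_scaleR[OF has_derivative_snd[OF has_derivative_ident] this]
  have d: "(\<Phi> has_derivative \<Phi>') (at (x, 1))"
    by (simp add: \<Phi>_def \<Phi>'_def)
  have lin: "linear \<Phi>'" using d has_derivative_linear by blast
  have orth: "H x \<bullet> FD H x u = 0" for u
  proof -
    have "FD (\<lambda>y. 1::real) x u = FD (\<lambda>y. H y \<bullet> H y) x u"
      using assms(3) by (intro FD_cong_smooth[OF assms(1) x(1) _ smooth_on_const]) (simp add: norm_eq_1)
    then show ?thesis
      using FD_inner[of H x H u] smooth_on_differentiable[OF assms(2) x(1)] by (simp add: inner_commute)
  qed
  have "w = 0" if "\<Phi>' w = 0" for w
  proof -
    have "H x \<bullet> \<Phi>' w = snd w" using assms(3)[OF x(1)] orth by (simp add: \<Phi>'_def inner_add_right norm_eq_1)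
    then have "snd w = 0" using that by simp
    moreover have "FD H x (fst w) = 0" using that \<open>snd w = 0\<close> by (simp add: \<Phi>'_def)
    then have "fst w = 0"
      using imm[OF x(1)] linear_injective_0[OF linear_FD[OF smooth_on_differentiable[OF assms(2) x(1)]]] by blast
    ultimately show ?thesis by (simp add: prod_eq_iff)
  qed
  then have inj: "inj \<Phi>'" using linear_injective_0[OF lin] by blast
  \<comment> \<open>The extra coordinate t makes the dimensions equal, so injectivity of the
    derivative is enough.\<close>
  have "surj \<Phi>'"
  proof -
    have "dim (range \<Phi>') = dim (UNIV :: ('e \<times> real) set)"
      by (rule dim_image_eq[OF lin]) (simp add: inj)
    then have "dim (range \<Phi>') = DIM('b)" using dim by simp
    then have "span (range \<Phi>') = UNIV" by (simp add: dim_eq_full)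
    moreover have "span (range \<Phi>') = range \<Phi>'" using linear_subspace_image[OF lin subspace_UNIV] by simp
    ultimately show ?thesis by simp
  qed
  then obtain g where g: "linear g" "\<Phi>' \<circ> g = id" using linear_surjective_right_inverse[OF lin] by blast
  have "\<Phi> (x, 1) \<in> interior (\<Phi> ` V)"
  proof (rule sussmann_open_mapping[OF _ _ _ d _ g(2)])
    show V: "open V" using assms(1) by (simp add: V_def open_Times)
    show "continuous_on V \<Phi>" unfolding \<Phi>_def V_def
      by (intro continuous_intros continuous_on_compose2[OF smooth_on_continuous[OF assms(2)]]) auto
    show "(x, 1) \<in> V" using x by (simp add: V_def)
    then show "(x, 1) \<in> interior V" using V by (simp add: interior_open)
    show "bounded_linear g" using g(1) linear_conv_bounded_linear by blast
  qed simp
  then have "\<exists>e>0. ball (\<Phi> (x, 1)) e \<subseteq> \<Phi> ` V" by (simp only: mem_interior)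
  moreover have "\<Phi> (x, 1) = q" by (simp add: \<Phi>_def x(2))
  ultimately obtain e where e: "e > 0" "ball q e \<subseteq> \<Phi> ` V" by auto
  have "q' \<in> H ` U" if q': "q' \<in> sphere 0 1" "dist q' q < e" for q'
  proof -
    have "q' \<in> \<Phi> ` V" using e(2) q'(2) by (auto simp: dist_commute)
    then obtain y t where y: "y \<in> U" "t > 0" "q' = t *\<^sub>R H y" by (auto simp: V_def \<Phi>_def)
    then have "t = 1" using q'(1) assms(3)[OF y(1)] by simp
    then show ?thesis using y by simp
  qed
  then show "\<exists>e>0. \<forall>x'\<in>sphere 0 1. dist x' q < e \<longrightarrow> x' \<in> H ` U" using e(1) by blast
qed

text \<open>Projection from the antipode of \<open>p\<close>, the only unit vector with
  \<open>p \<bullet> q = - 1\<close>, onto the hyperplane orthogonal to \<open>p\<close>, which the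
  isometry \<open>A\<close> identifies with \<open>'f\<close>. The inverse \<open>\<psi>\<close> is
  given by a formula that also makes sense off the sphere, so that it can be differentiated in the
  ambient space and the chain rule yields injectivity of the derivative of
  \<open>\<sigma>\<close>.\<close>

lemma stereographic_projection:
  fixes p :: "'b::euclidean_space"
  assumes p: "norm p = 1" and dim: "DIM('f::euclidean_space) + 1 = DIM('b)"
  obtains \<sigma> :: "'f::euclidean_space \<Rightarrow> 'b" and \<psi> :: "'b \<Rightarrow> 'f" where "smooth_on UNIV \<sigma>"
    "\<And>x. norm (\<sigma> x) = 1" "\<And>x. p \<bullet> \<sigma> x \<noteq> - 1" "\<And>x. \<psi> (\<sigma> x) = x"
    "\<And>q. norm q = 1 \<Longrightarrow> p \<bullet> q \<noteq> - 1 \<Longrightarrow> \<sigma> (\<psi> q) = q"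
    "\<And>q. p \<bullet> q \<noteq> - 1 \<Longrightarrow> \<psi> differentiable (at q)"
proof -
  have "p \<noteq> 0" using p by auto
  have pp: "p \<bullet> p = 1" using p by (simp add: norm_eq_1)
  define T where "T = {w. p \<bullet> w = 0}"
  have sT: "subspace T" unfolding T_def by (rule subspace_hyperplane)
  have dT: "dim (UNIV :: 'f set) = dim T" unfolding T_def using dim dim_hyperplane[OF \<open>p \<noteq> 0\<close>] by simp
  obtain A :: "'f \<Rightarrow> 'b" and B where A: "linear A" "linear B" "A ` UNIV = T"
      "\<And>x. norm (A x) = norm x" "\<And>w. w \<in> T \<Longrightarrow> norm (B w) = norm w" "\<And>x. B (A x) = x"
      "\<And>w. w \<in> T \<Longrightarrow> A (B w) = w"
    by (rule isometries_subspaces[OF subspace_UNIV sT dT], rule that) simp_all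
  have pA: "p \<bullet> A x = 0" for x using A(3) by (auto simp: T_def)
  have AA: "A x \<bullet> A x = x \<bullet> x" for x using A(4)[of x] by (simp add: norm_eq)
  have pos: "1 + x \<bullet> x > 0" for x :: 'f by (simp add: add_pos_nonneg)
  define \<sigma> where "\<sigma> x = inverse (1 + x \<bullet> x) *\<^sub>R ((1 + (- 1) * (x \<bullet> x)) *\<^sub>R p + 2 *\<^sub>R A x)" for x
  define \<psi> where "\<psi> q = inverse (1 + p \<bullet> q) *\<^sub>R B (q - (p \<bullet> q) *\<^sub>R p)" for q
  have bA: "bounded_linear A" "bounded_linear B" using A(1,2) linear_conv_bounded_linear by auto
  show thesis
  proof
    show "smooth_on UNIV \<sigma>"
    proof (rule smooth_onI)
      fix k
      have A: "Ck_on k UNIV A" by (rule Ck_on_linear[OF open_UNIV bA(1) Ck_on_id])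
      have s: "Ck_on k UNIV (\<lambda>x::'f. 1 + x \<bullet> x)"
        by (intro Ck_on_add Ck_on_const Ck_on_inner Ck_on_id open_UNIV)
      have "Ck_on k UNIV (\<lambda>x::'f. 1 + (- 1) *\<^sub>R (x \<bullet> x))"
        by (intro Ck_on_add Ck_on_const Ck_on_scaleR Ck_on_inner Ck_on_id open_UNIV)
      then have s': "Ck_on k UNIV (\<lambda>x::'f. 1 + (- 1) * (x \<bullet> x))" by (simp only: real_scaleR_def)
      have n: "1 + x \<bullet> x \<noteq> 0" for x :: 'f using pos[of x] by simp
      show "Ck_on k UNIV \<sigma>" unfolding \<sigma>_def
        by (rule Ck_on_scaleR[OF open_UNIV Ck_on_inverse[OF open_UNIV n s]
              Ck_on_add[OF open_UNIV Ck_on_scaleR[OF open_UNIV s' Ck_on_const]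
                Ck_on_scaleR[OF open_UNIV Ck_on_const A]]])
    qed
    have s: "p \<bullet> \<sigma> x = (1 - x \<bullet> x) / (1 + x \<bullet> x)" for x
      by (simp add: \<sigma>_def inner_add_right pp pA divide_inverse mult.commute)
    show "p \<bullet> \<sigma> x \<noteq> - 1" for x using pos[of x] by (simp add: s field_simps)
    show "norm (\<sigma> x) = 1" for x
    proof -
      let ?s = "x \<bullet> x"
      let ?w = "(1 + (- 1) * ?s) *\<^sub>R p + 2 *\<^sub>R A x"
      have "A x \<bullet> p = 0" using pA[of x] by (simp add: inner_commute)
      then have "?w \<bullet> ?w = (1 + ?s) * (1 + ?s)"
        by (simp add: inner_add_left inner_add_right pp pA AA algebra_simps)
      then have "\<sigma> x \<bullet> \<sigma> x = inverse (1 + ?s) * (inverse (1 + ?s) * ((1 + ?s) * (1 + ?s)))"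
        by (simp only: \<sigma>_def inner_scaleR_left inner_scaleR_right)
      also have "\<dots> = 1" using pos[of x] by (simp flip: mult.assoc)
      finally show ?thesis by (simp add: norm_eq_1)
    qed
    show "\<psi> (\<sigma> x) = x" for x
    proof -
      have "\<sigma> x - (p \<bullet> \<sigma> x) *\<^sub>R p = (2 / (1 + x \<bullet> x)) *\<^sub>R A x"
        unfolding s by (simp add: \<sigma>_def scaleR_add_right divide_inverse mult.commute)
      moreover have "1 + p \<bullet> \<sigma> x = 2 / (1 + x \<bullet> x)" unfolding s using pos[of x] by (simp add: field_simps)
      ultimately have "\<psi> (\<sigma> x) = (inverse (2 / (1 + x \<bullet> x)) * (2 / (1 + x \<bullet> x))) *\<^sub>R x"
        by (simp only: \<psi>_def linear_scale[OF A(2)] A(6) scaleR_scaleR)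
      also have "inverse (2 / (1 + x \<bullet> x)) * (2 / (1 + x \<bullet> x)) = 1" using pos[of x] by simp
      finally show ?thesis by simp
    qed
    show "\<sigma> (\<psi> q) = q" if q: "norm q = 1" "p \<bullet> q \<noteq> - 1" for q
    proof -
      define t where "t = p \<bullet> q"
      define y where "y = q - t *\<^sub>R p"
      have t: "1 + t \<noteq> 0" using q(2) by (auto simp: t_def add_eq_0_iff)
      have yT: "y \<in> T" by (simp add: T_def y_def inner_diff_right pp t_def)
      have "q \<bullet> q = 1" using q(1) by (simp add: norm_eq_1)
      then have yy: "y \<bullet> y = 1 - t * t"
        by (simp add: y_def inner_diff_left inner_diff_right pp inner_commute[of q p] t_def)
      define x where "x = \<psi> q"
      have x: "x = inverse (1 + t) *\<^sub>R B y" by (simp add: x_def \<psi>_def t_def y_def)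
      have "B y \<bullet> B y = 1 - t * t" using A(5)[OF yT] yy by (simp add: norm_eq)
      then have "x \<bullet> x = (1 - t * t) / ((1 + t) * (1 + t))" by (simp add: x divide_inverse)
      also have "\<dots> = ((1 - t) * (1 + t)) / ((1 + t) * (1 + t))" by (simp add: algebra_simps)
      finally have xx: "x \<bullet> x = (1 - t) / (1 + t)" using t by simp
      have "1 + x \<bullet> x = 2 / (1 + t)" "1 + (- 1) * (x \<bullet> x) = 2 * t / (1 + t)"
        using t unfolding xx by (simp_all add: field_simps)
      moreover have "A x = inverse (1 + t) *\<^sub>R y" by (simp add: x linear_scale[OF A(1)] A(7)[OF yT])
      ultimately have "\<sigma> x = inverse (2 / (1 + t)) *\<^sub>R ((2 * t / (1 + t)) *\<^sub>R p + 2 *\<^sub>R (inverse (1 + t) *\<^sub>R y))"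
        by (simp only: \<sigma>_def)
      also have "\<dots> = t *\<^sub>R p + y" using t by (simp add: scaleR_add_right)
      finally have "\<sigma> x = t *\<^sub>R p + y" .
      then show ?thesis by (simp add: x_def y_def)
    qed
    show "\<psi> differentiable (at q)" if "p \<bullet> q \<noteq> - 1" for q
    proof -
      have "(\<lambda>q. B (q - (p \<bullet> q) *\<^sub>R p)) differentiable (at q)"
        using bounded_linear.has_derivative[OF bA(2), of "\<lambda>q. q - (p \<bullet> q) *\<^sub>R p"]
        by (force simp: differentiable_def intro!: derivative_intros)
      moreover have "(\<lambda>q. inverse (1 + p \<bullet> q)) differentiable (at q)"
      proof -
        have d: "((\<lambda>q. 1 + p \<bullet> q) has_derivative (\<lambda>v. p \<bullet> v)) (at q)"
          by (auto intro!: derivative_eq_intros)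
        have "1 + p \<bullet> q \<noteq> 0" using that by (auto simp: add_eq_0_iff)
        from differentiableI[OF Deriv.has_derivative_inverse[OF this d]] show ?thesis .
      qed
      ultimately show ?thesis unfolding \<psi>_def by (intro differentiable_scaleR) auto
    qed
  qed
qed

section \<open>The maximal atlas of the sphere\<close>

lemma sphere_atlasD:
  fixes c :: "((real^'k) \<times> (real^'k), 'f::euclidean_space) chart"
  assumes "c \<in> sphere_atlas"
  shows "openin (top_of_set (sphere 0 1)) (fst c)" "open (coord_image c)"
    "continuous_on (fst c) (snd c)" "continuous_on (coord_image c) (param c)"
    "\<And>x. x \<in> coord_image c \<Longrightarrow> param c x \<in> fst c" "\<And>x. x \<in> coord_image c \<Longrightarrow> snd c (param c x) = x"
    "\<And>p. p \<in> fst c \<Longrightarrow> snd c p \<in> coord_image c" "\<And>p. p \<in> fst c \<Longrightarrow> param c (snd c p) = p"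
    "smooth_on (coord_image c) (param c)"
    "\<And>x. x \<in> coord_image c \<Longrightarrow> inj (FD (param c) x)"
    "\<And>p. p \<in> fst c \<Longrightarrow> norm p = 1"
proof -
  have c: "openin (top_of_set (sphere 0 1)) (fst c)" "open (coord_image c)"
    "homeomorphism (fst c) (coord_image c) (snd c) (param c)" "smooth_on (coord_image c) (param c)"
    "\<And>x. x \<in> coord_image c \<Longrightarrow> inj (FD (param c) x)"
    using assms unfolding sphere_atlas_def by auto
  show "openin (top_of_set (sphere 0 1)) (fst c)" "open (coord_image c)"
    "smooth_on (coord_image c) (param c)" "\<And>x. x \<in> coord_image c \<Longrightarrow> inj (FD (param c) x)"
    using c by auto
  show "continuous_on (fst c) (snd c)" "continuous_on (coord_image c) (param c)"
    "\<And>x. x \<in> coord_image c \<Longrightarrow> param c x \<in> fst c" "\<And>x. x \<in> coord_image c \<Longrightarrow> snd c (param c x) = x"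
    "\<And>p. p \<in> fst c \<Longrightarrow> snd c p \<in> coord_image c" "\<And>p. p \<in> fst c \<Longrightarrow> param c (snd c p) = p"
    using c(3) unfolding homeomorphism_def by auto
  show "\<And>p. p \<in> fst c \<Longrightarrow> norm p = 1" using openin_imp_subset[OF c(1)] by auto
qed

text \<open>\<open>param\<close> is an \<open>inv_into\<close> that is compared with
  \<open>\<sigma>\<close> on \<open>V\<close> only; since \<open>V\<close> is open, the derivatives
  agree there as well.\<close>

lemma sphere_atlasI:
  fixes \<sigma> :: "'f::euclidean_space \<Rightarrow> (real^'k) \<times> (real^'k)"
  assumes "openin (top_of_set (sphere 0 1)) W" "open V" "homeomorphism W V \<psi> \<sigma>"
    and "smooth_on V \<sigma>" "\<And>x. x \<in> V \<Longrightarrow> inj (FD \<sigma> x)"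
  shows "(W, \<psi>) \<in> sphere_atlas"
proof -
  have V: "coord_image (W, \<psi>) = V" using assms(3) by (simp add: coord_image_def homeomorphism_def)
  have "inj_on \<psi> W" using assms(3) unfolding homeomorphism_def by (metis inj_on_inverseI)
  then have eq: "\<sigma> x = param (W, \<psi>) x" if "x \<in> V" for x
    using assms(3) that unfolding homeomorphism_def param_def
    by (metis fst_conv imageI inv_into_f_f snd_conv)
  have "homeomorphism W V \<psi> (param (W, \<psi>))"
    using homeomorphism_cong[OF assms(3) refl refl] eq by auto
  moreover have "smooth_on V (param (W, \<psi>))" by (rule smooth_on_cong[OF assms(2) eq assms(4)])
  moreover have "inj (FD (param (W, \<psi>)) x)" if "x \<in> V" for x
  proof -
    have "FD \<sigma> x = FD (param (W, \<psi>)) x"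
      by (rule ext) (rule FD_cong_smooth[OF assms(2) that eq assms(4)])
    then show ?thesis using assms(5)[OF that] by simp
  qed
  ultimately show ?thesis unfolding sphere_atlas_def using V assms(1,2) by simp
qed

text \<open>Stereographic charts belong to the maximal atlas. Pullback conditions quantify over the
  charts of the target, and this is what makes them say something at every point.\<close>

lemma sphere_atlas_covers:
  fixes q :: "(real^'k) \<times> (real^'k)"
  assumes "norm q = 1" "DIM('f::euclidean_space) + 1 = 2 * CARD('k)"
  shows "\<exists>c :: ((real^'k) \<times> (real^'k), 'f::euclidean_space) chart. c \<in> sphere_atlas \<and> q \<in> fst c"
proof -
  have "DIM('f) + 1 = DIM((real^'k) \<times> (real^'k))" using assms(2) by simp
  from stereographic_projection[OF assms(1) this] obtain \<sigma> :: "'f \<Rightarrow> _" and \<psi> where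
    *: "smooth_on UNIV \<sigma>" "\<And>x. norm (\<sigma> x) = 1" "\<And>x. q \<bullet> \<sigma> x \<noteq> - 1" "\<And>x. \<psi> (\<sigma> x) = x"
    "\<And>p. norm p = 1 \<Longrightarrow> q \<bullet> p \<noteq> - 1 \<Longrightarrow> \<sigma> (\<psi> p) = p"
    "\<And>p. q \<bullet> p \<noteq> - 1 \<Longrightarrow> \<psi> differentiable (at p)" by metis
  define W where "W = sphere 0 1 \<inter> {p. q \<bullet> p \<noteq> - 1}"
  have "open {p. q \<bullet> p \<noteq> - 1}" by (intro open_Collect_neq continuous_intros)
  then have W: "openin (top_of_set (sphere 0 1)) W" by (simp add: W_def openin_open_Int)
  have "continuous_on W \<psi>"
    by (intro differentiable_imp_continuous_on differentiable_at_imp_differentiable_on) (auto simp: W_def *(6))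
  have \<sigma>W: "\<sigma> x \<in> W" for x using *(2,3) by (simp add: W_def)
  have W\<sigma>: "\<sigma> (\<psi> p) = p" if "p \<in> W" for p using that *(5) by (simp add: W_def)
  have "range \<sigma> = W" "\<psi> ` W = UNIV" using \<sigma>W W\<sigma> *(4) by (metis rangeI subsetI subset_antisym image_subsetI, metis \<sigma>W *(4) UNIV_eq_I imageI)
  then have hom: "homeomorphism W UNIV \<psi> \<sigma>"
    using smooth_on_continuous[OF *(1)] \<open>continuous_on W \<psi>\<close> W\<sigma> *(4) unfolding homeomorphism_def by simp
  have "inj (FD \<sigma> x)" for x
  proof -
    have "(\<sigma> has_derivative FD \<sigma> x) (at x)" by (rule has_derivative_FD[OF smooth_on_differentiable[OF *(1)]]) simp
    from has_derivative_compose[OF this has_derivative_FD[OF *(6)[OF *(3)]]]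
    have "FD (\<lambda>x. \<psi> (\<sigma> x)) x = (\<lambda>v. FD \<psi> (\<sigma> x) (FD \<sigma> x v))" by (rule FD_eq)
    moreover have "FD (\<lambda>x. \<psi> (\<sigma> x)) x = (\<lambda>v. v)" unfolding *(4) by (rule FD_eq[OF has_derivative_ident])
    ultimately show ?thesis by (metis injI)
  qed
  then have "(W, \<psi>) \<in> sphere_atlas" by (intro sphere_atlasI[OF W open_UNIV hom *(1)])
  moreover have "q \<in> W" using assms(1) by (simp add: W_def norm_eq_1)
  ultimately show ?thesis by force
qed

text \<open>A chart matters only on a subset of the sphere, so it has no ambient derivative to
  compose with; but its inverse is an immersion, and \<open>smooth_on_factor\<close>
  applies.\<close>

lemma smooth_on_sphere_chart:
  fixes c :: "((real^'k) \<times> (real^'k), 'f::euclidean_space) chart" and G :: "'e::euclidean_space \<Rightarrow> _"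
  assumes c: "c \<in> sphere_atlas" and G: "open U" "smooth_on U G" "G \<in> U \<rightarrow> fst c"
  shows "smooth_on U (\<lambda>x. snd c (G x))"
proof (rule smooth_on_factor[OF G(1) sphere_atlasD(2,9,10)[OF c]])
  show "continuous_on U (\<lambda>x. snd c (G x))"
    by (rule continuous_on_compose2[OF sphere_atlasD(3)[OF c] smooth_on_continuous[OF G(2)]]) (use G(3) in auto)
  show "(\<lambda>x. snd c (G x)) \<in> U \<rightarrow> coord_image c" by (rule Pi_I) (rule sphere_atlasD(7)[OF c funcset_mem[OF G(3)]])
  show "smooth_on U (\<lambda>x. param c (snd c (G x)))"
    by (rule smooth_on_cong[OF G(1) _ G(2)]) (simp add: sphere_atlasD(8)[OF c funcset_mem[OF G(3)]])
qed

section \<open>Unitary coordinates\<close>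

text \<open>Induction splits off the complex line spanned by a unit vector \<open>a\<close> and
  \<open>J a\<close>. These are orthogonal because \<open>J\<close> is skew, and for the same reason
  the orthogonal complement of the line in \<open>C\<close> is again invariant.\<close>

lemma complex_orthonormal_basis:
  fixes C :: "'b::euclidean_space set" and J :: "'b \<Rightarrow> 'b"
  assumes J: "linear J" "\<And>v. J (J v) = - v" "\<And>v w. J v \<bullet> w = - (v \<bullet> J w)"
    and "subspace C" "J ` C \<subseteq> C" "dim C = 2 * n"
  shows "\<exists>e. (\<forall>i<n. e i \<in> C) \<and> (\<forall>i<n. \<forall>j<n. e i \<bullet> e j = (if i = j then 1 else 0) \<and> e i \<bullet> J (e j) = 0) \<and>
    (\<forall>w\<in>C. (\<forall>i<n. w \<bullet> e i = 0 \<and> w \<bullet> J (e i) = 0) \<longrightarrow> w = 0)"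
  using assms(4-6)
proof (induction n arbitrary: C)
  case 0
  then show ?case by (auto simp: dim_eq_0)
next
  case (Suc n)
  have "\<not> C \<subseteq> {0}" using Suc.prems(3) dim_eq_0[of C] by auto
  then obtain v where v: "v \<in> C" "v \<noteq> 0" by blast
  define a where "a = v /\<^sub>R norm v"
  have a: "a \<in> C" "a \<bullet> a = 1"
    using v Suc.prems(1) by (simp_all add: a_def subspace_scale dot_square_norm power2_eq_square)
  have aJ: "a \<bullet> J a = 0" using J(3)[of a a] by (simp add: inner_commute)
  have Ja: "J a \<in> C" "J a \<bullet> J a = 1" using Suc.prems(2) a J by (auto simp: J(3)[of a])
  define B where "B = span {a, J a}"
  have "independent {a, J a}" "a \<noteq> J a"
  proof -
    show "a \<noteq> J a" using a(2) aJ by auto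
    have "pairwise orthogonal {a, J a}" using aJ by (auto simp: pairwise_def orthogonal_def inner_commute)
    moreover have "0 \<notin> {a, J a}" using a(2) Ja(2) by auto
    ultimately show "independent {a, J a}" by (rule pairwise_orthogonal_independent)
  qed
  then have dB: "dim B = 2" unfolding B_def by (simp add: dim_span dim_eq_card_independent)
  have BC: "B \<subseteq> C" unfolding B_def using a(1) Ja(1) Suc.prems(1) by (intro span_minimal) auto
  define C' where "C' = {y \<in> C. \<forall>x\<in>B. orthogonal x y}"
  have C'_iff: "y \<in> C' \<longleftrightarrow> y \<in> C \<and> a \<bullet> y = 0 \<and> J a \<bullet> y = 0" for y
  proof -
    have "(\<forall>x\<in>B. orthogonal x y) \<longleftrightarrow> orthogonal a y \<and> orthogonal (J a) y"
    proof
      assume "\<forall>x\<in>B. orthogonal x y"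
      then show "orthogonal a y \<and> orthogonal (J a) y" by (simp add: B_def span_base)
    next
      assume "orthogonal a y \<and> orthogonal (J a) y"
      then have "orthogonal y x" if "x \<in> B" for x
        using that unfolding B_def by (intro orthogonal_to_span[of x "{a, J a}"]) (auto simp: orthogonal_commute)
      then show "\<forall>x\<in>B. orthogonal x y" by (simp add: orthogonal_commute)
    qed
    then show ?thesis by (auto simp: C'_def orthogonal_def)
  qed
  have "dim C' + dim B = dim C"
    unfolding C'_def by (rule dim_subspace_orthogonal_to_vectors) (use Suc.prems(1) BC in \<open>auto simp: B_def\<close>)
  then have dC': "dim C' = 2 * n" using Suc.prems(3) dB by simp
  have sC': "subspace C'"
    using Suc.prems(1) by (auto simp: subspace_def C'_iff inner_add_right)
  have "J ` C' \<subseteq> C'"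
  proof safe
    fix y assume "y \<in> C'"
    then show "J y \<in> C'"
      using Suc.prems(2) J(3)[of a y] J(3)[of "J a" y] J(2)[of a] by (auto simp: C'_iff J(2))
  qed
  from Suc.IH[OF sC' this dC'] obtain e where e: "\<And>i. i < n \<Longrightarrow> e i \<in> C'"
      "\<And>i j. i < n \<Longrightarrow> j < n \<Longrightarrow> e i \<bullet> e j = (if i = j then 1 else 0) \<and> e i \<bullet> J (e j) = 0"
      "\<And>w. w \<in> C' \<Longrightarrow> (\<And>i. i < n \<Longrightarrow> w \<bullet> e i = 0 \<and> w \<bullet> J (e i) = 0) \<Longrightarrow> w = 0"
    by (elim exE conjE) (rule that, blast, blast, blast)
  have eC: "e i \<in> C" "a \<bullet> e i = 0" "J a \<bullet> e i = 0" if "i < n" for i using e(1)[OF that] by (auto simp: C'_iff)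
  let ?e = "e(n := a)"
  have 1: "?e i \<in> C" if "i < Suc n" for i using that eC a(1) by (cases "i = n") auto
  have 2: "?e i \<bullet> ?e j = (if i = j then 1 else 0) \<and> ?e i \<bullet> J (?e j) = 0"
    if ij: "i < Suc n" "j < Suc n" for i j
  proof -
    have "a \<bullet> J (e j) = 0" if "j < n" for j using J(3)[of a "e j"] eC(3)[OF that] by simp
    moreover have "e i \<bullet> a = 0" "e i \<bullet> J a = 0" if "i < n" for i
      using eC(2,3)[OF that] by (simp_all add: inner_commute)
    ultimately show ?thesis using ij e(2)[of i j] a(2) aJ eC(2) by (cases "i = n"; cases "j = n") auto
  qed
  have 3: "w = 0" if w: "w \<in> C" "\<forall>i<Suc n. w \<bullet> ?e i = 0 \<and> w \<bullet> J (?e i) = 0" for w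
  proof (rule e(3))
    show "w \<in> C'" using w(1) w(2)[rule_format, of n] by (simp add: C'_iff inner_commute)
    show "w \<bullet> e i = 0 \<and> w \<bullet> J (e i) = 0" if "i < n" for i using w(2)[rule_format, of i] that by auto
  qed
  show ?case by (rule exI[of _ ?e], intro conjI allI impI ballI) (use 1 2 3 in blast)+
qed

definition cJ :: "'v::real_vector \<times> 'v \<Rightarrow> 'v \<times> 'v" where
  "cJ p = (- snd p, fst p)"

lemma linear_cJ: "linear cJ"
  by (rule linearI) (simp_all add: cJ_def)

lemma cJ_cJ: "cJ (cJ p) = - p"
  by (simp add: cJ_def prod_eq_iff)

lemma cJ_skew: "cJ p \<bullet> q = - (p \<bullet> cJ q)" for p :: "'v::real_inner \<times> 'v"
  by (simp add: cJ_def inner_prod_def)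

text \<open>At a point of the unit sphere \<open>cJ p\<close> is the Hopf field, which is the Reeb
  field; the standard contact form is its metric dual.\<close>

lemma ambient_form_eq: "ambient_form p w = cJ p \<bullet> w"
  by (simp add: ambient_form_def cJ_def inner_prod_def inner_vec_def sum_subtractf sum_negf)

text \<open>\<open>L\<close> reads off real and imaginary parts with respect to a unitary basis of
  \<open>C\<close>. It is linear and commutes with the complex structures on the whole ambient
  space, so it can be composed with the immersion directly; membership in \<open>C\<close> matters
  only for inner products.\<close>

lemma unitary_coordinates:
  fixes C :: "'b::euclidean_space set" and J :: "'b \<Rightarrow> 'b"
  assumes J: "linear J" "\<And>v. J (J v) = - v" "\<And>v w. J v \<bullet> w = - (v \<bullet> J w)"
    and C: "subspace C" "J ` C \<subseteq> C" "dim C = 2 * CARD('m::finite)"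
  obtains L :: "'b \<Rightarrow> (real^'m) \<times> (real^'m)"
  where "linear L" "\<And>w. L (J w) = cJ (L w)" "\<And>w z. w \<in> C \<Longrightarrow> z \<in> C \<Longrightarrow> L w \<bullet> L z = w \<bullet> z"
proof -
  obtain e where e: "\<And>i. i < CARD('m) \<Longrightarrow> e i \<in> C"
    "\<And>i j. i < CARD('m) \<Longrightarrow> j < CARD('m) \<Longrightarrow> e i \<bullet> e j = (if i = j then 1 else 0) \<and> e i \<bullet> J (e j) = 0"
    "\<And>w. w \<in> C \<Longrightarrow> (\<And>i. i < CARD('m) \<Longrightarrow> w \<bullet> e i = 0 \<and> w \<bullet> J (e i) = 0) \<Longrightarrow> w = 0"
    using complex_orthonormal_basis[OF J C] by (elim exE conjE) (rule that, blast, blast, blast)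
  obtain k :: "'m \<Rightarrow> nat" where k: "bij_betw k UNIV {0..<CARD('m)}"
    using ex_bij_betw_finite_nat[OF finite_class.finite_UNIV] by blast
  define b where "b i = e (k i)" for i
  have k': "k i < CARD('m)" for i using k by (auto simp: bij_betw_def)
  have kinj: "k i = k j \<longleftrightarrow> i = j" for i j using k by (auto simp: bij_betw_def inj_eq)
  have b: "b i \<in> C" "b i \<bullet> b j = (if i = j then 1 else 0)" "b i \<bullet> J (b j) = 0" for i j
    using e(1,2) k' kinj by (auto simp: b_def)
  have Jb: "J (b i) \<in> C" "J (b i) \<bullet> J (b j) = (if i = j then 1 else 0)" "J (b i) \<bullet> b j = 0" for i j
    using b C(2) by (auto simp: J)
  define L :: "'b \<Rightarrow> (real^'m) \<times> (real^'m)" where "L w = ((\<chi> i. b i \<bullet> w), (\<chi> i. J (b i) \<bullet> w))" for w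
  have exp: "w = (\<Sum>i\<in>UNIV. (b i \<bullet> w) *\<^sub>R b i + (J (b i) \<bullet> w) *\<^sub>R J (b i))" if w: "w \<in> C" for w
  proof -
    define z where "z = (\<Sum>i\<in>UNIV. (b i \<bullet> w) *\<^sub>R b i + (J (b i) \<bullet> w) *\<^sub>R J (b i))"
    have "z \<in> C" unfolding z_def
      using b(1) Jb(1) C(1) by (intro subspace_sum subspace_add subspace_scale) auto
    have zb: "z \<bullet> b j = b j \<bullet> w" "z \<bullet> J (b j) = J (b j) \<bullet> w" for j
      by (simp_all add: z_def inner_sum_left inner_add_left b Jb if_distrib[of "(*) _"] cong: if_cong)
    have "w - z = 0"
    proof (rule e(3))
      show "w - z \<in> C" using w \<open>z \<in> C\<close> C(1) by (simp add: subspace_diff)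
      fix i assume "i < CARD('m)"
      then obtain j where "i = k j" using k by (metis bij_betw_imp_surj_on imageE lessThan_atLeast0 lessThan_iff)
      then show "(w - z) \<bullet> e i = 0 \<and> (w - z) \<bullet> J (e i) = 0"
        using zb[of j] by (simp add: b_def inner_diff_left inner_commute)
    qed
    then show ?thesis by (simp add: z_def)
  qed
  show thesis
  proof
    show "linear L" by (rule linearI) (simp_all add: L_def vec_eq_iff inner_add_right)
    show "L (J w) = cJ (L w)" for w
      using J(3)[of _ w] J(3)[of "J _" w] by (simp add: L_def cJ_def vec_eq_iff J(2))
    show "L w \<bullet> L z = w \<bullet> z" if "w \<in> C" "z \<in> C" for w z
    proof -
      have "w \<bullet> z = (\<Sum>i\<in>UNIV. (b i \<bullet> w) * (b i \<bullet> z) + (J (b i) \<bullet> w) * (J (b i) \<bullet> z))"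
        using arg_cong[OF exp[OF that(1)], of "\<lambda>w. w \<bullet> z"] by (simp add: inner_sum_left inner_add_left)
      then show ?thesis by (simp add: L_def inner_prod_def inner_vec_def sum.distrib)
    qed
  qed
qed

section \<open>From charts to the manifold\<close>

lemma param_props:
  assumes "inj_on (snd c) (fst c)"
  shows "\<And>x. x \<in> coord_image c \<Longrightarrow> param c x \<in> fst c" "\<And>x. x \<in> coord_image c \<Longrightarrow> snd c (param c x) = x"
    "\<And>p. p \<in> fst c \<Longrightarrow> snd c p \<in> coord_image c" "\<And>p. p \<in> fst c \<Longrightarrow> param c (snd c p) = p"
  using assms by (auto simp: coord_image_def param_def)

lemma local_dom_eq:
  assumes "inj_on (snd c) (fst c)"
  shows "local_dom F c c' = {x \<in> coord_image c. F (param c x) \<in> fst c'}"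
  using assms by (auto simp: local_dom_def coord_image_def param_def)

lemma open_local_dom:
  assumes "inj_on (snd c) (fst c)" "open (coord_image c)"
    and "continuous_map (top_of_set (coord_image c)) X (param c)" "continuous_map X Y F" "openin Y (fst c')"
  shows "open (local_dom F c c')"
proof -
  have "openin (top_of_set (coord_image c)) {x \<in> topspace (top_of_set (coord_image c)). (F \<circ> param c) x \<in> fst c'}"
    by (rule openin_continuous_map_preimage[OF continuous_map_compose[OF assms(3,4)] assms(5)])
  then show ?thesis using assms(2) by (simp add: local_dom_eq[OF assms(1)] openin_open_eq)
qed

lemma manifold_chart:
  assumes "smooth_manifold X A" "c \<in> A"
  shows "openin X (fst c)" "open (coord_image c)" "inj_on (snd c) (fst c)" "fst c \<subseteq> topspace X"
    "continuous_map (subtopology X (fst c)) (top_of_set (coord_image c)) (snd c)"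
    "continuous_map (top_of_set (coord_image c)) X (param c)"
proof -
  have c: "openin X (fst c)" "open (coord_image c)"
    "homeomorphic_map (subtopology X (fst c)) (top_of_set (coord_image c)) (snd c)"
    using assms by (auto simp: smooth_manifold_def)
  show 1: "openin X (fst c)" "open (coord_image c)" "fst c \<subseteq> topspace X"
    "continuous_map (subtopology X (fst c)) (top_of_set (coord_image c)) (snd c)"
    using c openin_subset homeomorphic_imp_continuous_map by auto
  have top: "topspace (subtopology X (fst c)) = fst c" using 1(3) by auto
  show inj: "inj_on (snd c) (fst c)" using homeomorphic_imp_injective_map[OF c(3)] unfolding top .
  obtain g where g: "homeomorphic_maps (subtopology X (fst c)) (top_of_set (coord_image c)) (snd c) g"
    using c(3) homeomorphic_map_maps by blast
  have "g x = param c x" if "x \<in> coord_image c" for x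
    using g param_props[OF inj] that unfolding homeomorphic_maps_def top by metis
  then have "continuous_map (top_of_set (coord_image c)) (subtopology X (fst c)) (param c)"
    using g continuous_map_eq unfolding homeomorphic_maps_def
    by (metis topspace_euclidean_subtopology)
  then show "continuous_map (top_of_set (coord_image c)) X (param c)"
    by (rule continuous_map_into_fulltopology)
qed

lemma chart_open_image:
  assumes "smooth_manifold X A" "c \<in> A" "open W"
  shows "openin X {p \<in> fst c. snd c p \<in> W}"
proof -
  note m = manifold_chart[OF assms(1,2)]
  have "openin (subtopology X (fst c)) {p \<in> topspace (subtopology X (fst c)). snd c p \<in> coord_image c \<inter> W}"
    by (rule openin_continuous_map_preimage[OF m(5)]) (simp add: assms(3) openin_open_Int)
  moreover have "{p \<in> topspace (subtopology X (fst c)). snd c p \<in> coord_image c \<inter> W} = {p \<in> fst c. snd c p \<in> W}"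
    using m(4) by (auto simp: coord_image_def)
  ultimately show ?thesis using openin_trans_full m(1) by metis
qed

lemma sphere_chart:
  fixes c :: "((real^'k) \<times> (real^'k), 'f::euclidean_space) chart"
  assumes "c \<in> sphere_atlas"
  shows "inj_on (snd c) (fst c)" "continuous_map (top_of_set (coord_image c)) (top_of_set (sphere 0 1)) (param c)"
proof -
  note s = sphere_atlasD[OF assms]
  show "inj_on (snd c) (fst c)" by (rule inj_on_inverseI) (rule s(8))
  show "continuous_map (top_of_set (coord_image c)) (top_of_set (sphere 0 1)) (param c)"
    using s(4,5,11) by auto
qed

text \<open>\<open>param c'\<close> undoes the local representative, so a map into the sphere can be
  differentiated as an ambient-valued map, without its target chart.\<close>

lemma sphere_local_rep:
  fixes F :: "'a \<Rightarrow> (real^'k) \<times> (real^'k)" and c' :: "((real^'k) \<times> (real^'k), 'f::euclidean_space) chart"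
    and c :: "('a, 'e::euclidean_space) chart"
  assumes M: "smooth_manifold X A" "c \<in> A" and c': "c' \<in> sphere_atlas"
    and F: "continuous_map X (top_of_set (sphere 0 1)) F"
    and sm: "smooth_on (local_dom F c c') (local_rep F c c')"
  shows "smooth_on (local_dom F c c') (\<lambda>x. F (param c x))"
    and "\<And>x. x \<in> local_dom F c c' \<Longrightarrow> local_rep F c c' x \<in> coord_image c'"
    and "\<And>x. x \<in> local_dom F c c' \<Longrightarrow> param c' (local_rep F c c' x) = F (param c x)"
    and "\<And>x v. x \<in> local_dom F c c' \<Longrightarrow>
      FD (\<lambda>x. F (param c x)) x v = FD (param c') (local_rep F c c' x) (local_deriv F c c' x v)"
proof -
  let ?D = "local_dom F c c'"
  note m = manifold_chart[OF M] and s = sphere_atlasD[OF c']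
  have op: "open ?D" by (rule open_local_dom[OF m(3,2,6) F s(1)])
  show mem: "local_rep F c c' x \<in> coord_image c'" if "x \<in> ?D" for x
    using that s(7) by (auto simp: local_dom_eq[OF m(3)] local_rep_def)
  show eq: "param c' (local_rep F c c' x) = F (param c x)" if "x \<in> ?D" for x
    using that s(8) by (auto simp: local_dom_eq[OF m(3)] local_rep_def)
  have comp: "smooth_on ?D (\<lambda>x. param c' (local_rep F c c' x))"
    by (rule smooth_on_compose[OF op s(2) _ sm s(9)]) (rule Pi_I, rule mem)
  show "smooth_on ?D (\<lambda>x. F (param c x))" by (rule smooth_on_cong[OF op eq comp])
  show "FD (\<lambda>x. F (param c x)) x v = FD (param c') (local_rep F c c' x) (local_deriv F c c' x v)"
    if x: "x \<in> ?D" for x v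
  proof -
    have "FD (\<lambda>x. param c' (local_rep F c c' x)) x v = FD (\<lambda>x. F (param c x)) x v"
      by (rule FD_cong_smooth[OF op x eq comp])
    moreover have "((\<lambda>x. param c' (local_rep F c c' x)) has_derivative
        (\<lambda>v. FD (param c') (local_rep F c c' x) (FD (local_rep F c c') x v))) (at x)"
      by (rule has_derivative_compose[OF has_derivative_FD[OF smooth_on_differentiable[OF sm x]]
            has_derivative_FD[OF smooth_on_differentiable[OF s(9) mem[OF x]]]])
    ultimately show ?thesis unfolding local_deriv_def using FD_eq by metis
  qed
qed

lemma sphere_chart_at:
  fixes F :: "'a \<Rightarrow> (real^'k) \<times> (real^'k)"
  assumes M: "smooth_manifold X A" "c \<in> A" and F: "continuous_map X (top_of_set (sphere 0 1)) F"
    and x: "x \<in> coord_image c" and dim: "DIM('f::euclidean_space) + 1 = 2 * CARD('k)"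
  shows "\<exists>c' :: ((real^'k) \<times> (real^'k), 'f) chart. c' \<in> sphere_atlas \<and> x \<in> local_dom F c c'"
proof -
  note m = manifold_chart[OF M]
  have "param c x \<in> topspace X" using param_props(1)[OF m(3) x] m(4) by blast
  then have "norm (F (param c x)) = 1" using F by (auto simp: continuous_map_def)
  from sphere_atlas_covers[OF this dim] show ?thesis using x by (auto simp: local_dom_eq[OF m(3)])
qed

lemma std_sphere_sel [simp]:
  "underlying std_sphere = top_of_set (sphere 0 1)" "atlas std_sphere = sphere_atlas"
  "contact_form std_sphere c x v = ambient_form (param c x) (FD (param c) x v)"
  "metric_tensor std_sphere c x u v = FD (param c) x u \<bullet> FD (param c) x v"
  by (simp_all add: std_sphere_def)

text \<open>This removes the charts of the target: metric and contact form become ambient inner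
  products of derivatives of \<open>f \<circ> param c\<close>. Around each image point any chart of
  the sphere serves, and smoothness is local.\<close>

lemma std_sphere_pullback:
  fixes f :: "'a \<Rightarrow> (real^'k) \<times> (real^'k)" and A :: "('a, 'e::euclidean_space) chart set"
  defines "S \<equiv> std_sphere :: ((real^'k) \<times> (real^'k), 'f::euclidean_space) contact_metric_data"
  assumes M: "smooth_manifold X A" "c \<in> A" and dim: "DIM('f) + 1 = 2 * CARD('k)"
    and f: "smooth_map X A (underlying S) (atlas S) f"
    and g: "pulls_back_metric A (atlas S) f (metric_tensor S) g"
    and \<eta>: "pulls_back_form A (atlas S) f (contact_form S) \<eta>"
  shows "smooth_on (coord_image c) (\<lambda>x. f (param c x))"
    and "\<And>x. x \<in> coord_image c \<Longrightarrow> norm (f (param c x)) = 1"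
    and "\<And>x u v. x \<in> coord_image c \<Longrightarrow>
      g c x u v = FD (\<lambda>x. f (param c x)) x u \<bullet> FD (\<lambda>x. f (param c x)) x v"
    and "\<And>x v. x \<in> coord_image c \<Longrightarrow> \<eta> c x v = cJ (f (param c x)) \<bullet> FD (\<lambda>x. f (param c x)) x v"
proof -
  note m = manifold_chart[OF M]
  have cont: "continuous_map X (top_of_set (sphere 0 1)) f" using f by (simp add: smooth_map_def S_def)
  have sm: "smooth_on (local_dom f c c') (local_rep f c c')"
    if "c' \<in> sphere_atlas" for c' :: "((real^'k) \<times> (real^'k), 'f) chart"
    using f M(2) that by (simp add: smooth_map_def S_def)
  note rep = sphere_local_rep[OF M _ cont sm]
  note chart = sphere_chart_at[OF M cont _ dim]
  have op: "open (local_dom f c c')" if "c' \<in> sphere_atlas" for c' :: "((real^'k) \<times> (real^'k), 'f) chart"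
    by (rule open_local_dom[OF m(3,2,6) cont sphere_atlasD(1)[OF that]])
  show "smooth_on (coord_image c) (\<lambda>x. f (param c x))"
  proof (rule smooth_on_local)
    fix x assume "x \<in> coord_image c"
    then obtain c' :: "((real^'k) \<times> (real^'k), 'f) chart" where "c' \<in> sphere_atlas" "x \<in> local_dom f c c'"
      using chart by blast
    then show "\<exists>T. open T \<and> x \<in> T \<and> smooth_on T (\<lambda>x. f (param c x))" using op rep(1) by blast
  qed
  fix x assume x: "x \<in> coord_image c"
  obtain c' :: "((real^'k) \<times> (real^'k), 'f) chart" where c': "c' \<in> sphere_atlas" "x \<in> local_dom f c c'"
    using chart[OF x] by blast
  show "norm (f (param c x)) = 1"
    using rep(2,3)[OF c'(1) c'(1) c'(2)] sphere_atlasD(5,11)[OF c'(1)] by metis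
  show "g c x u v = FD (\<lambda>x. f (param c x)) x u \<bullet> FD (\<lambda>x. f (param c x)) x v" for u v
    using g M(2) c' by (simp add: pulls_back_metric_def S_def rep(4)[OF c'(1) c'(1) c'(2)])
  show "\<eta> c x v = cJ (f (param c x)) \<bullet> FD (\<lambda>x. f (param c x)) x v" for v
  proof -
    have "\<eta> c x v = cJ (param c' (local_rep f c c' x)) \<bullet>
        FD (param c') (local_rep f c c' x) (local_deriv f c c' x v)"
      using \<eta> M(2) c' by (simp add: pulls_back_form_def S_def ambient_form_eq)
    then show ?thesis by (simp only: rep(3,4)[OF c'(1) c'(1) c'(2)])
  qed
qed

text \<open>\<open>\<phi> u\<close> is minus the part of \<open>J (Dh u)\<close> tangent to the hypersurface, so the compatibility of \<open>\<phi>\<close>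
  with the metric says that \<open>J (Dh u)\<close> has no component normal to the cone; since \<open>\<eta> \<noteq> 0\<close>, neither
  has \<open>J h\<close>.\<close>

lemma contact_metric_complex_patch:
  fixes K :: "('a, 'e::euclidean_space) contact_metric_data" and h :: "'e \<Rightarrow> 'v::euclidean_space \<times> 'v"
  assumes K: "contact_metric_manifold n K" "c \<in> atlas K"
    and h: "smooth_on (coord_image c) h" "\<And>x. x \<in> coord_image c \<Longrightarrow> norm (h x) = 1"
    and g: "\<And>x u v. x \<in> coord_image c \<Longrightarrow> metric_tensor K c x u v = FD h x u \<bullet> FD h x v"
    and \<eta>: "\<And>x v. x \<in> coord_image c \<Longrightarrow> contact_form K c x v = cJ (h x) \<bullet> FD h x v"
  shows "complex_sphere_patch (coord_image c) h cJ"
proof -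
  let ?U = "coord_image c"
  have M: "smooth_manifold (underlying K) (atlas K)"
    using K(1) by (simp add: contact_metric_manifold_def contact_manifold_def)
  have openU: "open ?U" by (rule manifold_chart(2)[OF M K(2)])
  have imm: "inj (FD h x)" if x: "x \<in> ?U" for x
  proof -
    have "linear (FD h x)" by (rule linear_FD[OF smooth_on_differentiable[OF h(1) x]])
    moreover have "v = 0" if "FD h x v = 0" for v
    proof (rule ccontr)
      assume "v \<noteq> 0"
      then have "metric_tensor K c x v v > 0"
        using K x by (simp add: contact_metric_manifold_def riemannian_metric_def)
      then show False using g[OF x] that by simp
    qed
    ultimately show ?thesis using linear_injective_0 by blast
  qed
  interpret sphere_patch ?U h cJ
    by (rule sphere_patch.intro) (rule openU h imm linear_cJ cJ_cJ cJ_skew | assumption)+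
  have d\<eta>: "ext_deriv (contact_form K) c x u v = 2 * (cJ (FD h x u) \<bullet> FD h x v)" if x: "x \<in> ?U" for x u v
  proof -
    have Jh: "smooth_on ?U (\<lambda>y. cJ (h y))" by (rule smooth_on_linear[OF openU bounded_J h(1)])
    have D: "FD (\<lambda>y. contact_form K c y v) x u = cJ (h x) \<bullet> D2 x u v + cJ (FD h x u) \<bullet> FD h x v" for u v
    proof -
      have "FD (\<lambda>y. cJ (h y) \<bullet> FD h y v) x u = FD (\<lambda>y. contact_form K c y v) x u"
        by (rule FD_cong_smooth[OF openU x _ smooth_on_inner[OF openU Jh smooth_Dh]]) (simp add: \<eta>)
      then show ?thesis
        using FD_inner[OF smooth_on_differentiable[OF Jh x] smooth_on_differentiable[OF smooth_Dh x], of v u]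
          FD_linear[OF bounded_J smooth_on_differentiable[OF h(1) x]] by simp
    qed
    have "cJ (FD h x v) \<bullet> FD h x u = - (cJ (FD h x u) \<bullet> FD h x v)"
      using cJ_skew[of "FD h x v" "FD h x u"] by (simp add: inner_commute)
    then show ?thesis unfolding ext_deriv_def D using D2_commute[OF x, of u v] by simp
  qed
  have phi: "phi K c x v = tau x (- cJ (FD h x v))" if x: "x \<in> ?U" for x v
  proof -
    have "(\<forall>u. ext_deriv (contact_form K) c x u v = 2 * metric_tensor K c x u w) \<longleftrightarrow> w = tau x (- cJ (FD h x v))" for w
    proof
      assume "\<forall>u. ext_deriv (contact_form K) c x u v = 2 * metric_tensor K c x u w"
      then have "FD h x w \<bullet> FD h x u = - cJ (FD h x v) \<bullet> FD h x u" for u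
        using d\<eta>[OF x, of u v] g[OF x, of u w] cJ_skew[of "FD h x u" "FD h x v"] by (simp add: inner_commute)
      then show "w = tau x (- cJ (FD h x v))" using tau_unique[OF x] by metis
    next
      assume w: "w = tau x (- cJ (FD h x v))"
      have "ext_deriv (contact_form K) c x u v = 2 * metric_tensor K c x u w" for u
        using tau_inner[OF x, of "- cJ (FD h x v)" u] d\<eta>[OF x, of u v] g[OF x, of u w]
          cJ_skew[of "FD h x u" "FD h x v"] by (simp add: inner_commute w)
      then show "\<forall>u. ext_deriv (contact_form K) c x u v = 2 * metric_tensor K c x u w" ..
    qed
    then show ?thesis by (simp add: phi_def)
  qed
  \<comment> \<open>Here \<open>w\<close> has the length of \<open>FD h x u\<close>; compatibility
    of \<open>phi\<close> with the metric says that \<open>P x w\<close> has this length too, and an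
    orthogonal projection that preserves the length of a vector fixes it.\<close>
  have PJ: "P x (cJ (FD h x u)) = cJ (FD h x u)" if x: "x \<in> ?U" for x u
  proof -
    define w where "w = - cJ (FD h x u)"
    have "FD h x (tau x w) \<bullet> FD h x (tau x w) = FD h x u \<bullet> FD h x u - (h x \<bullet> w) * (h x \<bullet> w)"
    proof -
      have "metric_tensor K c x (phi K c x u) (phi K c x u) =
          metric_tensor K c x u u - contact_form K c x u * contact_form K c x u"
        using K x by (simp add: contact_metric_manifold_def)
      moreover have "contact_form K c x u = h x \<bullet> w" by (simp add: \<eta>[OF x] w_def cJ_skew)
      ultimately show ?thesis by (simp add: g[OF x] phi[OF x] w_def)
    qed
    moreover have "P x w \<bullet> P x w = (h x \<bullet> w) * (h x \<bullet> w) + FD h x (tau x w) \<bullet> FD h x (tau x w)"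
      using h_Dh[OF x] by (simp add: P_def inner_add_left inner_add_right inner_h_h[OF x] inner_commute)
    moreover have "w \<bullet> w = FD h x u \<bullet> FD h x u" by (simp add: w_def cJ_skew cJ_cJ)
    ultimately have "P x w \<bullet> w = w \<bullet> w" "P x w \<bullet> P x w = w \<bullet> w"
      using P_sym[OF x, of w w] P_sym[OF x, of "P x w" w] P_P[OF x] by (simp_all add: inner_commute)
    then have "(P x w - w) \<bullet> (P x w - w) = 0"
      by (simp add: inner_diff_left inner_diff_right inner_commute)
    then have "P x w = w" by simp
    then show ?thesis using linear_neg[OF linear_P[OF x], of "cJ (FD h x u)"] by (simp add: w_def)
  qed
  \<comment> \<open>Nonvanishing of the contact volume provides a \<open>v\<close> with nonzero
    contact form. Then \<open>cJ (FD h x v)\<close> has radial component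
    \<open>r \<noteq> 0\<close>, and applying \<open>cJ\<close> to its decomposition gives an
    equation that can be solved for \<open>cJ (h x)\<close>.\<close>
  have "P x (cJ (h x)) = cJ (h x)" if x: "x \<in> ?U" for x
  proof -
    obtain v where v: "contact_form K c x v \<noteq> 0"
    proof (rule ccontr)
      assume "\<not> thesis"
      then have "contact_form K c x v = 0" for v using that by blast
      then have "contact_volume n (contact_form K) c x v = 0" for v by (simp add: contact_volume_def)
      moreover have "\<exists>v. contact_volume n (contact_form K) c x v \<noteq> 0"
        using K x by (simp add: contact_metric_manifold_def contact_manifold_def)
      ultimately show False by blast
    qed
    define r where "r = h x \<bullet> cJ (FD h x v)"
    have r: "r \<noteq> 0" using v by (simp add: r_def \<eta>[OF x] cJ_skew)
    define z where "z = tau x (cJ (FD h x v))"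
    have "cJ (FD h x v) = r *\<^sub>R h x + FD h x z" using PJ[OF x, of v] by (simp add: P_def r_def z_def)
    from arg_cong[OF this, of cJ] have "- FD h x v = r *\<^sub>R cJ (h x) + cJ (FD h x z)"
      by (simp add: cJ_cJ linear_add[OF linear_cJ] linear_scale[OF linear_cJ])
    then have "r *\<^sub>R cJ (h x) = - FD h x v - cJ (FD h x z)" by (simp add: algebra_simps)
    from arg_cong[OF this, of "\<lambda>w. w /\<^sub>R r"]
    have Jh: "cJ (h x) = (- FD h x v - cJ (FD h x z)) /\<^sub>R r" using r by simp
    show ?thesis
      unfolding Jh by (simp add: linear_scale[OF linear_P[OF x]] linear_diff[OF linear_P[OF x]]
          linear_neg[OF linear_P[OF x]] P_Dh[OF x] PJ[OF x])
  qed
  then show ?thesis using PJ by unfold_locales auto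
qed

section \<open>The tangent cone as one fixed subspace\<close>

context sphere_patch
begin

lemma range_P: "x \<in> U \<Longrightarrow> range (P x) = span (insert (h x) (range (FD h x)))"
proof
  assume x: "x \<in> U"
  show "range (P x) \<subseteq> span (insert (h x) (range (FD h x)))"
  proof (rule image_subsetI)
    show "P x w \<in> span (insert (h x) (range (FD h x)))" for w
      unfolding P_def by (intro span_add span_scale span_base) auto
  qed
  show "span (insert (h x) (range (FD h x))) \<subseteq> range (P x)"
  proof (rule span_minimal)
    show "insert (h x) (range (FD h x)) \<subseteq> range (P x)"
      using P_h[OF x] P_Dh[OF x] by (metis (no_types, lifting) image_subset_iff insert_subset rangeI)
    show "subspace (range (P x))" by (rule linear_subspace_image[OF linear_P[OF x] subspace_UNIV])
  qed
qed

lemma dim_range_P: "x \<in> U \<Longrightarrow> dim (range (P x)) = DIM('e) + 1"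
proof -
  assume x: "x \<in> U"
  have "dim (range (FD h x)) = DIM('e)"
    using dim_image_eq[OF linear_Dh[OF x], of UNIV] immersed[OF x] by simp
  moreover have "h x \<notin> span (range (FD h x))"
  proof
    assume "h x \<in> span (range (FD h x))"
    moreover have "span (range (FD h x)) = range (FD h x)"
      using linear_subspace_image[OF linear_Dh[OF x] subspace_UNIV] span_eq_iff by blast
    ultimately have "h x \<in> range (FD h x)" by simp
    then show False using h_Dh[OF x] inner_h_h[OF x] by auto
  qed
  ultimately show ?thesis by (simp add: range_P[OF x] dim_insert)
qed

lemma P_locally_constant:
  assumes "ball x r \<subseteq> U" "\<And>y u w. y \<in> U \<Longrightarrow> Q y u w = 0" "y \<in> ball x r"
  shows "P y w = P x w"
proof -
  have "((\<lambda>y. P y w) has_derivative (\<lambda>u. 0)) (at z within ball x r)" if "z \<in> ball x r" for z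
  proof -
    have z: "z \<in> U" using that assms(1) by blast
    have "FD (\<lambda>y. P y w) z = (\<lambda>u. 0)" using assms(2)[OF z] by blast
    then have "((\<lambda>y. P y w) has_derivative (\<lambda>u. 0)) (at z)"
      using has_derivative_FD[OF smooth_on_differentiable[OF smooth_P z], of w] by simp
    then show ?thesis by (rule has_derivative_at_withinI)
  qed
  from has_derivative_zero_constant[OF convex_ball this] obtain k where k: "\<And>y. y \<in> ball x r \<Longrightarrow> P y w = k"
    by blast
  have "x \<in> ball x r" using assms(3) by (auto intro: le_less_trans[OF zero_le_dist])
  then show ?thesis using k[OF assms(3)] k[of x] by simp
qed

end

text \<open>Chain rule with the transition map; the opposite inclusion follows by exchanging the
  charts.\<close>

lemma tangent_space_chart_independent:
  fixes f :: "'a \<Rightarrow> 'b::euclidean_space" and A :: "('a, 'e::euclidean_space) chart set"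
  assumes M: "smooth_manifold X A" and c: "c1 \<in> A" "c2 \<in> A" and p: "p \<in> fst c1" "p \<in> fst c2"
    and f: "smooth_on (coord_image c2) (\<lambda>x. f (param c2 x))"
  shows "range (FD (\<lambda>x. f (param c1 x)) (snd c1 p)) \<subseteq> range (FD (\<lambda>x. f (param c2 x)) (snd c2 p))"
proof -
  note m1 = manifold_chart[OF M c(1)] and m2 = manifold_chart[OF M c(2)]
  let ?t = "local_rep id c1 c2" and ?D = "local_dom id c1 c2"
  have op: "open ?D" by (rule open_local_dom[OF m1(3,2,6) continuous_map_id m2(1)])
  have sm: "smooth_on ?D ?t" using M c by (simp add: smooth_manifold_def)
  have D: "?D = {x \<in> coord_image c1. param c1 x \<in> fst c2}" by (simp add: local_dom_eq[OF m1(3)])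
  have t: "?t y \<in> coord_image c2" "f (param c2 (?t y)) = f (param c1 y)" if "y \<in> ?D" for y
    using that param_props(3,4)[OF m2(3)] by (auto simp: D local_rep_def)
  let ?x = "snd c1 p"
  have x: "?x \<in> ?D" using p param_props(3,4)[OF m1(3)] by (simp add: D)
  have tx: "?t ?x = snd c2 p" using param_props(4)[OF m1(3) p(1)] by (simp add: local_rep_def)
  have "((\<lambda>y. f (param c2 (?t y))) has_derivative
      (\<lambda>v. FD (\<lambda>x. f (param c2 x)) (?t ?x) (FD ?t ?x v))) (at ?x)"
    by (rule has_derivative_compose[OF has_derivative_FD[OF smooth_on_differentiable[OF sm x]]
          has_derivative_FD[OF smooth_on_differentiable[OF f t(1)[OF x]]]])
  from has_derivative_transform_within_open[OF this op x t(2)]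
  have "FD (\<lambda>y. f (param c1 y)) ?x = (\<lambda>v. FD (\<lambda>x. f (param c2 x)) (snd c2 p) (FD ?t ?x v))"
    unfolding tx by (rule FD_eq)
  then show ?thesis by auto
qed

text \<open>\<open>P\<close> is computed in a chart, yet its range is spanned by the position vector
  and the tangent space of the image, so it depends on the point alone. Vanishing of
  \<open>Q\<close> makes it locally constant, and connectedness makes it constant. Dimension and
  invariance under \<open>J\<close> are read off at one point.\<close>

lemma constant_tangent_cone:
  fixes f :: "'a \<Rightarrow> 'b::euclidean_space" and A :: "('a, 'e::euclidean_space) chart set"
  assumes M: "smooth_manifold X A" and X: "connected_space X" "topspace X \<noteq> {}"
    and patch: "\<And>c. c \<in> A \<Longrightarrow> complex_sphere_patch (coord_image c) (\<lambda>x. f (param c x)) J"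
    and flat: "\<And>c x u w. c \<in> A \<Longrightarrow> x \<in> coord_image c \<Longrightarrow>
      FD (\<lambda>y. sphere_patch.P (\<lambda>x. f (param c x)) y w) x u = 0"
  obtains C where "subspace C" "J ` C \<subseteq> C" "dim C = DIM('e) + 1"
    "\<And>c x. c \<in> A \<Longrightarrow> x \<in> coord_image c \<Longrightarrow> f (param c x) \<in> C"
    "\<And>c x v. c \<in> A \<Longrightarrow> x \<in> coord_image c \<Longrightarrow> FD (\<lambda>x. f (param c x)) x v \<in> C"
proof -
  let ?h = "\<lambda>c x. f (param c x)"
  define TC where "TC c p = span (insert (f p) (range (FD (?h c) (snd c p))))" for c :: "('a, 'e) chart" and p
  have sp: "sphere_patch (coord_image c) (?h c) J" if "c \<in> A" for c
    using patch[OF that] by (simp add: complex_sphere_patch_def)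
  note m = manifold_chart[OF M]
  have TC_P: "range (sphere_patch.P (?h c) (snd c p)) = TC c p" if "c \<in> A" "p \<in> fst c" for c p
    using sphere_patch.range_P[OF sp[OF that(1)] param_props(3)[OF m(3)[OF that(1)] that(2)]]
      param_props(4)[OF m(3)[OF that(1)] that(2)] by (simp add: TC_def)
  have le: "TC c1 p \<subseteq> TC c2 p" if "c1 \<in> A" "c2 \<in> A" "p \<in> fst c1" "p \<in> fst c2" for c1 c2 p
  proof -
    have "smooth_on (coord_image c2) (?h c2)"
      using sp[OF that(2)] by (simp add: sphere_patch_def)
    from tangent_space_chart_independent[OF M that this] show ?thesis
      unfolding TC_def by (intro span_mono) auto
  qed
  have indep: "TC c1 p = TC c2 p" if "c1 \<in> A" "c2 \<in> A" "p \<in> fst c1" "p \<in> fst c2" for c1 c2 p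
    using le that by blast
  have loc: "\<exists>T. openin X T \<and> p \<in> T \<and> T \<subseteq> fst c \<and> (\<forall>q\<in>T. TC c q = TC c p)"
    if c: "c \<in> A" "p \<in> fst c" for c p
  proof -
    have x: "snd c p \<in> coord_image c" by (rule param_props(3)[OF m(3)[OF c(1)] c(2)])
    obtain r where r: "r > 0" "ball (snd c p) r \<subseteq> coord_image c" using openE[OF m(2)[OF c(1)] x] by metis
    have "TC c q = TC c p" if q: "q \<in> fst c" "snd c q \<in> ball (snd c p) r" for q
    proof -
      have "sphere_patch.P (?h c) (snd c q) = sphere_patch.P (?h c) (snd c p)"
        by (rule ext) (rule sphere_patch.P_locally_constant[OF sp[OF c(1)] r(2) flat[OF c(1)] q(2)])
      then show ?thesis using TC_P[OF c(1) q(1)] TC_P[OF c] by simp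
    qed
    moreover define T where "T = {q \<in> fst c. snd c q \<in> ball (snd c p) r}"
    ultimately have "\<forall>q\<in>T. TC c q = TC c p" by blast
    moreover have "openin X T" unfolding T_def by (rule chart_open_image[OF M c(1) open_ball])
    moreover have "p \<in> T" "T \<subseteq> fst c" using c(2) r(1) by (auto simp: T_def)
    ultimately show ?thesis by blast
  qed
  have cover: "\<exists>c\<in>A. p \<in> fst c" if "p \<in> topspace X" for p
    using M that by (auto simp: smooth_manifold_def)
  obtain p0 where p0: "p0 \<in> topspace X" using X(2) by blast
  obtain c0 where c0: "c0 \<in> A" "p0 \<in> fst c0" using cover[OF p0] by blast
  define C where "C = TC c0 p0"
  define S1 where "S1 = {p. \<exists>c\<in>A. p \<in> fst c \<and> TC c p = C}"
  define S2 where "S2 = {p. \<exists>c\<in>A. p \<in> fst c \<and> TC c p \<noteq> C}"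
  \<comment> \<open>An arbitrary predicate \<open>R\<close> gives openness of \<open>S1\<close> and
    \<open>S2\<close> at once; they are disjoint by \<open>indep\<close>.\<close>
  have op: "openin X {p. \<exists>c\<in>A. p \<in> fst c \<and> R (TC c p)}" for R
  proof (subst openin_subopen, intro ballI)
    fix p assume "p \<in> {p. \<exists>c\<in>A. p \<in> fst c \<and> R (TC c p)}"
    then obtain c where c: "c \<in> A" "p \<in> fst c" "R (TC c p)" by blast
    obtain T where T: "openin X T" "p \<in> T" "T \<subseteq> fst c" "\<forall>q\<in>T. TC c q = TC c p"
      using loc[OF c(1,2)] by blast
    have "R (TC c q)" if "q \<in> T" for q using bspec[OF T(4) that] c(3) by (simp only:)
    then have "T \<subseteq> {p. \<exists>c\<in>A. p \<in> fst c \<and> R (TC c p)}" using T(3) c(1) by blast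
    then show "\<exists>T. openin X T \<and> p \<in> T \<and> T \<subseteq> {p. \<exists>c\<in>A. p \<in> fst c \<and> R (TC c p)}"
      using T(1,2) by blast
  qed
  have "openin X S1" "openin X S2" unfolding S1_def S2_def by (rule op)+
  moreover have "S1 \<inter> S2 = {}" unfolding S1_def S2_def using indep by blast
  moreover have "topspace X \<subseteq> S1 \<union> S2" unfolding S1_def S2_def using cover by blast
  moreover have "S1 \<noteq> {}" unfolding S1_def C_def using c0 by blast
  ultimately have S2: "S2 = {}" using X(1) unfolding connected_space_def by blast
  have TC: "TC c p = C" if "c \<in> A" "p \<in> fst c" for c p using S2 that unfolding S2_def by blast
  have x0: "snd c0 p0 \<in> coord_image c0" by (rule param_props(3)[OF m(3)[OF c0(1)] c0(2)])
  show thesis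
  proof
    show "subspace C" by (simp add: C_def TC_def)
    show "dim C = DIM('e) + 1"
      using sphere_patch.dim_range_P[OF sp[OF c0(1)] x0] TC_P[OF c0] by (simp add: C_def)
    show "J ` C \<subseteq> C"
    proof safe
      fix w assume "w \<in> C"
      then obtain z where "w = sphere_patch.P (?h c0) (snd c0 p0) z" using TC_P[OF c0] unfolding C_def by blast
      then have "J w = sphere_patch.P (?h c0) (snd c0 p0) (J z)"
        using complex_sphere_patch.P_J[OF patch[OF c0(1)] x0] by simp
      then show "J w \<in> C" using TC_P[OF c0] unfolding C_def by blast
    qed
    fix c x assume c: "c \<in> A" "x \<in> coord_image c"
    have p: "param c x \<in> fst c" "snd c (param c x) = x" using param_props(1,2)[OF m(3)[OF c(1)] c(2)] .
    have "insert (?h c x) (range (FD (?h c) x)) \<subseteq> C"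
      using TC[OF c(1) p(1)] span_superset[of "insert (?h c x) (range (FD (?h c) x))"] p(2) by (simp add: TC_def)
    then show "?h c x \<in> C" "FD (?h c) x v \<in> C" for v by auto
  qed
qed

text \<open>Equal dimensions make the immersion \<open>F\<close> an open map, so it is a local
  homeomorphism from a compact connected space to a simply connected sphere and hence a bijection.
  Smoothness of the inverse comes from \<open>smooth_on_factor\<close>, with
  \<open>F \<circ> param c\<close> as the immersion.\<close>

lemma sphere_diffeomorphism:
  fixes F :: "'a \<Rightarrow> (real^'m) \<times> (real^'m)" and A :: "('a, 'e::euclidean_space) chart set"
  assumes M: "smooth_manifold X A" and X: "connected_space X" "compact_space X" "topspace X \<noteq> {}"
    and dim: "DIM('e) + 1 = 2 * CARD('m)" "CARD('m) \<ge> 2"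
    and F: "continuous_map X (top_of_set (sphere 0 1)) F"
    and H: "\<And>c. c \<in> A \<Longrightarrow> smooth_on (coord_image c) (\<lambda>x. F (param c x))"
    and imm: "\<And>c x. c \<in> A \<Longrightarrow> x \<in> coord_image c \<Longrightarrow> inj (FD (\<lambda>x. F (param c x)) x)"
  shows "diffeomorphism X A (top_of_set (sphere 0 1))
    (sphere_atlas :: ((real^'m) \<times> (real^'m), 'e) chart set) F"
proof -
  let ?S = "top_of_set (sphere (0 :: (real^'m) \<times> (real^'m)) 1)"
  note m = manifold_chart[OF M]
  have haus: "Hausdorff_space X" using M by (simp add: smooth_manifold_def)
  have cover: "\<exists>c\<in>A. p \<in> fst c" if "p \<in> topspace X" for p
    using M that by (auto simp: smooth_manifold_def)
  have dim': "DIM('e) + 1 = DIM((real^'m) \<times> (real^'m))" using dim(1) by simp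
  have H1: "norm (F (param c x)) = 1" if "c \<in> A" "x \<in> coord_image c" for c x
  proof -
    have "param c x \<in> topspace X" using param_props(1)[OF m(3)[OF that(1)] that(2)] m(4)[OF that(1)] by blast
    then show ?thesis using F by (auto simp: continuous_map_def)
  qed
  have chart_inv: "q = param c (snd c q)" if "c \<in> A" "q \<in> fst c" for c q
    using param_props(4)[OF m(3)[OF that(1)] that(2)] by simp
  have open_F: "open_map X ?S F"
    unfolding open_map_def
  proof (intro allI impI)
    fix V assume V: "openin X V"
    have "\<exists>T. openin ?S T \<and> q \<in> T \<and> T \<subseteq> F ` V" if "q \<in> F ` V" for q
    proof -
      obtain p where p: "p \<in> V" "q = F p" using \<open>q \<in> F ` V\<close> by blast
      then obtain c where c: "c \<in> A" "p \<in> fst c" using cover openin_subset[OF V] by blast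
      define W where "W = {x \<in> topspace (top_of_set (coord_image c)). param c x \<in> V}"
      have "openin (top_of_set (coord_image c)) W"
        unfolding W_def by (rule openin_continuous_map_preimage[OF m(6)[OF c(1)] V])
      then have W: "open W" "W \<subseteq> coord_image c" using m(2)[OF c(1)] by (auto simp: openin_open_eq)
      have "openin ?S ((\<lambda>x. F (param c x)) ` W)"
        by (rule immersion_open_in_sphere[OF W(1) smooth_on_subset[OF H[OF c(1)] W(2)] _ _ dim'])
          (use W(2) H1[OF c(1)] imm[OF c(1)] in auto)
      moreover have "(\<lambda>x. F (param c x)) ` W \<subseteq> F ` V" by (auto simp: W_def)
      moreover have "snd c p \<in> W"
        using p(1) param_props(3)[OF m(3)[OF c(1)] c(2)] chart_inv[OF c] by (simp add: W_def)
      then have "q \<in> (\<lambda>x. F (param c x)) ` W" using chart_inv[OF c] p(2) by (metis imageI)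
      ultimately show ?thesis by blast
    qed
    then show "openin ?S (F ` V)" by (subst openin_subopen) blast
  qed
  have inj_F: "\<exists>V. openin X V \<and> p \<in> V \<and> inj_on F V" if "p \<in> topspace X" for p
  proof -
    obtain c where c: "c \<in> A" "p \<in> fst c" using cover[OF \<open>p \<in> topspace X\<close>] by blast
    have x: "snd c p \<in> coord_image c" by (rule param_props(3)[OF m(3)[OF c(1)] c(2)])
    obtain r where r: "r > 0" "inj_on (\<lambda>x. F (param c x)) (ball (snd c p) r)"
      using immersion_locally_injective[OF m(2)[OF c(1)] x H[OF c(1)] imm[OF c(1) x]] by metis
    define V where "V = {q \<in> fst c. snd c q \<in> ball (snd c p) r}"
    have "openin X V" unfolding V_def by (rule chart_open_image[OF M c(1) open_ball])
    moreover have "inj_on F V"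
    proof (rule inj_onI)
      fix q q' assume q: "q \<in> V" "q' \<in> V" "F q = F q'"
      then have "snd c q = snd c q'"
        using inj_onD[OF r(2), of "snd c q" "snd c q'"] param_props(4)[OF m(3)[OF c(1)]] by (simp add: V_def)
      then show "q = q'" using q m(3)[OF c(1)] by (auto simp: V_def inj_on_def)
    qed
    moreover have "p \<in> V" using c(2) r(1) by (simp add: V_def)
    ultimately show ?thesis by blast
  qed
  \<comment> \<open>Unit spheres are simply connected once the ambient dimension is at least 3; this
    excludes the circle, which has nontrivial connected coverings.\<close>
  have "3 \<le> DIM((real^'m) \<times> (real^'m))" using dim(2) by simp
  then have bij: "bij_betw F (topspace X) (sphere 0 1)"
    by (intro local_homeomorphism_onto_simply_connected[OF X(2) haus X(1,3) F open_F inj_F]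
        simply_connected_sphere locally_path_connected_sphere)
  let ?G = "inv_into (topspace X) F"
  have G: "continuous_map ?S X ?G"
  proof -
    have "homeomorphic_map X ?S F"
      using bij by (intro continuous_imp_homeomorphic_map[OF F X(2)])
        (auto simp: bij_betw_def Hausdorff_space_subtopology)
    then obtain g where g: "homeomorphic_maps X ?S F g" using homeomorphic_map_maps by blast
    have "g q = ?G q" if "q \<in> topspace ?S" for q
    proof -
      have gq: "g q \<in> topspace X" "F (g q) = q"
        using g that unfolding homeomorphic_maps_def by (auto simp: continuous_map_def)
      have "?G (F (g q)) = g q" by (rule inv_into_f_f[OF bij_betw_imp_inj_on[OF bij] gq(1)])
      then show ?thesis using gq(2) by simp
    qed
    then show ?thesis using g continuous_map_eq[of ?S X g ?G] by (simp add: homeomorphic_maps_def)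
  qed
  have FG: "F (?G q) = q" if "norm q = 1" for q
    using bij that by (intro f_inv_into_f) (auto simp: bij_betw_def)
  have "smooth_on (local_dom F c c') (local_rep F c c')"
    if c: "c \<in> A" and c': "c' \<in> sphere_atlas" for c and c' :: "((real^'m) \<times> (real^'m), 'e) chart"
  proof -
    have D: "local_dom F c c' = {x \<in> coord_image c. F (param c x) \<in> fst c'}" by (rule local_dom_eq[OF m(3)[OF c]])
    have "open (local_dom F c c')" by (rule open_local_dom[OF m(3,2,6)[OF c] F sphere_atlasD(1)[OF c']])
    then show ?thesis unfolding local_rep_def
      by (rule smooth_on_sphere_chart[OF c' _ smooth_on_subset[OF H[OF c]]]) (auto simp: D)
  qed
  moreover have "smooth_on (local_dom ?G c' c) (local_rep ?G c' c)"
    if c: "c \<in> A" and c': "c' \<in> sphere_atlas" for c and c' :: "((real^'m) \<times> (real^'m), 'e) chart"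
  proof -
    note s = sphere_atlasD[OF c'] and s' = sphere_chart[OF c']
    let ?D = "local_dom ?G c' c"
    have D: "?D = {x \<in> coord_image c'. ?G (param c' x) \<in> fst c}" by (rule local_dom_eq[OF s'(1)])
    have op: "open ?D" by (rule open_local_dom[OF s'(1) s(2) s'(2) G m(1)[OF c]])
    \<comment> \<open>In coordinates the inverse solves the equation that
      \<open>smooth_on_factor\<close> expects, with the smooth map \<open>param c'\<close> on the
      other side.\<close>
    have H_rep: "param c' x = F (param c (local_rep ?G c' c x))" if "x \<in> ?D" for x
      using that chart_inv[OF c] FG s(5,11) unfolding D local_rep_def by (metis (no_types, lifting) mem_Collect_eq)
    show ?thesis
    proof (rule smooth_on_factor[OF op m(2)[OF c] H[OF c] imm[OF c]])
      show "local_rep ?G c' c \<in> ?D \<rightarrow> coord_image c"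
        using param_props(3)[OF m(3)[OF c]] by (auto simp: D local_rep_def)
      have sm: "smooth_on ?D (param c')" by (rule smooth_on_subset[OF s(9)]) (auto simp: D)
      show "smooth_on ?D (\<lambda>x. F (param c (local_rep ?G c' c x)))"
        by (rule smooth_on_cong[OF op _ sm]) (rule H_rep)
      have "continuous_map (top_of_set ?D) X (?G \<circ> param c')"
        by (rule continuous_map_compose[OF continuous_map_from_subtopology_mono[OF s'(2)] G]) (auto simp: D)
      then have "continuous_map (top_of_set ?D) (subtopology X (fst c)) (?G \<circ> param c')"
        by (auto simp: continuous_map_in_subtopology D)
      from continuous_map_compose[OF this m(5)[OF c]]
      show "continuous_on ?D (local_rep ?G c' c)"
        by (simp add: local_rep_def o_def continuous_map_in_subtopology)
    qed
  qed
  ultimately show ?thesis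
    using bij F G unfolding diffeomorphism_def smooth_map_def by simp
qed

text \<open>The model sphere takes its charts in the same \<open>'e\<close> as \<open>K\<close>,
  whose dimension 2 n + 1 is part of \<open>K_contact_manifold\<close>; the index types
  \<open>'k\<close> and \<open>'m\<close> count complex coordinates.\<close>

theorem corollary2:
  fixes n N :: nat
    and K :: "('a, 'e::euclidean_space) contact_metric_data"
    and f :: "'a \<Rightarrow> (real^'k) \<times> (real^'k)"
  assumes "n \<ge> 1"
    and "K_contact_manifold n K"
    and "compact_space (underlying K)"
    and "einstein_metric (atlas K) (metric_tensor K)"
    and "CARD('k) = N + 1" and "DIM('f) = 2 * N + 1"
    and "contact_metric_immersion K
           (std_sphere :: ((real^'k) \<times> (real^'k), 'f::euclidean_space) contact_metric_data) f"
    and "CARD('m) = n + 1"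
  shows "sasaki_equivalent K
           (std_sphere :: ((real^'m) \<times> (real^'m), 'e) contact_metric_data)"
proof -
  let ?X = "underlying K" and ?A = "atlas K"
  let ?h = "\<lambda>c x. f (param c x)"
  have cm: "contact_metric_manifold n K" using assms(2) by (simp add: K_contact_manifold_def)
  then have M: "smooth_manifold ?X ?A" and dimK: "DIM('e) = 2 * n + 1"
    and X: "connected_space ?X" "topspace ?X \<noteq> {}"
    by (simp_all add: contact_metric_manifold_def contact_manifold_def)
  note m = manifold_chart[OF M]
  let ?T = "std_sphere :: ((real^'k) \<times> (real^'k), 'f) contact_metric_data"
  have f: "smooth_map ?X ?A (underlying ?T) (atlas ?T) f"
    "pulls_back_metric ?A (atlas ?T) f (metric_tensor ?T) (metric_tensor K)"
    "pulls_back_form ?A (atlas ?T) f (contact_form ?T) (contact_form K)"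
    using assms(7) by (simp_all add: contact_metric_immersion_def immersion_def)
  have "DIM('f) + 1 = 2 * CARD('k)" using assms(5,6) by simp
  note h = std_sphere_pullback[OF M _ this f]
  have patch: "complex_sphere_patch (coord_image c) (?h c) cJ" if "c \<in> ?A" for c
    by (rule contact_metric_complex_patch[OF cm that h[OF that]])
  obtain l where l: "\<And>c x v w. c \<in> ?A \<Longrightarrow> x \<in> coord_image c \<Longrightarrow>
      ricci (metric_tensor K) c x v w = l * metric_tensor K c x v w"
    using assms(4) unfolding einstein_metric_def by blast
  have flat: "FD (\<lambda>y. sphere_patch.P (?h c) y w) x u = 0" if "c \<in> ?A" "x \<in> coord_image c" for c x u w
    by (rule complex_sphere_patch.einstein_Q_eq_0[OF patch[OF that(1)] h(3)[OF that(1)] that(2) l[OF that]])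
  obtain C where C: "subspace C" "cJ ` C \<subseteq> C" "dim C = DIM('e) + 1"
    "\<And>c x. c \<in> ?A \<Longrightarrow> x \<in> coord_image c \<Longrightarrow> ?h c x \<in> C"
    "\<And>c x v. c \<in> ?A \<Longrightarrow> x \<in> coord_image c \<Longrightarrow> FD (?h c) x v \<in> C"
    using constant_tangent_cone[OF M X patch flat] by metis
  have dC: "dim C = 2 * CARD('m)" using C(3) dimK assms(8) by simp
  obtain L :: "(real^'k) \<times> (real^'k) \<Rightarrow> (real^'m) \<times> (real^'m)" where
    L: "linear L" "\<And>w. L (cJ w) = cJ (L w)" "\<And>w z. w \<in> C \<Longrightarrow> z \<in> C \<Longrightarrow> L w \<bullet> L z = w \<bullet> z"
    using unitary_coordinates[OF linear_cJ cJ_cJ cJ_skew C(1,2) dC] by metis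
  have bL: "bounded_linear L" using L(1) linear_conv_bounded_linear by blast
  \<comment> \<open>\<open>L\<close> is known to preserve inner products on \<open>C\<close> only,
    which is why position vectors and derivatives of the chart maps have to lie in
    \<open>C\<close>.\<close>
  define F where "F = (\<lambda>p. L (f p))"
  let ?H = "\<lambda>c x. F (param c x)"
  have H: "smooth_on (coord_image c) (?H c)" if "c \<in> ?A" for c
    unfolding F_def by (rule smooth_on_linear[OF m(2)[OF that] bL h(1)[OF that]])
  have DH: "FD (?H c) x v = L (FD (?h c) x v)" if "c \<in> ?A" "x \<in> coord_image c" for c x v
    unfolding F_def by (rule FD_linear[OF bL smooth_on_differentiable[OF h(1)[OF that(1)] that(2)]])
  have metric: "metric_tensor K c x u v = FD (?H c) x u \<bullet> FD (?H c) x v"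
    if "c \<in> ?A" "x \<in> coord_image c" for c x u v
    using h(3)[OF that] L(3)[OF C(5)[OF that] C(5)[OF that]] by (simp add: DH[OF that])
  have form: "contact_form K c x v = ambient_form (?H c x) (FD (?H c) x v)"
    if "c \<in> ?A" "x \<in> coord_image c" for c x v
  proof -
    \<comment> \<open>The contact form pairs \<open>cJ (?h c x)\<close> with a tangent vector;
      invariance of \<open>C\<close> puts both where \<open>L\<close> is isometric.\<close>
    have "cJ (?h c x) \<in> C" using C(2) C(4)[OF that] by blast
    then have "contact_form K c x v = L (cJ (?h c x)) \<bullet> L (FD (?h c) x v)"
      using h(4)[OF that] L(3)[OF _ C(5)[OF that]] by simp
    then show ?thesis unfolding DH[OF that] ambient_form_eq by (simp add: F_def L(2))
  qed
  have normF: "norm (F p) = 1" if p: "p \<in> topspace ?X" for p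
  proof -
    have "p \<in> (\<Union>c\<in>?A. fst c)" using M p by (simp add: smooth_manifold_def)
    then obtain c where c: "c \<in> ?A" "p \<in> fst c" by blast
    have x: "snd c p \<in> coord_image c" "param c (snd c p) = p"
      using param_props(3,4)[OF m(3)[OF c(1)] c(2)] .
    then have "f p \<in> C" "norm (f p) = 1" using C(4)[OF c(1) x(1)] h(2)[OF c(1) x(1)] by simp_all
    then show ?thesis using L(3)[of "f p" "f p"] by (simp add: F_def norm_eq_1)
  qed
  have contF: "continuous_map ?X (top_of_set (sphere 0 1)) F"
  proof -
    have "continuous_map ?X euclidean f" using f(1) by (simp add: smooth_map_def continuous_map_in_subtopology)
    moreover have "continuous_map euclidean euclidean L"
      using bL by (simp add: continuous_map_iff_continuous2 linear_continuous_on)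
    ultimately have "continuous_map ?X euclidean (L \<circ> f)" by (rule continuous_map_compose)
    then show ?thesis using normF by (auto simp: continuous_map_in_subtopology F_def o_def)
  qed
  have imm: "inj (FD (?H c) x)" if "c \<in> ?A" "x \<in> coord_image c" for c x
  proof -
    have "linear (FD (?H c) x)" by (rule linear_FD[OF smooth_on_differentiable[OF H[OF that(1)] that(2)]])
    moreover have "v = 0" if "FD (?H c) x v = 0" for v
    proof (rule ccontr)
      assume "v \<noteq> 0"
      then have "metric_tensor K c x v v > 0"
        using cm \<open>c \<in> ?A\<close> \<open>x \<in> coord_image c\<close> by (simp add: contact_metric_manifold_def riemannian_metric_def)
      then show False using metric[OF \<open>c \<in> ?A\<close> \<open>x \<in> coord_image c\<close>, of v v] that by simp
    qed
    ultimately show ?thesis using linear_injective_0 by blast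
  qed
  let ?S = "std_sphere :: ((real^'m) \<times> (real^'m), 'e) contact_metric_data"
  \<comment> \<open>The hypothesis \<open>n \<ge> 1\<close> is used here: it gives at least two
    complex coordinates, as simple connectivity of the sphere requires.\<close>
  have "DIM('e) + 1 = 2 * CARD('m)" "CARD('m) \<ge> 2" using dimK assms(1,8) by auto
  from sphere_diffeomorphism[OF M X(1) assms(3) X(2) this contF H imm]
  have diffeo: "diffeomorphism ?X ?A (top_of_set (sphere 0 1)) (sphere_atlas :: ((real^'m) \<times> (real^'m), 'e) chart set) F" .
  have rep: "param c' (local_rep F c c' x) = ?H c x" "x \<in> coord_image c"
    "FD (param c') (local_rep F c c' x) (local_deriv F c c' x v) = FD (?H c) x v"
    if "c \<in> ?A" "c' \<in> sphere_atlas" "x \<in> local_dom F c c'"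
    for c and c' :: "((real^'m) \<times> (real^'m), 'e) chart" and x v
  proof -
    have "smooth_on (local_dom F c c') (local_rep F c c')"
      using diffeo that by (simp add: diffeomorphism_def smooth_map_def)
    note r = sphere_local_rep[OF M that(1,2) contF this]
    show "param c' (local_rep F c c' x) = ?H c x" "x \<in> coord_image c"
      "FD (param c') (local_rep F c c' x) (local_deriv F c c' x v) = FD (?H c) x v"
      using r(3,4)[OF that(3)] that(3) by (auto simp: local_dom_eq[OF m(3)[OF that(1)]])
  qed
  have "pulls_back_form ?A (atlas ?S) F (contact_form ?S) (contact_form K)"
    unfolding pulls_back_form_def by (auto simp: rep form)
  moreover have "pulls_back_metric ?A (atlas ?S) F (metric_tensor ?S) (metric_tensor K)"
    unfolding pulls_back_metric_def by (auto simp: rep metric)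
  ultimately show ?thesis unfolding sasaki_equivalent_def using diffeo by auto
qed

end
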